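(* Let $R=k[x_1,\ldots,x_n]$ be a polynomial ring over a field $k$ in $n$ variables with its standard grading and let $M$ be a finitely generated graded $R$-module. Then $$a^*(M)=\max\{b_i(M)\mid i\ge0\}-n.$$
   Context: $R_+=(x_1,\ldots,x_n)$. $H^i_{R_+}(M)$ is the $i$-th (graded) local cohomology module of $M$ with respect to $R_+$, $a_i(M)=\sup\{t\mid H^i_{R_+}(M)_t\ne0\}$ (with $a_i(M)=-\infty$ if $H^i_{R_+}(M)=0$), and $a^*(M)=\max\{a_i(M)\mid i\ge0\}$. $b_i(M)$ is the maximal degree of the generators of $F_i$ in a minimal graded free resolution $0\to F_s\to\cdots\to F_0\to M\to0$, with $b_i(M)=-\infty$ if $F_i=0$. *)

theory Defs
  imports "HOL-Algebra.Module" "HOL-Algebra.Ideal_Product"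
    "HOL-Library.Poly_Mapping" "HOL-Library.Extended_Real"
begin

subsection \<open>The standard graded polynomial ring\<close>

text \<open>
  The variables are indexed from 0: the variable \<open>x_{i+1}\<close> of the usual notation is \<open>mvar i\<close>.
\<close>

type_synonym 'k mpoly = "(nat \<Rightarrow>\<^sub>0 nat) \<Rightarrow>\<^sub>0 'k"

definition poly_ring :: "nat \<Rightarrow> 'k::field mpoly ring" where
  "poly_ring n = \<lparr>carrier = {p. \<forall>m\<in>Poly_Mapping.keys p. Poly_Mapping.keys m \<subseteq> {..<n}},
                  mult = (*), one = 1, zero = 0, add = (+)\<rparr>"

definition mvar :: "nat \<Rightarrow> 'k::field mpoly" where
  "mvar i = Poly_Mapping.single (Poly_Mapping.single i 1) 1"

definition monom_degree :: "(nat \<Rightarrow>\<^sub>0 nat) \<Rightarrow> nat" where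
  "monom_degree m = (\<Sum>i\<in>Poly_Mapping.keys m. Poly_Mapping.lookup m i)"

definition poly_piece :: "nat \<Rightarrow> nat \<Rightarrow> 'k::field mpoly set" where
  "poly_piece n d = {p \<in> carrier (poly_ring n). \<forall>m\<in>Poly_Mapping.keys p. monom_degree m = d}"

definition irrelevant_ideal :: "nat \<Rightarrow> 'k::field mpoly set" where
  "irrelevant_ideal n = Idl\<^bsub>poly_ring n\<^esub> (mvar ` {..<n})"

lemma cring_poly_ring: "cring (poly_ring n :: 'k::field mpoly ring)"
proof -
  let ?R = "poly_ring n :: 'k mpoly ring"
  have add_closed: "p + q \<in> carrier ?R" if "p \<in> carrier ?R" "q \<in> carrier ?R" for p q
    using that set_mp[OF Poly_Mapping.keys_add[of p q]] by (auto simp: poly_ring_def)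
  have mult_closed: "p * q \<in> carrier ?R" if p: "p \<in> carrier ?R" and q: "q \<in> carrier ?R" for p q
  proof -
    have "Poly_Mapping.keys m \<subseteq> {..<n}" if m: "m \<in> Poly_Mapping.keys (p * q)" for m
    proof -
      obtain a b where ab: "m = a + b" "a \<in> Poly_Mapping.keys p" "b \<in> Poly_Mapping.keys q"
        using m keys_mult[of p q] by blast
      then have "Poly_Mapping.keys a \<subseteq> {..<n}" "Poly_Mapping.keys b \<subseteq> {..<n}"
        using p q by (auto simp: poly_ring_def)
      then show ?thesis
        using Poly_Mapping.keys_add[of a b] unfolding ab(1) by blast
    qed
    then show ?thesis by (simp add: poly_ring_def)
  qed
  have neg_closed: "- p \<in> carrier ?R" if "p \<in> carrier ?R" for p
    using that by (simp add: poly_ring_def)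
  have const_closed: "0 \<in> carrier ?R" "1 \<in> carrier ?R"
    by (simp_all add: poly_ring_def)
  have ops: "x \<oplus>\<^bsub>?R\<^esub> y = x + y" "x \<otimes>\<^bsub>?R\<^esub> y = x * y" "\<zero>\<^bsub>?R\<^esub> = 0" "\<one>\<^bsub>?R\<^esub> = 1" for x y
    by (simp_all add: poly_ring_def)
  have ex_neg: "\<exists>y\<in>carrier ?R. x + y = 0" if "x \<in> carrier ?R" for x
    using neg_closed[OF that] by (intro bexI[of _ "- x"]) simp_all
  show ?thesis
  proof (rule cringI)
    show "abelian_group ?R"
      by (rule abelian_groupI; unfold ops)
        (simp_all only: add_closed const_closed ex_neg ac_simps add_0_right)
    show "comm_monoid ?R"
      by (rule comm_monoidI; unfold ops)
        (simp_all only: mult_closed const_closed ac_simps mult_1_right mult_1_left)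
  qed (simp_all only: ops distrib_right)
qed


subsection \<open>Graded modules\<close>

record ('a, 'b) graded_module = "('a, 'b) module" +
  piece :: "int \<Rightarrow> 'b set"

definition graded_module :: "nat \<Rightarrow> ('k::field mpoly, 'b) graded_module \<Rightarrow> bool" where
  "graded_module n M \<longleftrightarrow>
     Module.module (poly_ring n) M \<and>
     (\<forall>d. additive_subgroup (piece M d) M) \<and>
     (\<forall>d e. \<forall>p\<in>poly_piece n d. \<forall>x\<in>piece M e. p \<odot>\<^bsub>M\<^esub> x \<in> piece M (int d + e)) \<and>
     (\<forall>x\<in>carrier M. \<exists>!f. (\<forall>d. f d \<in> piece M d) \<and> finite {d. f d \<noteq> \<zero>\<^bsub>M\<^esub>} \<and>
        x = finsum M f {d. f d \<noteq> \<zero>\<^bsub>M\<^esub>})"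

definition mod_span ::
  "nat \<Rightarrow> ('k::field mpoly, 'b) graded_module \<Rightarrow> 'b set \<Rightarrow> 'b set" where
  "mod_span n M S = \<Inter>{N. submodule N (poly_ring n) M \<and> S \<subseteq> N}"

definition finitely_generated :: "nat \<Rightarrow> ('k::field mpoly, 'b) graded_module \<Rightarrow> bool" where
  "finitely_generated n M \<longleftrightarrow>
     (\<exists>S. finite S \<and> S \<subseteq> carrier M \<and> mod_span n M S = carrier M)"

definition graded_hom ::
  "nat \<Rightarrow> ('k::field mpoly, 'b) graded_module \<Rightarrow> ('k mpoly, 'c) graded_module \<Rightarrow> ('b \<Rightarrow> 'c) set" where
  "graded_hom n M N =
     {f \<in> carrier M \<rightarrow> carrier N.
        (\<forall>x\<in>carrier M. \<forall>y\<in>carrier M. f (x \<oplus>\<^bsub>M\<^esub> y) = f x \<oplus>\<^bsub>N\<^esub> f y) \<and>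
        (\<forall>p\<in>carrier (poly_ring n). \<forall>x\<in>carrier M. f (p \<odot>\<^bsub>M\<^esub> x) = p \<odot>\<^bsub>N\<^esub> f x) \<and>
        (\<forall>d. f ` piece M d \<subseteq> piece N d)}"

definition ker_on ::
  "('a, 'b) graded_module \<Rightarrow> ('a, 'c) graded_module \<Rightarrow> ('b \<Rightarrow> 'c) \<Rightarrow> 'b set" where
  "ker_on M N f = {x \<in> carrier M. f x = \<zero>\<^bsub>N\<^esub>}"


subsection \<open>Graded local cohomology\<close>

text \<open>
  Injective objects of the category of graded modules and degree-preserving homomorphisms.
  HOL cannot quantify over the carrier types of the test modules \<open>N\<close> and \<open>P\<close>, so these are
  taken with carrier in the type of polynomials. They include the shifts of the ring and all its
  homogeneous ideals, so by the graded version of Baer's criterion this is injectivity with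
  respect to graded modules over arbitrary carrier types.
\<close>

definition graded_injective :: "nat \<Rightarrow> ('k::field mpoly, 'b) graded_module \<Rightarrow> bool" where
  "graded_injective n E \<longleftrightarrow>
     graded_module n E \<and>
     (\<forall>(N :: ('k mpoly, 'k mpoly) graded_module) (P :: ('k mpoly, 'k mpoly) graded_module).
        \<forall>j\<in>graded_hom n N P. \<forall>f\<in>graded_hom n N E.
          graded_module n N \<and> graded_module n P \<and> inj_on j (carrier N) \<longrightarrow>
          (\<exists>g\<in>graded_hom n P E. \<forall>x\<in>carrier N. g (j x) = f x))"

text \<open>
  Exactness of \<open>0 \<rightarrow> M \<rightarrow> E 0 \<rightarrow> E 1 \<rightarrow> \<dots>\<close> with maps \<open>\<eta>\<close>, \<open>\<delta> 0\<close>, \<open>\<delta> 1\<close>, ...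
\<close>

definition graded_injective_resolution ::
  "nat \<Rightarrow> ('k::field mpoly, 'm) graded_module \<Rightarrow> (nat \<Rightarrow> ('k mpoly, 'e) graded_module) \<Rightarrow>
   (nat \<Rightarrow> 'e \<Rightarrow> 'e) \<Rightarrow> ('m \<Rightarrow> 'e) \<Rightarrow> bool" where
  "graded_injective_resolution n M E \<delta> \<eta> \<longleftrightarrow>
     (\<forall>i. graded_injective n (E i)) \<and>
     \<eta> \<in> graded_hom n M (E 0) \<and>
     (\<forall>i. \<delta> i \<in> graded_hom n (E i) (E (Suc i))) \<and>
     inj_on \<eta> (carrier M) \<and>
     \<eta> ` carrier M = ker_on (E 0) (E 1) (\<delta> 0) \<and>
     (\<forall>i. \<delta> i ` carrier (E i) = ker_on (E (Suc i)) (E (Suc (Suc i))) (\<delta> (Suc i)))"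

definition torsion_elements :: "nat \<Rightarrow> ('k::field mpoly, 'b) graded_module \<Rightarrow> 'b set" where
  "torsion_elements n M =
     {x \<in> carrier M. \<exists>t::nat.
        \<forall>p \<in> irrelevant_ideal n [^]\<^bsub>ideals_set (poly_ring n)\<^esub> t. p \<odot>\<^bsub>M\<^esub> x = \<zero>\<^bsub>M\<^esub>}"

definition torsion_functor ::
  "nat \<Rightarrow> ('k::field mpoly, 'b) graded_module \<Rightarrow> ('k mpoly, 'b) graded_module" where
  "torsion_functor n M =
     M\<lparr>carrier := torsion_elements n M, piece := \<lambda>d. piece M d \<inter> torsion_elements n M\<rparr>"

fun coboundaries ::
  "(nat \<Rightarrow> ('a, 'b) graded_module) \<Rightarrow> (nat \<Rightarrow> 'b \<Rightarrow> 'b) \<Rightarrow> nat \<Rightarrow> 'b set" where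
  "coboundaries C \<delta> 0 = {\<zero>\<^bsub>C 0\<^esub>}"
| "coboundaries C \<delta> (Suc i) = \<delta> i ` carrier (C i)"

text \<open>
  The degree \<open>t\<close> piece of the \<open>i\<close>-th cohomology module of a cochain complex of graded modules,
  as a set of cosets. Its zero element is the coset \<open>coboundaries C \<delta> i\<close>.
\<close>

definition cohomology_piece ::
  "(nat \<Rightarrow> ('a, 'b) graded_module) \<Rightarrow> (nat \<Rightarrow> 'b \<Rightarrow> 'b) \<Rightarrow> nat \<Rightarrow> int \<Rightarrow> 'b set set" where
  "cohomology_piece C \<delta> i t =
     (\<lambda>z. coboundaries C \<delta> i +>\<^bsub>C i\<^esub> z) ` (ker_on (C i) (C (Suc i)) (\<delta> i) \<inter> piece (C i) t)"

text \<open>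
  Local cohomology with support in the irrelevant ideal is the right derived functor of the
  torsion functor. It is computed from an injective resolution \<open>(E, \<delta>)\<close> of the module, which is
  why the definitions below take the resolution as argument.
\<close>

definition local_cohomology_nonzero ::
  "nat \<Rightarrow> (nat \<Rightarrow> ('k::field mpoly, 'e) graded_module) \<Rightarrow> (nat \<Rightarrow> 'e \<Rightarrow> 'e) \<Rightarrow> nat \<Rightarrow> int \<Rightarrow> bool" where
  "local_cohomology_nonzero n E \<delta> i t \<longleftrightarrow>
     cohomology_piece (\<lambda>j. torsion_functor n (E j)) \<delta> i t
       \<noteq> {coboundaries (\<lambda>j. torsion_functor n (E j)) \<delta> i}"

definition a_invariant ::
  "nat \<Rightarrow> (nat \<Rightarrow> ('k::field mpoly, 'e) graded_module) \<Rightarrow> (nat \<Rightarrow> 'e \<Rightarrow> 'e) \<Rightarrow> nat \<Rightarrow> ereal" where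
  "a_invariant n E \<delta> i = Sup {ereal (of_int t) | t. local_cohomology_nonzero n E \<delta> i t}"

definition a_star ::
  "nat \<Rightarrow> (nat \<Rightarrow> ('k::field mpoly, 'e) graded_module) \<Rightarrow> (nat \<Rightarrow> 'e \<Rightarrow> 'e) \<Rightarrow> ereal" where
  "a_star n E \<delta> = (SUP i. a_invariant n E \<delta> i)"


subsection \<open>Minimal graded free resolutions\<close>

definition homogeneous_basis ::
  "nat \<Rightarrow> ('k::field mpoly, 'b) graded_module \<Rightarrow> 'b set \<Rightarrow> bool" where
  "homogeneous_basis n F B \<longleftrightarrow>
     finite B \<and> B \<subseteq> (\<Union>d. piece F d) \<and>
     (\<forall>x\<in>carrier F. \<exists>!c. c \<in> B \<rightarrow>\<^sub>E carrier (poly_ring n) \<and> x = finsum F (\<lambda>b. c b \<odot>\<^bsub>F\<^esub> b) B)"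

text \<open>
  Exactness of \<open>0 \<rightarrow> F s \<rightarrow> \<dots> \<rightarrow> F 1 \<rightarrow> F 0 \<rightarrow> M \<rightarrow> 0\<close> with maps \<open>\<phi> i : F (i+1) \<rightarrow> F i\<close> and
  \<open>\<epsilon> : F 0 \<rightarrow> M\<close>, where \<open>B i\<close> is a finite homogeneous basis of \<open>F i\<close>. Minimality means that
  the image of each \<open>\<phi> i\<close> lies in the product of the irrelevant ideal with \<open>F i\<close>.
\<close>

definition minimal_graded_free_resolution ::
  "nat \<Rightarrow> ('k::field mpoly, 'm) graded_module \<Rightarrow> (nat \<Rightarrow> ('k mpoly, 'f) graded_module) \<Rightarrow>
   (nat \<Rightarrow> 'f \<Rightarrow> 'f) \<Rightarrow> ('f \<Rightarrow> 'm) \<Rightarrow> (nat \<Rightarrow> 'f set) \<Rightarrow> bool" where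
  "minimal_graded_free_resolution n M F \<phi> \<epsilon> B \<longleftrightarrow>
     (\<forall>i. graded_module n (F i) \<and> homogeneous_basis n (F i) (B i)) \<and>
     \<epsilon> \<in> graded_hom n (F 0) M \<and>
     (\<forall>i. \<phi> i \<in> graded_hom n (F (Suc i)) (F i)) \<and>
     \<epsilon> ` carrier (F 0) = carrier M \<and>
     \<phi> 0 ` carrier (F 1) = ker_on (F 0) M \<epsilon> \<and>
     (\<forall>i. \<phi> (Suc i) ` carrier (F (Suc (Suc i))) = ker_on (F (Suc i)) (F i) (\<phi> i)) \<and>
     (\<exists>s. \<forall>i>s. carrier (F i) = {\<zero>\<^bsub>F i\<^esub>}) \<and>
     (\<forall>i. \<phi> i ` carrier (F (Suc i)) \<subseteq>
        mod_span n (F i) {p \<odot>\<^bsub>F i\<^esub> x | p x. p \<in> irrelevant_ideal n \<and> x \<in> carrier (F i)})"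

definition b_invariant ::
  "(nat \<Rightarrow> ('a, 'f) graded_module) \<Rightarrow> (nat \<Rightarrow> 'f set) \<Rightarrow> nat \<Rightarrow> ereal" where
  "b_invariant F B i = Sup {ereal (of_int d) | d. \<exists>b\<in>B i. b \<in> piece (F i) d}"

end

theory Submission
  imports Defs
begin

text \<open>
  Write \<open>C\<close> for the torsion subcomplex of the injective resolution \<open>E\<close> and \<open>C_j\<close> for the elements of \<open>C\<close>
  killed by the first \<open>j\<close> variables. Injectivity makes \<open>0 \<rightarrow> C_{j+1} \<rightarrow> C_j \<rightarrow> C_j(1) \<rightarrow> 0\<close> exact, where the
  second map is multiplication by the next variable. Hence if the cohomology of \<open>C_j\<close> vanishes in all
  degrees above \<open>a\<close>, so does that of \<open>C_{j+1}\<close>. Conversely, if the cohomology of \<open>C_{j+1}\<close> vanishes above \<open>a\<close>,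
  the variable acts injectively on the cohomology of \<open>C_j\<close> above \<open>a\<close>, and that cohomology is zero because
  it is torsion. So the top degree of local cohomology is that of the cohomology of the socle complex
  \<open>C_n\<close>, which is \<open>Ext(k, M)\<close>.

  By dimension shifting along \<open>E\<close>, the cohomology of the socle complex in degree \<open>t\<close> vanishes exactly when
  the Koszul cohomology of \<open>M\<close> does, since the Koszul complex of an injective module is exact in positive
  degrees. By dimension shifting along the minimal free resolution, the Koszul cohomology of \<open>M\<close> in
  cohomological degree \<open>n - i\<close> and internal degree \<open>t\<close> vanishes exactly when \<open>F_i\<close> has no generator of
  degree \<open>t + n\<close>.
\<close>

text \<open>Only vanishing is compared, so no quotient modules or connecting maps are built: each
  link of a long exact sequence becomes the claim that certain cochains are coboundaries or that
  certain cocycles lift. Both resolutions are given data, and every argument runs on them directly,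
  without comparison maps between resolutions.

  Injectivity is used through a single consequence, division by a variable. It makes the variables a
  coregular sequence on each term of the injective resolution; on a free module they form a regular
  sequence. Koszul exactness away from one end follows from these two facts by parallel inductions
  on the number of variables.

  Socle and generators correspond in every single internal degree. Torsion and socle do not:
  multiplication by a variable raises the degree, so only vanishing in all degrees above a bound
  passes both ways, and this is just enough for a top degree.

  The constant \<open>n\<close> is the twist of the top Koszul cochains. A cochain of degree
  \<open>p\<close> and internal degree \<open>t\<close> has its values in degree
  \<open>t + p\<close>, so the top cohomology in internal degree \<open>t\<close> sees generators of
  degree \<open>t + n\<close>.\<close>

abbreviation "lookup \<equiv> Poly_Mapping.lookup"
abbreviation "keys \<equiv> Poly_Mapping.keys"
abbreviation "single \<equiv> Poly_Mapping.single"

section \<open>Polynomials in n variables and degrees of monomials\<close>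

lemma poly_ring_simps [simp]:
  "a \<oplus>\<^bsub>poly_ring n\<^esub> b = a + b" "a \<otimes>\<^bsub>poly_ring n\<^esub> b = a * b"
  "\<zero>\<^bsub>poly_ring n\<^esub> = 0" "\<one>\<^bsub>poly_ring n\<^esub> = 1"
  by (simp_all add: poly_ring_def)

lemma poly_ring_carrier: "p \<in> carrier (poly_ring n) \<longleftrightarrow> (\<forall>m\<in>keys p. keys m \<subseteq> {..<n})"
  by (simp add: poly_ring_def)

lemma carrier_add: "p \<in> carrier (poly_ring n) \<Longrightarrow> q \<in> carrier (poly_ring n) \<Longrightarrow> p + q \<in> carrier (poly_ring n)"
  using cring.cring_simprules(1)[OF cring_poly_ring, of p n q] by simp

lemma carrier_mult: "p \<in> carrier (poly_ring n) \<Longrightarrow> q \<in> carrier (poly_ring n) \<Longrightarrow> p * q \<in> carrier (poly_ring n)"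
  using cring.cring_simprules(5)[OF cring_poly_ring, of p n q] by simp

lemma carrier_single: "keys u \<subseteq> {..<n} \<Longrightarrow> single u a \<in> carrier (poly_ring n)"
  by (auto simp: poly_ring_carrier split: if_splits)

lemma mvar_carrier [simp]: "i < n \<Longrightarrow> mvar i \<in> carrier (poly_ring n)"
  unfolding mvar_def by (rule carrier_single) simp

lemma carrier_0 [simp]: "0 \<in> carrier (poly_ring n)" and carrier_1 [simp]: "1 \<in> carrier (poly_ring n)"
  by (simp_all add: poly_ring_carrier)

lemma monom_degree_eq_sum:
  assumes "finite A" "keys m \<subseteq> A" shows "monom_degree m = (\<Sum>i\<in>A. lookup m i)"
  unfolding monom_degree_def
  by (rule sum.mono_neutral_left) (use assms in \<open>auto simp: in_keys_iff\<close>)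

lemma monom_degree_add: "monom_degree (a + b) = monom_degree a + monom_degree b"
proof -
  have "keys (a + b) \<subseteq> keys a \<union> keys b" by (rule Poly_Mapping.keys_add)
  then show ?thesis
    using monom_degree_eq_sum[of "keys a \<union> keys b" a] monom_degree_eq_sum[of "keys a \<union> keys b" b]
      monom_degree_eq_sum[of "keys a \<union> keys b" "a + b"]
    by (simp add: lookup_add sum.distrib)
qed

lemma monom_degree_single [simp]: "monom_degree (single i c) = c"
  by (cases "c = 0") (simp_all add: monom_degree_def)

lemma monom_degree_0 [simp]: "monom_degree 0 = 0"
  by (simp add: monom_degree_def)

lemma monom_degree_eq_0_iff: "monom_degree m = 0 \<longleftrightarrow> m = 0"
  by (auto simp: monom_degree_def in_keys_iff intro!: poly_mapping_eqI)

lemma monom_split_variable: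
  assumes "lookup u j \<noteq> 0"
  obtains u' where "u = u' + single j (1::nat)" "keys u' \<subseteq> keys u"
proof
  show "u = (u - single j 1) + single j 1"
    by (rule poly_mapping_eqI) (use assms in \<open>auto simp: lookup_add lookup_minus lookup_single when_def\<close>)
  show "keys (u - single j 1) \<subseteq> keys u"
    by (auto simp: in_keys_iff lookup_minus)
qed

lemma mvar_mult_single: "mvar i * single u a = single (u + single i 1) a"
  by (simp add: mvar_def mult_single add.commute)

lemma poly_mapping_eq_sum_single: "p = (\<Sum>u\<in>keys p. single u (lookup p u))"
proof (rule poly_mapping_eqI)
  fix v
  have "lookup (\<Sum>u\<in>keys p. single u (lookup p u)) v = (\<Sum>u\<in>keys p. if u = v then lookup p u else 0)"
    by (simp add: lookup_sum lookup_single when_def)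
  then show "lookup p v = lookup (\<Sum>u\<in>keys p. single u (lookup p u)) v"
    by (simp add: sum.delta in_keys_iff)
qed

subsection \<open>Graded modules\<close>

locale gmod =
  fixes n :: nat and M :: "('k::field mpoly, 'b) graded_module"
  assumes gm: "graded_module n M"
begin

sublocale Module.module "poly_ring n" M
  using gm by (simp add: graded_module_def)

lemma piece_subgroup: "additive_subgroup (piece M d) M"
  using gm by (simp add: graded_module_def)

lemma piece_carr: "x \<in> piece M d \<Longrightarrow> x \<in> carrier M"
  using piece_subgroup additive_subgroup.a_Hcarr by metis

lemma piece_zero [simp]: "\<zero>\<^bsub>M\<^esub> \<in> piece M d"
  using piece_subgroup additive_subgroup.zero_closed by metis

lemma piece_add: "x \<in> piece M d \<Longrightarrow> y \<in> piece M d \<Longrightarrow> x \<oplus>\<^bsub>M\<^esub> y \<in> piece M d"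
  using piece_subgroup additive_subgroup.a_closed by metis

lemma piece_neg: "x \<in> piece M d \<Longrightarrow> \<ominus>\<^bsub>M\<^esub> x \<in> piece M d"
  using piece_subgroup[of d] abelian_group.a_inv_closed
  by (metis a_inv_def additive_subgroup.a_subgroup subgroup.m_inv_closed)

lemma piece_diff: "x \<in> piece M d \<Longrightarrow> y \<in> piece M d \<Longrightarrow> x \<ominus>\<^bsub>M\<^esub> y \<in> piece M d"
  by (simp add: a_minus_def piece_add piece_neg)

lemma piece_smult: "p \<in> poly_piece n d \<Longrightarrow> x \<in> piece M e \<Longrightarrow> p \<odot>\<^bsub>M\<^esub> x \<in> piece M (int d + e)"
  using gm by (simp add: graded_module_def)

lemma piece_single:
  assumes "keys u \<subseteq> {..<n}" "x \<in> piece M e"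
  shows "single u a \<odot>\<^bsub>M\<^esub> x \<in> piece M (int (monom_degree u) + e)"
  by (rule piece_smult) (use assms in \<open>auto simp: poly_piece_def carrier_single split: if_splits\<close>)

lemma piece_var: "i < n \<Longrightarrow> x \<in> piece M e \<Longrightarrow> mvar i \<odot>\<^bsub>M\<^esub> x \<in> piece M (e + 1)"
  using piece_single[of "single i 1" x e 1] by (simp add: mvar_def add.commute)

lemma smult_comm:
  assumes "p \<in> carrier (poly_ring n)" "q \<in> carrier (poly_ring n)" "x \<in> carrier M"
  shows "p \<odot>\<^bsub>M\<^esub> (q \<odot>\<^bsub>M\<^esub> x) = q \<odot>\<^bsub>M\<^esub> (p \<odot>\<^bsub>M\<^esub> x)"
  using smult_assoc1[of p q x] smult_assoc1[of q p x] assms by (simp add: mult.commute)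

lemma smult_diff:
  assumes "p \<in> carrier (poly_ring n)" "x \<in> carrier M" "y \<in> carrier M"
  shows "p \<odot>\<^bsub>M\<^esub> (x \<ominus>\<^bsub>M\<^esub> y) = p \<odot>\<^bsub>M\<^esub> x \<ominus>\<^bsub>M\<^esub> p \<odot>\<^bsub>M\<^esub> y"
  using assms by (simp add: a_minus_def smult_r_distr smult_r_minus)

lemma diff_eq_zero_iff:
  "x \<in> carrier M \<Longrightarrow> y \<in> carrier M \<Longrightarrow> x \<ominus>\<^bsub>M\<^esub> y = \<zero>\<^bsub>M\<^esub> \<longleftrightarrow> x = y"
  by (metis M.add.inv_closed M.minus_equality M.minus_minus M.r_neg a_minus_def)

lemma diff_add_cancel:
  "x \<in> carrier M \<Longrightarrow> y \<in> carrier M \<Longrightarrow> (x \<ominus>\<^bsub>M\<^esub> y) \<oplus>\<^bsub>M\<^esub> y = x"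
  by (simp add: a_minus_def M.a_assoc M.l_neg)

lemma finsum_in_subgroup:
  assumes "additive_subgroup H M" "\<And>i. i \<in> A \<Longrightarrow> f i \<in> H"
  shows "finsum M f A \<in> H"
proof (cases "finite A")
  case True
  then show ?thesis using assms(2)
  proof (induction A rule: finite_induct)
    case empty
    then show ?case using additive_subgroup.zero_closed[OF assms(1)] by simp
  next
    case (insert i A)
    then have "finsum M f (insert i A) = f i \<oplus>\<^bsub>M\<^esub> finsum M f A"
      using additive_subgroup.a_Hcarr[OF assms(1)] by (intro M.finsum_insert) auto
    then show ?case using insert additive_subgroup.a_closed[OF assms(1)] by auto
  qed
next
  case False
  then show ?thesis using additive_subgroup.zero_closed[OF assms(1)]
    by (simp add: M.finsum_infinite)
qed

lemma smult_sum_left: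
  assumes "finite K" "\<And>k. k \<in> K \<Longrightarrow> f k \<in> carrier (poly_ring n)" "x \<in> carrier M"
  shows "sum f K \<in> carrier (poly_ring n) \<and> sum f K \<odot>\<^bsub>M\<^esub> x = finsum M (\<lambda>k. f k \<odot>\<^bsub>M\<^esub> x) K"
  using assms
proof (induction K rule: finite_induct)
  case empty
  then show ?case using smult_l_null by simp
next
  case (insert k K)
  then have "(f k + sum f K) \<odot>\<^bsub>M\<^esub> x = f k \<odot>\<^bsub>M\<^esub> x \<oplus>\<^bsub>M\<^esub> sum f K \<odot>\<^bsub>M\<^esub> x"
    using smult_l_distr[of "f k" "sum f K" x] by simp
  moreover have "finsum M (\<lambda>k. f k \<odot>\<^bsub>M\<^esub> x) (insert k K) = f k \<odot>\<^bsub>M\<^esub> x \<oplus>\<^bsub>M\<^esub> finsum M (\<lambda>k. f k \<odot>\<^bsub>M\<^esub> x) K"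
    using insert by (intro M.finsum_insert) auto
  ultimately show ?case using insert by (auto intro: carrier_add)
qed

text \<open>Only additive closure of \<open>H\<close> is asked for, so this reduction to monomials
  also applies to graded pieces and to the elements without a part of some degree, which are not
  submodules.\<close>

lemma smult_in_subgroup:
  assumes p: "p \<in> carrier (poly_ring n)" and x: "x \<in> carrier M" and H: "additive_subgroup H M"
    and mon: "\<And>u. u \<in> keys p \<Longrightarrow> single u (lookup p u) \<odot>\<^bsub>M\<^esub> x \<in> H"
  shows "p \<odot>\<^bsub>M\<^esub> x \<in> H"
proof -
  have "(\<Sum>u\<in>keys p. single u (lookup p u)) \<odot>\<^bsub>M\<^esub> x
      = finsum M (\<lambda>u. single u (lookup p u) \<odot>\<^bsub>M\<^esub> x) (keys p)"
    using smult_sum_left[of "keys p" "\<lambda>u. single u (lookup p u)" x] p x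
    by (simp add: carrier_single poly_ring_carrier[of p])
  then have "p \<odot>\<^bsub>M\<^esub> x = finsum M (\<lambda>u. single u (lookup p u) \<odot>\<^bsub>M\<^esub> x) (keys p)"
    by (simp only: poly_mapping_eq_sum_single[symmetric])
  then show ?thesis using finsum_in_subgroup[OF H mon] by simp
qed

lemma zero_subgroup: "additive_subgroup {\<zero>\<^bsub>M\<^esub>} M"
  by (rule additive_subgroup.intro) (rule M.add.triv_subgroup[simplified])

lemma single_smult_eq_zero:
  assumes "keys u \<subseteq> {..<n}" "x \<in> carrier M" "single u 1 \<odot>\<^bsub>M\<^esub> x = \<zero>\<^bsub>M\<^esub>"
  shows "single u a \<odot>\<^bsub>M\<^esub> x = \<zero>\<^bsub>M\<^esub>"
proof -
  have "single u a = single 0 a * single u 1" by (simp add: mult_single)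
  then show ?thesis
    using smult_assoc1[of "single 0 a" "single u 1" x] assms by (simp add: carrier_single)
qed

lemma smult_eq_zero_keys:
  assumes p: "p \<in> carrier (poly_ring n)" and x: "x \<in> carrier M"
    and mon: "\<And>u. u \<in> keys p \<Longrightarrow> single u 1 \<odot>\<^bsub>M\<^esub> x = \<zero>\<^bsub>M\<^esub>"
  shows "p \<odot>\<^bsub>M\<^esub> x = \<zero>\<^bsub>M\<^esub>"
proof -
  have "p \<odot>\<^bsub>M\<^esub> x \<in> {\<zero>\<^bsub>M\<^esub>}"
    by (rule smult_in_subgroup[OF p x zero_subgroup])
      (use p x mon single_smult_eq_zero in \<open>auto simp: poly_ring_carrier\<close>)
  then show ?thesis by simp
qed

lemma single_add_smult:
  assumes "keys u \<subseteq> {..<n}" "keys v \<subseteq> {..<n}" "x \<in> carrier M"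
  shows "single (u + v) 1 \<odot>\<^bsub>M\<^esub> x = single u 1 \<odot>\<^bsub>M\<^esub> (single v 1 \<odot>\<^bsub>M\<^esub> x)"
  using smult_assoc1[of "single u 1" "single v 1" x] assms by (simp add: mult_single carrier_single)

definition component :: "'b \<Rightarrow> int \<Rightarrow> 'b" where
  "component x = (THE f. (\<forall>d. f d \<in> piece M d) \<and> finite {d. f d \<noteq> \<zero>\<^bsub>M\<^esub>} \<and>
        x = finsum M f {d. f d \<noteq> \<zero>\<^bsub>M\<^esub>})"

lemma component:
  assumes "x \<in> carrier M"
  shows "component x d \<in> piece M d" "finite {d. component x d \<noteq> \<zero>\<^bsub>M\<^esub>}"
    "finsum M (component x) {d. component x d \<noteq> \<zero>\<^bsub>M\<^esub>} = x"
proof -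
  have "\<exists>!f. (\<forall>d. f d \<in> piece M d) \<and> finite {d. f d \<noteq> \<zero>\<^bsub>M\<^esub>} \<and> x = finsum M f {d. f d \<noteq> \<zero>\<^bsub>M\<^esub>}"
    using gm assms by (simp add: graded_module_def)
  from theI'[OF this] show "component x d \<in> piece M d" "finite {d. component x d \<noteq> \<zero>\<^bsub>M\<^esub>}"
    "finsum M (component x) {d. component x d \<noteq> \<zero>\<^bsub>M\<^esub>} = x"
    unfolding component_def[symmetric] by auto
qed

lemma component_carr: "x \<in> carrier M \<Longrightarrow> component x d \<in> carrier M"
  using component(1) piece_carr by blast

text \<open>The index set \<open>A\<close> may be larger than the support of \<open>f\<close>. This
  allows two elements to be decomposed over a common set, as needed for sums.\<close>

lemma component_unique:
  assumes fA: "finite A" and f: "\<And>d. f d \<in> piece M d" and out: "\<And>d. d \<notin> A \<Longrightarrow> f d = \<zero>\<^bsub>M\<^esub>"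
    and x: "x = finsum M f A"
  shows "component x = f"
proof -
  have sub: "{d. f d \<noteq> \<zero>\<^bsub>M\<^esub>} \<subseteq> A" using out by auto
  have "finsum M f {d. f d \<noteq> \<zero>\<^bsub>M\<^esub>} = finsum M f A"
    by (rule M.add.finprod_mono_neutral_cong_left[folded finsum_def])
       (use fA sub f piece_carr in auto)
  moreover have xc: "x \<in> carrier M" unfolding x using f piece_carr by (intro M.finsum_closed) auto
  moreover have "\<exists>!f. (\<forall>d. f d \<in> piece M d) \<and> finite {d. f d \<noteq> \<zero>\<^bsub>M\<^esub>} \<and> x = finsum M f {d. f d \<noteq> \<zero>\<^bsub>M\<^esub>}"
    using gm xc by (simp add: graded_module_def)
  ultimately show ?thesis
    unfolding component_def using f x finite_subset[OF sub fA] by (intro the1_equality) auto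
qed

lemma component_finsum:
  assumes "x \<in> carrier M"
  obtains A where "finite A" "\<And>d. d \<notin> A \<Longrightarrow> component x d = \<zero>\<^bsub>M\<^esub>" "finsum M (component x) A = x"
  using component[OF assms] that by blast

lemma component_extend:
  assumes "x \<in> carrier M" "finite A'"
  obtains A where "finite A" "A' \<subseteq> A" "\<And>d. d \<notin> A \<Longrightarrow> component x d = \<zero>\<^bsub>M\<^esub>" "finsum M (component x) A = x"
proof -
  obtain A where A: "finite A" "\<And>d. d \<notin> A \<Longrightarrow> component x d = \<zero>\<^bsub>M\<^esub>" "finsum M (component x) A = x"
    using component_finsum[OF assms(1)] by blast
  have "finsum M (component x) A = finsum M (component x) (A \<union> A')"
    by (rule M.add.finprod_mono_neutral_cong_left[folded finsum_def])
       (use A assms component_carr in auto)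
  then show ?thesis using A assms(2) by (intro that[of "A \<union> A'"]) auto
qed

lemma component_add:
  assumes x: "x \<in> carrier M" and y: "y \<in> carrier M"
  shows "component (x \<oplus>\<^bsub>M\<^esub> y) d = component x d \<oplus>\<^bsub>M\<^esub> component y d"
proof -
  obtain A where A: "finite A" "\<And>d. d \<notin> A \<Longrightarrow> component x d = \<zero>\<^bsub>M\<^esub>"
    "finsum M (component x) A = x"
    using component_finsum[OF x] by blast
  obtain A' where A': "finite A'" "A \<subseteq> A'" "\<And>d. d \<notin> A' \<Longrightarrow> component y d = \<zero>\<^bsub>M\<^esub>"
    "finsum M (component y) A' = y"
    using component_extend[OF y A(1)] by blast
  have ex: "finsum M (component x) A = finsum M (component x) A'"
    by (rule M.add.finprod_mono_neutral_cong_left[folded finsum_def])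
       (use A A' x component_carr in auto)
  have "component (x \<oplus>\<^bsub>M\<^esub> y) = (\<lambda>d. component x d \<oplus>\<^bsub>M\<^esub> component y d)"
  proof (rule component_unique[OF A'(1)])
    show "component x d \<oplus>\<^bsub>M\<^esub> component y d \<in> piece M d" for d
      by (intro piece_add component x y)
    show "component x d \<oplus>\<^bsub>M\<^esub> component y d = \<zero>\<^bsub>M\<^esub>" if "d \<notin> A'" for d
    proof -
      have "d \<notin> A" using that A'(2) by blast
      then show ?thesis using A(2)[of d] A'(3)[OF that] by simp
    qed
    have "finsum M (\<lambda>d. component x d \<oplus>\<^bsub>M\<^esub> component y d) A'
       = finsum M (component x) A' \<oplus>\<^bsub>M\<^esub> finsum M (component y) A'"
      by (rule M.finsum_addf) (use component_carr x y in auto)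
    then show "x \<oplus>\<^bsub>M\<^esub> y = finsum M (\<lambda>d. component x d \<oplus>\<^bsub>M\<^esub> component y d) A'"
      using ex A A' by simp
  qed
  then show ?thesis by simp
qed

lemma component_piece:
  assumes "x \<in> piece M e" shows "component x d = (if d = e then x else \<zero>\<^bsub>M\<^esub>)"
proof -
  have "component x = (\<lambda>d. if d = e then x else \<zero>\<^bsub>M\<^esub>)"
    by (rule component_unique[of "{e}"]) (use assms piece_carr in \<open>auto\<close>)
  then show ?thesis by simp
qed

lemma component_zero [simp]: "component \<zero>\<^bsub>M\<^esub> d = \<zero>\<^bsub>M\<^esub>"
  using component_piece[of "\<zero>\<^bsub>M\<^esub>" d d] by simp

lemma piece_unique:
  "x \<in> piece M d \<Longrightarrow> x \<in> piece M e \<Longrightarrow> x \<noteq> \<zero>\<^bsub>M\<^esub> \<Longrightarrow> d = e"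
  using component_piece[of x d d] component_piece[of x e d] by (auto split: if_splits)

text \<open>Lets one show through \<open>smult_in_subgroup\<close> that a combination of terms in
  wrong degrees contributes nothing in degree \<open>d\<close>.\<close>

lemma component_kernel_subgroup: "additive_subgroup {y \<in> carrier M. component y d = \<zero>\<^bsub>M\<^esub>} M"
proof (rule additive_subgroup.intro, rule M.add.subgroupI, goal_cases)
  case 2
  then show ?case by (auto intro: exI[of _ "\<zero>\<^bsub>M\<^esub>"])
next
  case (3 a)
  then have a: "a \<in> carrier M" "component a d = \<zero>\<^bsub>M\<^esub>" by auto
  have "component (\<ominus>\<^bsub>M\<^esub> a \<oplus>\<^bsub>M\<^esub> a) d = component (\<ominus>\<^bsub>M\<^esub> a) d \<oplus>\<^bsub>M\<^esub> component a d"
    using a by (intro component_add) auto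
  then have "component (\<ominus>\<^bsub>M\<^esub> a) d = \<zero>\<^bsub>M\<^esub>"
    using a by (simp add: M.l_neg component_carr)
  then show ?case using a by (simp add: a_inv_def[symmetric])
next
  case (4 a b)
  then show ?case by (auto simp: component_add)
qed auto

lemma component_single:
  assumes x: "x \<in> carrier M" and u: "keys u \<subseteq> {..<n}"
  shows "component (single u a \<odot>\<^bsub>M\<^esub> x) (int (monom_degree u) + d) = single u a \<odot>\<^bsub>M\<^esub> component x d"
proof -
  let ?k = "int (monom_degree u)"
  obtain A where A: "finite A" "\<And>d. d \<notin> A \<Longrightarrow> component x d = \<zero>\<^bsub>M\<^esub>"
    "finsum M (component x) A = x"
    using component_finsum[OF x] by blast
  have "component (single u a \<odot>\<^bsub>M\<^esub> x) = (\<lambda>e. single u a \<odot>\<^bsub>M\<^esub> component x (e - ?k))"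
  proof (rule component_unique)
    show "finite ((\<lambda>d. ?k + d) ` A)" using A by simp
    show "single u a \<odot>\<^bsub>M\<^esub> component x (e - ?k) \<in> piece M e" for e
      using piece_single[OF u component(1)[OF x, of "e - ?k"]] by simp
    show "single u a \<odot>\<^bsub>M\<^esub> component x (e - ?k) = \<zero>\<^bsub>M\<^esub>" if "e \<notin> (\<lambda>d. ?k + d) ` A" for e
    proof -
      have "e - ?k \<notin> A" using that by force
      then show ?thesis using A u by (simp add: carrier_single)
    qed
    have "finsum M (\<lambda>e. single u a \<odot>\<^bsub>M\<^esub> component x (e - ?k)) ((\<lambda>d. ?k + d) ` A)
        = finsum M (\<lambda>d. single u a \<odot>\<^bsub>M\<^esub> component x d) A"
      using M.finsum_reindex[of "\<lambda>e. single u a \<odot>\<^bsub>M\<^esub> component x (e - ?k)" "\<lambda>d. ?k + d" A]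
        u x by (auto simp: carrier_single component_carr)
    also have "\<dots> = single u a \<odot>\<^bsub>M\<^esub> x"
      using finsum_smult_ldistr[of A "single u a" "component x"] A u x
      by (auto simp: carrier_single component_carr)
    finally show "single u a \<odot>\<^bsub>M\<^esub> x
      = finsum M (\<lambda>e. single u a \<odot>\<^bsub>M\<^esub> component x (e - ?k)) ((\<lambda>d. ?k + d) ` A)" by simp
  qed
  then show ?thesis by simp
qed

end

section \<open>Degree-preserving homomorphisms\<close>

locale ghom = M: gmod n M + N: gmod n N
  for n and M :: "('k::field mpoly, 'b) graded_module" and N :: "('k mpoly, 'c) graded_module" +
  fixes h :: "'b \<Rightarrow> 'c"
  assumes gh: "h \<in> graded_hom n M N"
begin

lemma hom_carr [simp]: "x \<in> carrier M \<Longrightarrow> h x \<in> carrier N"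
  using gh by (auto simp: graded_hom_def)

lemma hom_piece: "x \<in> piece M d \<Longrightarrow> h x \<in> piece N d"
  using gh by (simp add: graded_hom_def) blast

lemma hom_add: "x \<in> carrier M \<Longrightarrow> y \<in> carrier M \<Longrightarrow> h (x \<oplus>\<^bsub>M\<^esub> y) = h x \<oplus>\<^bsub>N\<^esub> h y"
  using gh by (auto simp: graded_hom_def)

lemma hom_smult: "p \<in> carrier (poly_ring n) \<Longrightarrow> x \<in> carrier M \<Longrightarrow> h (p \<odot>\<^bsub>M\<^esub> x) = p \<odot>\<^bsub>N\<^esub> h x"
  using gh by (auto simp: graded_hom_def)

lemma hom_zero [simp]: "h \<zero>\<^bsub>M\<^esub> = \<zero>\<^bsub>N\<^esub>"
  using hom_smult[of 0 "\<zero>\<^bsub>M\<^esub>"] M.smult_l_null[of "\<zero>\<^bsub>M\<^esub>"] N.smult_l_null[of "h \<zero>\<^bsub>M\<^esub>"] by simp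

lemma hom_neg: "x \<in> carrier M \<Longrightarrow> h (\<ominus>\<^bsub>M\<^esub> x) = \<ominus>\<^bsub>N\<^esub> h x"
  using hom_add[of "\<ominus>\<^bsub>M\<^esub> x" x] by (simp add: M.M.l_neg N.M.minus_equality)

lemma hom_diff: "x \<in> carrier M \<Longrightarrow> y \<in> carrier M \<Longrightarrow> h (x \<ominus>\<^bsub>M\<^esub> y) = h x \<ominus>\<^bsub>N\<^esub> h y"
  by (simp add: a_minus_def hom_add hom_neg)

lemma hom_finsum:
  assumes "finite A" "\<And>i. i \<in> A \<Longrightarrow> f i \<in> carrier M"
  shows "h (finsum M f A) = finsum N (\<lambda>i. h (f i)) A"
  using assms
proof (induction A rule: finite_induct)
  case (insert i A)
  then have "finsum M f (insert i A) = f i \<oplus>\<^bsub>M\<^esub> finsum M f A"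
    "finsum N (\<lambda>i. h (f i)) (insert i A) = h (f i) \<oplus>\<^bsub>N\<^esub> finsum N (\<lambda>i. h (f i)) A"
    by (auto intro!: M.M.finsum_insert N.M.finsum_insert)
  moreover have "finsum M f A \<in> carrier M" using insert by (intro M.M.finsum_closed) auto
  ultimately show ?case using insert by (simp add: hom_add)
qed simp

lemma hom_component:
  assumes x: "x \<in> carrier M" shows "N.component (h x) d = h (M.component x d)"
proof -
  obtain A where A: "finite A" "\<And>d. d \<notin> A \<Longrightarrow> M.component x d = \<zero>\<^bsub>M\<^esub>"
    "finsum M (M.component x) A = x"
    using M.component_finsum[OF x] by blast
  have "N.component (h x) = (\<lambda>d. h (M.component x d))"
    by (rule N.component_unique[OF A(1)])
      (use A x hom_finsum[OF A(1), of "M.component x"] in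
        \<open>auto simp: hom_piece M.component M.component_carr\<close>)
  then show ?thesis by simp
qed

text \<open>Since \<open>h\<close> commutes with components, any preimage of \<open>z\<close> can be
  replaced by its component of degree \<open>t\<close>.\<close>

lemma hom_lift_piece:
  assumes "z \<in> piece N t" "z \<in> h ` carrier M"
  obtains w where "w \<in> piece M t" "h w = z"
proof -
  obtain w where w: "w \<in> carrier M" "z = h w" using assms by auto
  have "h (M.component w t) = z"
    using hom_component[OF w(1), of t] w N.component_piece[OF assms(1)] by simp
  then show ?thesis using that M.component(1)[OF w(1)] by blast
qed

end

subsection \<open>Division by a variable\<close>

text \<open>Pulling coefficients back along the injective shift m -> m + e_j divides by x_j and
  forgets the monomials that do not involve x_j.\<close>

definition var_div :: "nat \<Rightarrow> 'k::field mpoly \<Rightarrow> 'k mpoly" where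
  "var_div j p = Poly_Mapping.map_key (\<lambda>m. m + single j 1) p"

definition var_free :: "nat \<Rightarrow> 'k::field mpoly \<Rightarrow> 'k mpoly" where
  "var_free j p = Poly_Mapping.mapp (\<lambda>m a. a when lookup m j = 0) p"

lemma lookup_var_div [simp]: "lookup (var_div j p) m = lookup p (m + single j 1)"
  unfolding var_div_def by (subst map_key.rep_eq) (auto simp: inj_def)

lemma lookup_var_free [simp]: "lookup (var_free j p) m = (if lookup m j = 0 then lookup p m else 0)"
  by (auto simp: var_free_def lookup_mapp when_def in_keys_iff)

lemma var_div_add: "var_div j (p + q) = var_div j p + var_div j q"
  by (rule poly_mapping_eqI) (simp add: lookup_add)

lemma lookup_mvar_mult:
  "lookup (mvar j * p) m = (if lookup m j = 0 then 0 else lookup p (m - single j 1))"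
proof -
  have "lookup (mvar j * p) m = (\<Sum>l. lookup (mvar j) l * (\<Sum>q. lookup p q when m = l + q))"
    by (simp add: lookup_mult)
  also have "\<dots> = (\<Sum>l. (\<Sum>q. lookup p q when m = l + q) when l = single j 1)"
    by (rule Sum_any.cong) (simp add: mvar_def lookup_single when_def)
  also have "\<dots> = (\<Sum>q. lookup p q when m = single j 1 + q)" by simp
  also have "\<dots> = (if lookup m j = 0 then 0 else lookup p (m - single j 1))"
  proof (cases "lookup m j = 0")
    case True
    then have "m \<noteq> single j 1 + q" for q by (auto simp: lookup_add)
    then show ?thesis using True by simp
  next
    case False
    then obtain u' where u': "m = u' + single j 1" by (rule monom_split_variable)
    then have "(m = single j 1 + q) = (q = u')" for q by (auto simp: add.commute)
    then show ?thesis using False u' by simp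
  qed
  finally show ?thesis .
qed

lemma var_div_mvar_mult [simp]: "var_div j (mvar j * p) = p"
  by (rule poly_mapping_eqI) (simp add: lookup_mvar_mult lookup_add)

lemma var_div_mvar_mult_other:
  assumes "i \<noteq> j" shows "var_div j (mvar i * p) = mvar i * var_div j p"
proof (rule poly_mapping_eqI)
  fix m :: "nat \<Rightarrow>\<^sub>0 nat"
  have "m + single j 1 - single i 1 = m - single i 1 + single j 1" if "lookup m i \<noteq> 0"
    by (rule poly_mapping_eqI) (use that assms in \<open>auto simp: lookup_add lookup_minus lookup_single when_def\<close>)
  then show "lookup (var_div j (mvar i * p)) m = lookup (mvar i * var_div j p) m"
    using assms by (simp add: lookup_mvar_mult lookup_add lookup_single)
qed

lemma var_div_decomp: "p = mvar j * var_div j p + var_free j p"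
proof (rule poly_mapping_eqI)
  fix m :: "nat \<Rightarrow>\<^sub>0 nat"
  have "m - single j 1 + single j 1 = m" if "lookup m j \<noteq> 0"
    by (rule poly_mapping_eqI) (use that in \<open>auto simp: lookup_add lookup_minus lookup_single when_def\<close>)
  then show "lookup p m = lookup (mvar j * var_div j p + var_free j p) m"
    by (simp add: lookup_add lookup_mvar_mult)
qed

lemma var_div_eq_0: "(\<And>m. m \<in> keys p \<Longrightarrow> lookup m j = 0) \<Longrightarrow> var_div j p = 0"
  by (rule poly_mapping_eqI) (force simp: in_keys_iff lookup_add)

lemma keys_var_free: "m \<in> keys (var_free j p) \<longleftrightarrow> m \<in> keys p \<and> lookup m j = 0"
  by (auto simp: in_keys_iff)

lemma keys_var_div: "m \<in> keys (var_div j p) \<longleftrightarrow> m + single j 1 \<in> keys p"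
  by (auto simp: in_keys_iff)

lemma keys_add_nat: "keys (a + b :: nat \<Rightarrow>\<^sub>0 nat) = keys a \<union> keys b"
  by (auto simp: in_keys_iff lookup_add)

lemma var_div_carrier: "p \<in> carrier (poly_ring n) \<Longrightarrow> var_div j p \<in> carrier (poly_ring n)"
  by (auto simp: poly_ring_carrier keys_var_div keys_add_nat dest!: bspec)

lemma var_free_carrier: "p \<in> carrier (poly_ring n) \<Longrightarrow> var_free j p \<in> carrier (poly_ring n)"
  by (auto simp: poly_ring_carrier keys_var_free)

text \<open>Split \<open>q\<close> by \<open>var_div_decomp\<close>. The part of \<open>q\<close>
  without x_j stays free of x_j after multiplication by \<open>var_free j p\<close>, so division by
  x_j discards it.\<close>

lemma var_div_mult_var_free: "var_div j (q * var_free j p) = var_div j q * var_free j p"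
proof -
  have "var_div j (var_free j q * var_free j p) = 0"
  proof (rule var_div_eq_0)
    fix m assume "m \<in> keys (var_free j q * var_free j p)"
    then obtain a b where "m = a + b" "a \<in> keys (var_free j q)" "b \<in> keys (var_free j p)"
      using keys_mult by blast
    then show "lookup m j = 0" by (simp add: keys_var_free lookup_add)
  qed
  then have "var_div j ((mvar j * var_div j q + var_free j q) * var_free j p) = var_div j q * var_free j p"
    by (simp add: distrib_right var_div_add mult.assoc)
  then show ?thesis by (simp only: var_div_decomp[symmetric])
qed

text \<open>A twisted Leibniz rule: \<open>var_div j\<close> fails to be linear only by a multiple
  of \<open>var_free j p\<close>. Linearity is restored wherever \<open>var_free j p\<close> acts as
  zero.\<close>

lemma var_div_mult: "var_div j (q * p) = q * var_div j p + var_div j q * var_free j p"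
proof -
  have "var_div j (q * (mvar j * var_div j p + var_free j p)) = q * var_div j p + var_div j q * var_free j p"
    by (simp add: distrib_left var_div_add var_div_mult_var_free mult.left_commute[of q])
  then show ?thesis by (simp only: var_div_decomp[symmetric])
qed

subsection \<open>Monomial ideals as graded modules\<close>

text \<open>The shift \<open>s\<close> is the degree given to 1, chosen so that degree-preserving
  maps can send 1 into a prescribed piece. The carrier lies in the type of polynomials, so these
  modules are admissible test objects for \<open>graded_injective\<close>.\<close>

definition monomial_module :: "nat \<Rightarrow> (nat \<Rightarrow>\<^sub>0 nat) set \<Rightarrow> int \<Rightarrow> ('k::field mpoly, 'k mpoly) graded_module" where
  "monomial_module n U s = \<lparr>carrier = {p \<in> carrier (poly_ring n). keys p \<subseteq> U},
     mult = (*), one = 1, zero = 0, add = (+), smult = (*),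
     piece = (\<lambda>d. {p \<in> carrier (poly_ring n). keys p \<subseteq> U \<and> (\<forall>m\<in>keys p. int (monom_degree m) + s = d)})\<rparr>"

lemma monomial_module_simps [simp]:
  "p \<in> carrier (monomial_module n U s) \<longleftrightarrow> p \<in> carrier (poly_ring n) \<and> keys p \<subseteq> U"
  "p \<in> piece (monomial_module n U s) d \<longleftrightarrow>
    p \<in> carrier (poly_ring n) \<and> keys p \<subseteq> U \<and> (\<forall>m\<in>keys p. int (monom_degree m) + s = d)"
  "p \<oplus>\<^bsub>monomial_module n U s\<^esub> q = p + q" "\<zero>\<^bsub>monomial_module n U s\<^esub> = 0"
  "p \<odot>\<^bsub>monomial_module n U s\<^esub> q = p * q"
  by (simp_all add: monomial_module_def)

lemma carrier_uminus: "p \<in> carrier (poly_ring n) \<Longrightarrow> - p \<in> carrier (poly_ring n)"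
  by (simp add: poly_ring_carrier)

text \<open>The condition on \<open>U\<close> says that the polynomials supported on
  \<open>U\<close> form an ideal. Taking the part of a given degree only drops monomials, so it does
  not leave this ideal.\<close>

lemma graded_module_monomial_module:
  assumes up: "\<And>m m'. m \<in> U \<Longrightarrow> keys m' \<subseteq> {..<n} \<Longrightarrow> m' + m \<in> U"
  shows "graded_module n (monomial_module n U s :: ('k::field mpoly, 'k mpoly) graded_module)"
proof -
  let ?M = "monomial_module n U s :: ('k mpoly, 'k mpoly) graded_module"
  have keys_sub: "keys (p + q) \<subseteq> keys p \<union> keys q" for p q :: "'k mpoly"
    by (rule Poly_Mapping.keys_add)
  have mult_keys: "keys (p * q) \<subseteq> U" if "p \<in> carrier (poly_ring n)" "keys q \<subseteq> U" for p q :: "'k mpoly"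
  proof
    fix m assume "m \<in> keys (p * q)"
    then obtain a b where "m = a + b" "a \<in> keys p" "b \<in> keys q" using keys_mult by blast
    then show "m \<in> U" using up[of b a] that by (auto simp: poly_ring_carrier)
  qed
  have ab: "abelian_group ?M"
  proof (rule abelian_groupI)
    show "\<exists>y\<in>carrier ?M. y \<oplus>\<^bsub>?M\<^esub> x = \<zero>\<^bsub>?M\<^esub>" if "x \<in> carrier ?M" for x
      using that by (intro bexI[of _ "- x"]) (auto simp: carrier_uminus)
    show "x \<oplus>\<^bsub>?M\<^esub> y \<in> carrier ?M" if "x \<in> carrier ?M" "y \<in> carrier ?M" for x y
      using that keys_sub[of x y] by (auto simp: carrier_add)
  qed (auto simp: add_ac)
  have md: "Module.module (poly_ring n) ?M"
    by (rule moduleI[OF cring_poly_ring ab]) (auto simp: carrier_mult algebra_simps dest: mult_keys[THEN subsetD])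
  have fs: "finsum ?M f A = sum f A \<and> sum f A \<in> carrier ?M"
    if "finite A" "\<And>d. d \<in> A \<Longrightarrow> f d \<in> carrier ?M" for f :: "int \<Rightarrow> 'k mpoly" and A
    using that
  proof (induction A rule: finite_induct)
    case empty
    then show ?case using abelian_monoid.finsum_empty[OF abelian_group.axioms(1)[OF ab]] by simp
  next
    case (insert a A)
    have "finsum ?M f (insert a A) = f a \<oplus>\<^bsub>?M\<^esub> finsum ?M f A"
      by (rule abelian_monoid.finsum_insert[OF abelian_group.axioms(1)[OF ab]]) (use insert in auto)
    then show ?case using insert abelian_monoid.a_closed[OF abelian_group.axioms(1)[OF ab], of "f a" "sum f A"]
      by auto
  qed
  have sub: "additive_subgroup (piece ?M d) ?M" for d
  proof (rule additive_subgroup.intro, rule group.subgroupI)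
    show "Group.group (add_monoid ?M)" using ab abelian_group.a_group by blast
    have "0 \<in> piece ?M d" by simp
    then show "piece ?M d \<noteq> {}" by blast
    fix a assume a: "a \<in> piece ?M d"
    have "inv\<^bsub>add_monoid ?M\<^esub> a = - a"
      using abelian_group.minus_equality[OF ab, of "- a" a] a by (auto simp: a_inv_def carrier_uminus)
    then show "inv\<^bsub>add_monoid ?M\<^esub> a \<in> piece ?M d" using a by (simp add: carrier_uminus)
    fix b assume b: "b \<in> piece ?M d"
    show "a \<otimes>\<^bsub>add_monoid ?M\<^esub> b \<in> piece ?M d" using a b keys_sub[of a b] by (auto simp: carrier_add)
  qed auto
  have smul: "p \<odot>\<^bsub>?M\<^esub> x \<in> piece ?M (int d + e)" if "p \<in> poly_piece n d" "x \<in> piece ?M e" for p x d e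
  proof -
    have "int (monom_degree m) + s = int d + e" if "m \<in> keys (p * x)" for m
    proof -
      obtain a b where "m = a + b" "a \<in> keys p" "b \<in> keys x" using \<open>m \<in> _\<close> keys_mult by blast
      then show ?thesis using \<open>p \<in> _\<close> \<open>x \<in> _\<close> by (auto simp: poly_piece_def monom_degree_add)
    qed
    then show ?thesis using that mult_keys[of p x] by (auto simp: poly_piece_def carrier_mult)
  qed
  have dec: "\<exists>!f. (\<forall>d. f d \<in> piece ?M d) \<and> finite {d. f d \<noteq> \<zero>\<^bsub>?M\<^esub>} \<and>
        x = finsum ?M f {d. f d \<noteq> \<zero>\<^bsub>?M\<^esub>}" if x: "x \<in> carrier ?M" for x
  proof -
    define g where "g d = Poly_Mapping.mapp (\<lambda>m a. a when int (monom_degree m) + s = d) x" for d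
    have lg: "lookup (g d) m = (if int (monom_degree m) + s = d then lookup x m else 0)" for d m
      by (auto simp: g_def lookup_mapp when_def in_keys_iff)
    have gp: "g d \<in> piece ?M d" for d
      using x by (auto simp: poly_ring_carrier in_keys_iff lg split: if_splits)
    have gs: "{d. g d \<noteq> 0} \<subseteq> (\<lambda>m. int (monom_degree m) + s) ` keys x"
    proof
      fix d assume "d \<in> {d. g d \<noteq> 0}"
      then obtain m where "lookup (g d) m \<noteq> 0" by (metis mem_Collect_eq poly_mapping_eqI lookup_zero)
      then show "d \<in> (\<lambda>m. int (monom_degree m) + s) ` keys x"
        by (auto simp: lg in_keys_iff split: if_splits)
    qed
    have gf: "finite {d. g d \<noteq> 0}" by (rule finite_subset[OF gs]) simp
    have off: "lookup p m = 0" if "p \<in> piece ?M d" "d \<noteq> int (monom_degree m) + s" for p d m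
      using that by (auto simp: in_keys_iff)
    \<comment> \<open>The coefficient at \<open>m\<close> of a sum of homogeneous parts comes from
      the part in the degree of \<open>m\<close> alone. This yields both existence and uniqueness of
      the decomposition.\<close>
    have lsum: "lookup (sum f {d. f d \<noteq> 0}) m = lookup (f (int (monom_degree m) + s)) m"
      if "\<And>d. f d \<in> piece ?M d" "finite {d. f d \<noteq> 0}" for f m
    proof -
      have "lookup (sum f {d. f d \<noteq> 0}) m = (\<Sum>d\<in>{d. f d \<noteq> 0}. lookup (f d) m)"
        by (simp add: lookup_sum)
      also have "\<dots> = (\<Sum>d\<in>{d. f d \<noteq> 0}. if d = int (monom_degree m) + s then lookup (f (int (monom_degree m) + s)) m else 0)"
        by (rule sum.cong) (use off[OF that(1), of _ m] in auto)
      also have "\<dots> = lookup (f (int (monom_degree m) + s)) m"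
        using that(2) by (auto simp: sum.delta)
      finally show ?thesis .
    qed
    show ?thesis
    proof (rule ex1I[of _ g])
      have "sum g {d. g d \<noteq> 0} = x"
        by (rule poly_mapping_eqI) (use lsum[OF gp gf] in \<open>simp add: lg\<close>)
      then show "(\<forall>d. g d \<in> piece ?M d) \<and> finite {d. g d \<noteq> \<zero>\<^bsub>?M\<^esub>} \<and>
        x = finsum ?M g {d. g d \<noteq> \<zero>\<^bsub>?M\<^esub>}"
        using gp gf fs[OF gf, of g] by auto
    next
      fix f assume f: "(\<forall>d. f d \<in> piece ?M d) \<and> finite {d. f d \<noteq> \<zero>\<^bsub>?M\<^esub>} \<and>
        x = finsum ?M f {d. f d \<noteq> \<zero>\<^bsub>?M\<^esub>}"
      then have x': "x = sum f {d. f d \<noteq> 0}" using fs[of "{d. f d \<noteq> 0}" f] by auto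
      show "f = g"
      proof (rule ext, rule poly_mapping_eqI)
        fix d m
        show "lookup (f d) m = lookup (g d) m"
          using lsum[of f m] f x' off[of "f d" d m] by (auto simp: lg)
      qed
    qed
  qed
  show ?thesis unfolding graded_module_def using md sub smul dec by blast
qed

subsection \<open>Injective modules are divisible by the variables\<close>

text \<open>
  The map \<open>p \<mapsto> (p div x_j) c\<close> is linear on the monomial ideal generated by \<open>x_j\<close> and the monomials
  that kill \<open>c\<close> and do not involve \<open>x_j\<close>. The image of 1 under an extension to the whole ring is a
  quotient of \<open>c\<close> by \<open>x_j\<close>.
\<close>

lemma graded_injective_divisible:
  fixes E :: "('k::field mpoly, 'e) graded_module"
  assumes inj: "graded_injective n E" and j: "j < n" and c: "c \<in> piece E e"
  obtains d where "d \<in> piece E (e - 1)" "mvar j \<odot>\<^bsub>E\<^esub> d = c"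
    "\<And>u. keys u \<subseteq> {..<n} \<Longrightarrow> lookup u j = 0 \<Longrightarrow> single u 1 \<odot>\<^bsub>E\<^esub> c = \<zero>\<^bsub>E\<^esub> \<Longrightarrow> single u 1 \<odot>\<^bsub>E\<^esub> d = \<zero>\<^bsub>E\<^esub>"
proof -
  interpret E: gmod n E using inj by unfold_locales (simp add: graded_injective_def)
  have cc: "c \<in> carrier E" using c E.piece_carr by blast
  define T :: "(nat \<Rightarrow>\<^sub>0 nat) set" where "T = {u. keys u \<subseteq> {..<n}}"
  define U where "U = {u \<in> T. lookup u j \<noteq> 0 \<or> single u 1 \<odot>\<^bsub>E\<^esub> c = \<zero>\<^bsub>E\<^esub>}"
  \<comment> \<open>With 1 in degree \<open>e - 1\<close> the variable x_j has degree
    \<open>e\<close>, the degree of \<open>c\<close>, so x_j -> \<open>c\<close> preserves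
    degrees.\<close>
  let ?P = "monomial_module n T (e - 1) :: ('k mpoly, 'k mpoly) graded_module"
  let ?N = "monomial_module n U (e - 1) :: ('k mpoly, 'k mpoly) graded_module"
  have P: "graded_module n ?P"
    by (rule graded_module_monomial_module) (auto simp: T_def keys_add_nat)
  have N: "graded_module n ?N"
  proof (rule graded_module_monomial_module)
    fix m m' :: "nat \<Rightarrow>\<^sub>0 nat" assume m: "m \<in> U" and m': "keys m' \<subseteq> {..<n}"
    have "single (m' + m) 1 \<odot>\<^bsub>E\<^esub> c = \<zero>\<^bsub>E\<^esub>" if "single m 1 \<odot>\<^bsub>E\<^esub> c = \<zero>\<^bsub>E\<^esub>"
      using E.single_add_smult[of m' m c] m m' cc that
      by (auto simp: U_def T_def carrier_single)
    then show "m' + m \<in> U" using m m' by (auto simp: U_def T_def keys_add_nat lookup_add)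
  qed
  define f where "f p = var_div j p \<odot>\<^bsub>E\<^esub> c" for p
  have f: "f \<in> graded_hom n ?N E"
    unfolding graded_hom_def
  proof (safe, goal_cases)
    case (1 x)
    then show ?case using cc by (simp add: f_def var_div_carrier)
  next
    case (2 x y)
    then show ?case using cc E.smult_l_distr[of "var_div j x" "var_div j y" c] by (simp add: f_def var_div_add var_div_carrier)
  next
    case (3 q p)
    \<comment> \<open>The monomials of \<open>var_free j p\<close> lie in \<open>U\<close> without
      involving x_j, hence they kill \<open>c\<close>. So the error term of
      \<open>var_div_mult\<close> disappears.\<close>
    have "var_free j p \<odot>\<^bsub>E\<^esub> c = \<zero>\<^bsub>E\<^esub>"
      by (rule E.smult_eq_zero_keys) (use 3 cc in \<open>auto simp: var_free_carrier keys_var_free U_def\<close>)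
    then have z: "(var_div j q * var_free j p) \<odot>\<^bsub>E\<^esub> c = \<zero>\<^bsub>E\<^esub>"
      using E.smult_assoc1[of "var_div j q" "var_free j p" c] 3 cc by (simp add: var_div_carrier var_free_carrier)
    have "(q * var_div j p + var_div j q * var_free j p) \<odot>\<^bsub>E\<^esub> c = q \<odot>\<^bsub>E\<^esub> (var_div j p \<odot>\<^bsub>E\<^esub> c)"
      using E.smult_assoc1[of q "var_div j p" c] 3 cc z
        E.smult_l_distr[of "q * var_div j p" "var_div j q * var_free j p" c]
      by (simp add: var_div_carrier var_free_carrier carrier_mult)
    then show ?case by (simp add: f_def var_div_mult)
  next
    case (4 d p y)
    have "var_div j y \<odot>\<^bsub>E\<^esub> c \<in> piece E d"
    proof (rule E.smult_in_subgroup[OF _ cc E.piece_subgroup])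
      show "var_div j y \<in> carrier (poly_ring n)" using 4 by (simp add: var_div_carrier)
      fix u assume "u \<in> keys (var_div j y)"
      then have u: "u + single j 1 \<in> keys y" by (simp add: keys_var_div)
      then have "keys u \<subseteq> {..<n}" "int (monom_degree u) + e = d"
        using 4 by (force simp: poly_ring_carrier keys_add_nat monom_degree_add)+
      then show "single u (lookup (var_div j y) u) \<odot>\<^bsub>E\<^esub> c \<in> piece E d"
        using E.piece_single[OF _ c, of u] by metis
    qed
    then show ?case by (simp add: f_def)
  qed
  have i: "id \<in> graded_hom n ?N ?P" by (auto simp: graded_hom_def U_def)
  obtain g where g: "g \<in> graded_hom n ?P E" "\<And>x. x \<in> carrier ?N \<Longrightarrow> g (id x) = f x"
    using inj i f N P unfolding graded_injective_def by (meson inj_on_id)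
  interpret G: ghom n ?P E g by unfold_locales (use g P in auto)
  have cT: "p \<in> carrier ?P \<longleftrightarrow> p \<in> carrier (poly_ring n)" for p
    by (auto simp: T_def poly_ring_carrier)
  have gp: "p \<odot>\<^bsub>E\<^esub> g 1 = f p" if "p \<in> carrier (poly_ring n)" "keys p \<subseteq> U" for p
    using G.hom_smult[of p 1] g(2)[of p] that cT[of p] cT[of 1] by simp
  have jU: "single j 1 \<in> U" using j by (simp add: U_def T_def)
  show ?thesis
  proof (rule that[of "g 1"])
    show "g 1 \<in> piece E (e - 1)" using G.hom_piece[of 1 "e - 1"] by (simp add: T_def)
    show "mvar j \<odot>\<^bsub>E\<^esub> g 1 = c"
    proof -
      have "keys (mvar j :: 'k mpoly) \<subseteq> U" using jU by (simp add: mvar_def)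
      moreover have "var_div j (mvar j :: 'k mpoly) = 1" using var_div_mvar_mult[of j 1] by simp
      ultimately show ?thesis using gp[of "mvar j"] j cc E.smult_one by (simp add: f_def)
    qed
    fix u assume u: "keys u \<subseteq> {..<n}" "lookup u j = 0" "single u 1 \<odot>\<^bsub>E\<^esub> c = \<zero>\<^bsub>E\<^esub>"
    \<comment> \<open>Such a \<open>u\<close> belongs to the ideal and has quotient 0 by x_j, so the
      extended map sends it to 0.\<close>
    have "var_div j (single u 1 :: 'k mpoly) = 0" by (rule var_div_eq_0) (use u in simp)
    then show "single u 1 \<odot>\<^bsub>E\<^esub> g 1 = \<zero>\<^bsub>E\<^esub>"
      using gp[of "single u 1"] u cc E.smult_l_null by (simp add: f_def carrier_single U_def T_def)
  qed
qed

subsection \<open>Torsion\<close>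

text \<open>For \<open>t = 1\<close> this is an ideal that contains the variables, so elements of
  the irrelevant ideal have no constant term.\<close>

lemma monomials_ideal:
  "ideal {p \<in> carrier (poly_ring n). \<forall>u\<in>keys p. t \<le> monom_degree u} (poly_ring n :: 'k::field mpoly ring)"
proof -
  let ?R = "poly_ring n :: 'k mpoly ring" and ?J = "{p \<in> carrier (poly_ring n). \<forall>u\<in>keys p. t \<le> monom_degree u} :: 'k mpoly set"
  interpret cring ?R by (rule cring_poly_ring)
  have inv: "\<ominus>\<^bsub>?R\<^esub> p = - p" if "p \<in> carrier ?R" for p
    using minus_equality[of "- p" p] that by (simp add: carrier_uminus)
  have mult: "p * q \<in> ?J" if "p \<in> ?J" "q \<in> carrier ?R" for p q
  proof -
    have "t \<le> monom_degree u" if u: "u \<in> keys (p * q)" for u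
    proof -
      obtain a b where "u = a + b" "a \<in> keys p" "b \<in> keys q" using u keys_mult by blast
      then show ?thesis using \<open>p \<in> ?J\<close> by (fastforce simp: monom_degree_add)
    qed
    then show ?thesis using that by (simp add: carrier_mult)
  qed
  show ?thesis
  proof (rule idealI)
    show "ring ?R" by (rule ring_axioms)
    show "subgroup ?J (add_monoid ?R)"
    proof (rule add.subgroupI)
      have "0 \<in> ?J" by simp
      then show "?J \<noteq> {}" by blast
      fix a assume a: "a \<in> ?J"
      then have i: "\<ominus>\<^bsub>?R\<^esub> a = - a" using inv by blast
      have "- a \<in> ?J" using a by (simp add: carrier_uminus)
      then show "\<ominus>\<^bsub>?R\<^esub> a \<in> ?J" unfolding i .
      fix b assume b: "b \<in> ?J"
      show "a \<oplus>\<^bsub>?R\<^esub> b \<in> ?J"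
        using a b Poly_Mapping.keys_add[of a b] by (auto simp: carrier_add)
    qed auto
    fix a x assume "a \<in> ?J" "x \<in> carrier ?R"
    then show "a \<otimes>\<^bsub>?R\<^esub> x \<in> ?J" "x \<otimes>\<^bsub>?R\<^esub> a \<in> ?J"
      using mult[of a x] by (simp_all add: mult.commute)
  qed
qed

lemma mvar_irrelevant: "i < n \<Longrightarrow> mvar i \<in> (irrelevant_ideal n :: 'k::field mpoly set)"
proof -
  assume i: "i < n"
  interpret cring "poly_ring n :: 'k mpoly ring" by (rule cring_poly_ring)
  show ?thesis unfolding irrelevant_ideal_def
    by (rule subsetD[OF genideal_self]) (use i in auto)
qed

lemma keys_mvar: "keys (mvar i :: 'k::field mpoly) = {single i 1}"
  by (simp add: mvar_def)

lemma irrelevant_ideal_keys: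
  assumes "p \<in> (irrelevant_ideal n :: 'k::field mpoly set)"
  shows "p \<in> carrier (poly_ring n)" "u \<in> keys p \<Longrightarrow> 1 \<le> monom_degree u"
proof -
  let ?J = "{p \<in> carrier (poly_ring n). \<forall>u\<in>keys p. 1 \<le> monom_degree u} :: 'k mpoly set"
  interpret cring "poly_ring n :: 'k mpoly ring" by (rule cring_poly_ring)
  have "irrelevant_ideal n \<subseteq> ?J" unfolding irrelevant_ideal_def
    by (rule genideal_minimal[OF monomials_ideal]) (auto simp: keys_mvar)
  then show "p \<in> carrier (poly_ring n)" "u \<in> keys p \<Longrightarrow> 1 \<le> monom_degree u" using assms by auto
qed

abbreviation ideal_power :: "nat \<Rightarrow> nat \<Rightarrow> 'k::field mpoly set" where
  "ideal_power n t \<equiv> irrelevant_ideal n [^]\<^bsub>ideals_set (poly_ring n)\<^esub> t"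

lemma ideal_power_simps:
  "ideal_power n 0 = carrier (poly_ring n)"
  "ideal_power n (Suc t) = ideal_prod (poly_ring n) (ideal_power n t) (irrelevant_ideal n)"
  by (simp_all add: nat_pow_def ideals_set_def)

lemma ideal_power_keys:
  "p \<in> ideal_power n t \<Longrightarrow> p \<in> carrier (poly_ring n) \<and> (\<forall>u\<in>keys p. t \<le> monom_degree u)"
proof (induction t arbitrary: p)
  case 0
  then show ?case unfolding ideal_power_simps by simp
next
  case (Suc t)
  from Suc.prems show ?case unfolding ideal_power_simps
  proof (induction rule: ideal_prod.induct)
    case (prod i j)
    have "Suc t \<le> monom_degree u" if u: "u \<in> keys (i * j)" for u
    proof -
      obtain a b where "u = a + b" "a \<in> keys i" "b \<in> keys j" using u keys_mult by blast
      then show ?thesis using Suc.IH[OF prod(1)] irrelevant_ideal_keys[OF prod(2)]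
        by (fastforce simp: monom_degree_add)
    qed
    then show ?case
      using Suc.IH[OF prod(1)] irrelevant_ideal_keys(1)[OF prod(2)] by (simp add: carrier_mult)
  next
    case (sum s1 s2)
    then show ?case using Poly_Mapping.keys_add[of s1 s2] by (auto simp: carrier_add)
  qed
qed

lemma single_ideal_power:
  "keys u \<subseteq> {..<n} \<Longrightarrow> t \<le> monom_degree u \<Longrightarrow> single u 1 \<in> (ideal_power n t :: 'k::field mpoly set)"
proof (induction t arbitrary: u)
  case 0
  then show ?case unfolding ideal_power_simps by (simp add: carrier_single)
next
  case (Suc t)
  then have "u \<noteq> 0" by auto
  then obtain i where i: "lookup u i \<noteq> 0" by (metis lookup_zero poly_mapping_eqI)
  then have "i \<in> keys u" by (simp add: in_keys_iff)
  then have "i < n" using Suc.prems by auto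
  from i obtain u' where u': "u = u' + single i 1" "keys u' \<subseteq> keys u" by (rule monom_split_variable)
  have "single u' 1 \<in> (ideal_power n t :: 'k mpoly set)"
    by (rule Suc.IH) (use Suc.prems u' in \<open>auto simp: monom_degree_add\<close>)
  from ideal_prod.prod[OF this mvar_irrelevant[OF \<open>i < n\<close>], of "poly_ring n"]
  show ?case unfolding ideal_power_simps by (simp add: mvar_def mult_single u'(1))
qed

context gmod
begin

text \<open>By \<open>ideal_power_keys\<close> and \<open>single_ideal_power\<close>, the
  \<open>t\<close>-th power of the irrelevant ideal is spanned by the monomials of degree at least
  \<open>t\<close>. Annihilation can therefore be tested on monomials.\<close>

lemma torsion_iff:
  "x \<in> torsion_elements n M \<longleftrightarrow> x \<in> carrier M \<and>
    (\<exists>t. \<forall>u. keys u \<subseteq> {..<n} \<longrightarrow> t \<le> monom_degree u \<longrightarrow> single u 1 \<odot>\<^bsub>M\<^esub> x = \<zero>\<^bsub>M\<^esub>)"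
proof (intro iffI conjI)
  assume x: "x \<in> torsion_elements n M"
  then show "x \<in> carrier M" by (simp add: torsion_elements_def)
  from x obtain t where t: "\<forall>p\<in>ideal_power n t. p \<odot>\<^bsub>M\<^esub> x = \<zero>\<^bsub>M\<^esub>" by (auto simp: torsion_elements_def)
  show "\<exists>t. \<forall>u. keys u \<subseteq> {..<n} \<longrightarrow> t \<le> monom_degree u \<longrightarrow> single u 1 \<odot>\<^bsub>M\<^esub> x = \<zero>\<^bsub>M\<^esub>"
    by (rule exI[of _ t]) (use t single_ideal_power in blast)
next
  assume "x \<in> carrier M \<and> (\<exists>t. \<forall>u. keys u \<subseteq> {..<n} \<longrightarrow> t \<le> monom_degree u \<longrightarrow> single u 1 \<odot>\<^bsub>M\<^esub> x = \<zero>\<^bsub>M\<^esub>)"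
  then obtain t where x: "x \<in> carrier M" and
    t: "\<And>u. keys u \<subseteq> {..<n} \<Longrightarrow> t \<le> monom_degree u \<Longrightarrow> single u 1 \<odot>\<^bsub>M\<^esub> x = \<zero>\<^bsub>M\<^esub>" by blast
  have "p \<odot>\<^bsub>M\<^esub> x = \<zero>\<^bsub>M\<^esub>" if "p \<in> ideal_power n t" for p
    by (rule smult_eq_zero_keys) (use ideal_power_keys[OF that] t x in \<open>auto simp: poly_ring_carrier\<close>)
  then show "x \<in> torsion_elements n M" using x by (auto simp: torsion_elements_def)
qed

lemma torsion_diff:
  assumes "x \<in> torsion_elements n M" "y \<in> torsion_elements n M"
  shows "x \<ominus>\<^bsub>M\<^esub> y \<in> torsion_elements n M"
proof -
  obtain s where x: "x \<in> carrier M" and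
    s: "\<And>u. keys u \<subseteq> {..<n} \<Longrightarrow> s \<le> monom_degree u \<Longrightarrow> single u 1 \<odot>\<^bsub>M\<^esub> x = \<zero>\<^bsub>M\<^esub>"
    using assms(1) unfolding torsion_iff by blast
  obtain t where y: "y \<in> carrier M" and
    t: "\<And>u. keys u \<subseteq> {..<n} \<Longrightarrow> t \<le> monom_degree u \<Longrightarrow> single u 1 \<odot>\<^bsub>M\<^esub> y = \<zero>\<^bsub>M\<^esub>"
    using assms(2) unfolding torsion_iff by blast
  have "single u 1 \<odot>\<^bsub>M\<^esub> (x \<ominus>\<^bsub>M\<^esub> y) = \<zero>\<^bsub>M\<^esub>" if "keys u \<subseteq> {..<n}" "max s t \<le> monom_degree u" for u
    using that s[of u] t[of u] x y by (simp add: smult_diff carrier_single diff_eq_zero_iff)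
  then show ?thesis unfolding torsion_iff using x y by blast
qed

lemma torsion_zero: "\<zero>\<^bsub>M\<^esub> \<in> torsion_elements n M"
  unfolding torsion_iff by (auto simp: carrier_single)

lemma torsion_smult:
  assumes "x \<in> torsion_elements n M" "p \<in> carrier (poly_ring n)"
  shows "p \<odot>\<^bsub>M\<^esub> x \<in> torsion_elements n M"
  using assms unfolding torsion_iff by (metis smult_comm smult_r_null smult_closed carrier_single)

lemma torsion_component:
  assumes "x \<in> torsion_elements n M" shows "component x d \<in> torsion_elements n M"
proof -
  obtain t where x: "x \<in> carrier M" and
    t: "\<And>u. keys u \<subseteq> {..<n} \<Longrightarrow> t \<le> monom_degree u \<Longrightarrow> single u 1 \<odot>\<^bsub>M\<^esub> x = \<zero>\<^bsub>M\<^esub>"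
    using assms unfolding torsion_iff by blast
  have "single u 1 \<odot>\<^bsub>M\<^esub> component x d = \<zero>\<^bsub>M\<^esub>" if "keys u \<subseteq> {..<n}" "t \<le> monom_degree u" for u
    using component_single[OF x that(1), of 1 d] t[OF that] by simp
  then show ?thesis unfolding torsion_iff using component_carr[OF x] by blast
qed

text \<open>Every monomial of degree at least 1 has a variable as a factor, so the bound 1 works.
  Hence the socle lies in the torsion part automatically.\<close>

lemma torsion_if_all_vars:
  assumes x: "x \<in> carrier M" and v: "\<And>i. i < n \<Longrightarrow> mvar i \<odot>\<^bsub>M\<^esub> x = \<zero>\<^bsub>M\<^esub>"
  shows "x \<in> torsion_elements n M"
proof -
  have "single u 1 \<odot>\<^bsub>M\<^esub> x = \<zero>\<^bsub>M\<^esub>" if u: "keys u \<subseteq> {..<n}" "1 \<le> monom_degree u" for u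
  proof -
    have "u \<noteq> 0" using u by auto
    then obtain i where i: "lookup u i \<noteq> 0" by (metis lookup_zero poly_mapping_eqI)
    then have "i \<in> keys u" by (simp add: in_keys_iff)
    then have "i < n" using u by auto
    from i obtain u' where u': "u = u' + single i 1" "keys u' \<subseteq> keys u" by (rule monom_split_variable)
    then show ?thesis
      using single_add_smult[of u' "single i 1" x] v[OF \<open>i < n\<close>] u x \<open>i < n\<close>
      by (auto simp: mvar_def carrier_single)
  qed
  then show ?thesis unfolding torsion_iff using x by blast
qed

lemma torsion_var_power:
  assumes "x \<in> torsion_elements n M" "i < n"
  obtains s where "((\<lambda>y. mvar i \<odot>\<^bsub>M\<^esub> y) ^^ s) x = \<zero>\<^bsub>M\<^esub>"
proof -
  obtain t where x: "x \<in> carrier M" and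
    t: "\<And>u. keys u \<subseteq> {..<n} \<Longrightarrow> t \<le> monom_degree u \<Longrightarrow> single u 1 \<odot>\<^bsub>M\<^esub> x = \<zero>\<^bsub>M\<^esub>"
    using assms unfolding torsion_iff by blast
  have "((\<lambda>y. mvar i \<odot>\<^bsub>M\<^esub> y) ^^ s) x = single (single i s) 1 \<odot>\<^bsub>M\<^esub> x" for s
  proof (induction s)
    case 0
    then show ?case using x smult_one by (simp add: single_one)
  next
    case (Suc s)
    have "single i (Suc s) = single i 1 + single i s" by (simp add: single_add[symmetric])
    then show ?case using Suc single_add_smult[of "single i 1" "single i s" x] x assms(2)
      by (simp add: mvar_def)
  qed
  then show ?thesis using t[of "single i t"] assms(2) by (intro that[of t]) simp
qed

end

lemma graded_injective_divisible_torsion: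
  fixes E :: "('k::field mpoly, 'e) graded_module"
  assumes inj: "graded_injective n E" and j: "j < n" and c: "c \<in> piece E (e + 1)"
    and k: "\<And>i. i < j \<Longrightarrow> mvar i \<odot>\<^bsub>E\<^esub> c = \<zero>\<^bsub>E\<^esub>"
  obtains d where "d \<in> piece E e" "mvar j \<odot>\<^bsub>E\<^esub> d = c"
    "\<And>i. i < j \<Longrightarrow> mvar i \<odot>\<^bsub>E\<^esub> d = \<zero>\<^bsub>E\<^esub>"
    "c \<in> torsion_elements n E \<Longrightarrow> d \<in> torsion_elements n E"
proof -
  interpret E: gmod n E using inj by unfold_locales (simp add: graded_injective_def)
  obtain d where d: "d \<in> piece E e" "mvar j \<odot>\<^bsub>E\<^esub> d = c"
    and dk: "\<And>u. keys u \<subseteq> {..<n} \<Longrightarrow> lookup u j = 0 \<Longrightarrow> single u 1 \<odot>\<^bsub>E\<^esub> c = \<zero>\<^bsub>E\<^esub> \<Longrightarrow> single u 1 \<odot>\<^bsub>E\<^esub> d = \<zero>\<^bsub>E\<^esub>"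
    using graded_injective_divisible[OF inj j c] by auto
  have dc: "d \<in> carrier E" using d E.piece_carr by blast
  show ?thesis
  proof (rule that[OF d])
    fix i assume "i < j"
    then show "mvar i \<odot>\<^bsub>E\<^esub> d = \<zero>\<^bsub>E\<^esub>"
      using dk[of "single i 1"] k[of i] j by (simp add: mvar_def lookup_single)
  next
    assume "c \<in> torsion_elements n E"
    then obtain t where
      t: "\<And>u. keys u \<subseteq> {..<n} \<Longrightarrow> t \<le> monom_degree u \<Longrightarrow> single u 1 \<odot>\<^bsub>E\<^esub> c = \<zero>\<^bsub>E\<^esub>"
      unfolding E.torsion_iff by blast
    \<comment> \<open>The bound rises by one: a monomial that involves x_j spends one factor x_j on
      turning \<open>d\<close> into \<open>c\<close>, and what is left has degree at least
      \<open>t\<close>.\<close>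
    have "single u 1 \<odot>\<^bsub>E\<^esub> d = \<zero>\<^bsub>E\<^esub>" if u: "keys u \<subseteq> {..<n}" "t + 1 \<le> monom_degree u" for u
    proof (cases "lookup u j = 0")
      case True
      then show ?thesis using dk t u by auto
    next
      case False
      then obtain u' where u': "u = u' + single j 1" "keys u' \<subseteq> keys u" by (rule monom_split_variable)
      then show ?thesis using E.single_add_smult[of u' "single j 1" d] u dc j d(2) t[of u']
        by (auto simp: mvar_def monom_degree_add)
    qed
    then show "d \<in> torsion_elements n E" unfolding E.torsion_iff using dc by blast
  qed
qed

subsection \<open>Torsion and socle complexes of an injective complex\<close>

text \<open>The comparison of torsion and socle is a statement about any complex of injectives;
  exactness enters with \<open>injective_resolution\<close>.\<close>

locale injective_complex =
  fixes n :: nat and E :: "nat \<Rightarrow> ('k::field mpoly, 'e) graded_module" and \<delta> :: "nat \<Rightarrow> 'e \<Rightarrow> 'e"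
  assumes inj: "graded_injective n (E i)"
    and delta_hom: "\<delta> i \<in> graded_hom n (E i) (E (Suc i))"
    and delta_delta: "x \<in> carrier (E i) \<Longrightarrow> \<delta> (Suc i) (\<delta> i x) = \<zero>\<^bsub>E (Suc (Suc i))\<^esub>"
begin

sublocale E: gmod n "E i" for i
  using inj by unfold_locales (simp add: graded_injective_def)

sublocale D: ghom n "E i" "E (Suc i)" "\<delta> i" for i
  by unfold_locales (rule delta_hom)

text \<open>
  \<open>C j\<close> is the complex of torsion elements killed by the first \<open>j\<close> variables, so \<open>C 0\<close> computes local
  cohomology and \<open>C n\<close> is the socle complex. Multiplication by the variable \<open>j\<close> gives short exact
  sequences from \<open>C (Suc j)\<close> to \<open>C j\<close> to the shift of \<open>C j\<close>.
\<close>

definition C :: "nat \<Rightarrow> nat \<Rightarrow> int \<Rightarrow> 'e set" where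
  "C j i t = {c \<in> piece (E i) t. c \<in> torsion_elements n (E i) \<and> (\<forall>l<j. mvar l \<odot>\<^bsub>E i\<^esub> c = \<zero>\<^bsub>E i\<^esub>)}"

text \<open>The preimage has to lie in \<open>C j\<close> itself: these are the coboundaries of the
  subcomplex, not those of the ambient complex.\<close>

definition cobounds :: "nat \<Rightarrow> nat \<Rightarrow> int \<Rightarrow> 'e \<Rightarrow> bool" where
  "cobounds j i t z = (case i of 0 \<Rightarrow> z = \<zero>\<^bsub>E 0\<^esub> | Suc r \<Rightarrow> \<exists>w\<in>C j r t. \<delta> r w = z)"

text \<open>All cohomological degrees are taken together, because passing between \<open>C j\<close>
  and \<open>C (Suc j)\<close> mixes neighbouring ones and a* takes the maximum over all of them
  anyway.\<close>

definition acyclic_at :: "nat \<Rightarrow> int \<Rightarrow> bool" where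
  "acyclic_at j t \<longleftrightarrow> (\<forall>i. \<forall>z\<in>C j i t. \<delta> i z = \<zero>\<^bsub>E (Suc i)\<^esub> \<longrightarrow> cobounds j i t z)"

lemma C_carr: "c \<in> C j i t \<Longrightarrow> c \<in> carrier (E i)"
  by (auto simp: C_def E.piece_carr)

lemma C_zero: "j \<le> n \<Longrightarrow> \<zero>\<^bsub>E i\<^esub> \<in> C j i t"
  by (auto simp: C_def E.torsion_zero)

lemma C_diff:
  assumes "j \<le> n" "x \<in> C j i t" "y \<in> C j i t"
  shows "x \<ominus>\<^bsub>E i\<^esub> y \<in> C j i t"
proof -
  have c: "x \<in> carrier (E i)" "y \<in> carrier (E i)" using assms C_carr by auto
  have "mvar l \<odot>\<^bsub>E i\<^esub> (x \<ominus>\<^bsub>E i\<^esub> y) = \<zero>\<^bsub>E i\<^esub>" if "l < j" for l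
    using assms that c by (auto simp: C_def E.smult_diff E.diff_eq_zero_iff)
  then show ?thesis using assms by (auto simp: C_def E.piece_diff E.torsion_diff)
qed

lemma C_add:
  assumes "j \<le> n" "x \<in> C j i t" "y \<in> C j i t"
  shows "x \<oplus>\<^bsub>E i\<^esub> y \<in> C j i t"
proof -
  have c: "x \<in> carrier (E i)" "y \<in> carrier (E i)" using assms C_carr by auto
  have "x \<ominus>\<^bsub>E i\<^esub> (\<zero>\<^bsub>E i\<^esub> \<ominus>\<^bsub>E i\<^esub> y) \<in> C j i t"
    using assms by (intro C_diff C_zero) auto
  then show ?thesis using c by (simp add: a_minus_def)
qed

lemma C_var:
  assumes "j < n" "x \<in> C j i t" shows "mvar j \<odot>\<^bsub>E i\<^esub> x \<in> C j i (t + 1)"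
proof -
  have c: "x \<in> carrier (E i)" using assms C_carr by auto
  have "mvar l \<odot>\<^bsub>E i\<^esub> (mvar j \<odot>\<^bsub>E i\<^esub> x) = \<zero>\<^bsub>E i\<^esub>" if "l < j" for l
    using E.smult_comm[of "mvar l" "mvar j" x] that assms c by (auto simp: C_def)
  then show ?thesis using assms by (auto simp: C_def E.piece_var E.torsion_smult)
qed

lemma C_delta:
  assumes "j \<le> n" "x \<in> C j i t" shows "\<delta> i x \<in> C j (Suc i) t"
proof -
  have c: "x \<in> carrier (E i)" using assms C_carr by auto
  have "mvar l \<odot>\<^bsub>E (Suc i)\<^esub> \<delta> i x = \<zero>\<^bsub>E (Suc i)\<^esub>" if "l < j" for l
    using D.hom_smult[of "mvar l" x i] that assms c by (auto simp: C_def)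
  moreover have "\<delta> i x \<in> torsion_elements n (E (Suc i))"
  proof -
    obtain s where s: "\<And>u. keys u \<subseteq> {..<n} \<Longrightarrow> s \<le> monom_degree u \<Longrightarrow> single u 1 \<odot>\<^bsub>E i\<^esub> x = \<zero>\<^bsub>E i\<^esub>"
      using assms unfolding C_def E.torsion_iff by blast
    have "single u 1 \<odot>\<^bsub>E (Suc i)\<^esub> \<delta> i x = \<zero>\<^bsub>E (Suc i)\<^esub>" if "keys u \<subseteq> {..<n}" "s \<le> monom_degree u" for u
      using D.hom_smult[of "single u 1" x i] s[OF that] that c by (simp add: carrier_single)
    then show ?thesis unfolding E.torsion_iff using c by auto
  qed
  ultimately show ?thesis using assms by (auto simp: C_def D.hom_piece)
qed

lemma C_surj:
  assumes "j < n" "c \<in> C j i (t + 1)"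
  obtains d where "d \<in> C j i t" "mvar j \<odot>\<^bsub>E i\<^esub> d = c"
proof -
  obtain d where "d \<in> piece (E i) t" "mvar j \<odot>\<^bsub>E i\<^esub> d = c"
    "\<And>l. l < j \<Longrightarrow> mvar l \<odot>\<^bsub>E i\<^esub> d = \<zero>\<^bsub>E i\<^esub>"
    "c \<in> torsion_elements n (E i) \<Longrightarrow> d \<in> torsion_elements n (E i)"
    using assms by (auto simp: C_def intro: graded_injective_divisible_torsion[OF inj assms(1), of c i t])
  then show ?thesis using that[of d] assms by (auto simp: C_def)
qed

lemma C_Suc: "c \<in> C (Suc j) i t \<longleftrightarrow> c \<in> C j i t \<and> mvar j \<odot>\<^bsub>E i\<^esub> c = \<zero>\<^bsub>E i\<^esub>"
  by (auto simp: C_def less_Suc_eq)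

text \<open>The chase behind the long exact sequence: a cochain whose multiple by x_j bounds can be
  moved into \<open>C (Suc j)\<close> by a coboundary. As \<open>w\<close> need not be a cocycle,
  this serves both the connecting map and exactness at the cohomology of \<open>C j\<close>.\<close>

lemma cobounds_var:
  assumes j: "j < n" and w: "w \<in> C j i t" and b: "cobounds j i (t + 1) (mvar j \<odot>\<^bsub>E i\<^esub> w)"
  obtains w' where "w' \<in> C (Suc j) i t" "\<delta> i w' = \<delta> i w" "cobounds j i t (w \<ominus>\<^bsub>E i\<^esub> w')"
proof (cases i)
  case 0
  have "w \<ominus>\<^bsub>E i\<^esub> w = \<zero>\<^bsub>E i\<^esub>" using C_carr[OF w] by (simp add: E.diff_eq_zero_iff)
  then show ?thesis using that[of w] w b by (auto simp: 0 cobounds_def C_Suc)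
next
  case (Suc r)
  from b obtain u where u: "u \<in> C j r (t + 1)" "\<delta> r u = mvar j \<odot>\<^bsub>E i\<^esub> w" by (auto simp: Suc cobounds_def)
  \<comment> \<open>Dividing the primitive \<open>u\<close> by x_j inside \<open>C j\<close> gives
    the correction: x_j kills \<open>w\<close> minus the differential of \<open>v\<close>.\<close>
  from C_surj[OF j u(1)] obtain v where v: "v \<in> C j r t" "mvar j \<odot>\<^bsub>E r\<^esub> v = u" .
  have c: "w \<in> carrier (E i)" "v \<in> carrier (E r)" "\<delta> r v \<in> carrier (E i)"
    using w v C_carr by (auto simp: Suc)
  have "mvar j \<odot>\<^bsub>E i\<^esub> (w \<ominus>\<^bsub>E i\<^esub> \<delta> r v) = \<zero>\<^bsub>E i\<^esub>"
    using D.hom_smult[of "mvar j" v r] c j u v by (simp add: E.smult_diff Suc E.diff_eq_zero_iff)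
  moreover have dv: "\<delta> r v \<in> C j i t" using C_delta[OF _ v(1)] j by (simp add: Suc)
  ultimately have "w \<ominus>\<^bsub>E i\<^esub> \<delta> r v \<in> C (Suc j) i t"
    using C_diff[OF _ w dv] j by (simp add: C_Suc)
  moreover have "\<delta> i (w \<ominus>\<^bsub>E i\<^esub> \<delta> r v) = \<delta> i w"
    using D.hom_diff[of w i "\<delta> r v"] c delta_delta[of v r] by (simp add: Suc a_minus_def)
  moreover have "w \<ominus>\<^bsub>E i\<^esub> (w \<ominus>\<^bsub>E i\<^esub> \<delta> r v) = \<delta> r v"
    using c by (simp add: a_minus_def E.M.minus_add E.M.r_neg2)
  ultimately show ?thesis using that[of "w \<ominus>\<^bsub>E i\<^esub> \<delta> r v"] v(1) by (auto simp: cobounds_def Suc)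
qed

text \<open>In the long exact sequence, H^i of \<open>C (Suc j)\<close> in degree \<open>t\<close>
  sits between H^(i-1) of \<open>C j\<close> in degree \<open>t + 1\<close> and H^i of
  \<open>C j\<close> in degree \<open>t\<close>.\<close>

lemma acyclic_at_Suc:
  assumes j: "j < n" and "acyclic_at j t" "acyclic_at j (t + 1)"
  shows "acyclic_at (Suc j) t"
  unfolding acyclic_at_def
proof (intro allI ballI impI)
  fix i z assume z: "z \<in> C (Suc j) i t" "\<delta> i z = \<zero>\<^bsub>E (Suc i)\<^esub>"
  then have zj: "z \<in> C j i t" "mvar j \<odot>\<^bsub>E i\<^esub> z = \<zero>\<^bsub>E i\<^esub>" by (auto simp: C_Suc)
  have b: "cobounds j i t z" using assms z zj by (auto simp: acyclic_at_def)
  show "cobounds (Suc j) i t z"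
  proof (cases i)
    case 0
    then show ?thesis using b by (simp add: cobounds_def)
  next
    case (Suc r)
    from b obtain w where w: "w \<in> C j r t" "\<delta> r w = z" by (auto simp: Suc cobounds_def)
    \<comment> \<open>The primitive \<open>w\<close> lies only in \<open>C j\<close>. Since x_j
      kills \<open>z\<close>, the element x_j \<open>w\<close> is a cocycle, and it bounds in degree
      \<open>t + 1\<close>.\<close>
    have "\<delta> r (mvar j \<odot>\<^bsub>E r\<^esub> w) = \<zero>\<^bsub>E (Suc r)\<^esub>"
      using D.hom_smult[of "mvar j" w r] j w zj C_carr by (auto simp: Suc)
    then have "cobounds j r (t + 1) (mvar j \<odot>\<^bsub>E r\<^esub> w)"
      using assms C_var[OF j w(1)] by (auto simp: acyclic_at_def)
    from cobounds_var[OF j w(1) this] show ?thesis using w(2) by (auto simp: Suc cobounds_def)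
  qed
qed

text \<open>Induction on the number \<open>s\<close> of multiplications by x_j that kill the
  cocycle, which is finite by torsion. Each step raises the degree, so vanishing is needed in all
  degrees above \<open>a\<close>.\<close>

lemma acyclic_at_Suc_converse:
  assumes j: "j < n" and van: "\<And>t. a < t \<Longrightarrow> acyclic_at (Suc j) t" and t: "a < t"
  shows "acyclic_at j t"
proof -
  have "cobounds j i t z"
    if "((\<lambda>y. mvar j \<odot>\<^bsub>E i\<^esub> y) ^^ s) z = \<zero>\<^bsub>E i\<^esub>" "a < t" "z \<in> C j i t" "\<delta> i z = \<zero>\<^bsub>E (Suc i)\<^esub>" for i s z t
    using that
  proof (induction s arbitrary: z t)
    case 0
    have "\<exists>w\<in>C j r t. \<delta> r w = \<zero>\<^bsub>E (Suc r)\<^esub>" for r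
      by (rule bexI[of _ "\<zero>\<^bsub>E r\<^esub>"]) (use j in \<open>auto intro: C_zero\<close>)
    then show ?case using 0 by (auto simp: cobounds_def split: nat.split)
  next
    case (Suc s)
    have zc: "z \<in> carrier (E i)" using Suc.prems C_carr by auto
    have "\<delta> i (mvar j \<odot>\<^bsub>E i\<^esub> z) = \<zero>\<^bsub>E (Suc i)\<^esub>"
      using D.hom_smult[of "mvar j" z i] j Suc.prems zc by auto
    \<comment> \<open>One multiplication fewer kills x_j \<open>z\<close>, and its degree
      \<open>t + 1\<close> is still above \<open>a\<close>.\<close>
    then have "cobounds j i (t + 1) (mvar j \<odot>\<^bsub>E i\<^esub> z)"
      using Suc.prems C_var[OF j] by (intro Suc.IH) (auto simp: funpow_swap1)
    from cobounds_var[OF j Suc.prems(3) this] obtain w'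
      where w': "w' \<in> C (Suc j) i t" "\<delta> i w' = \<delta> i z" "cobounds j i t (z \<ominus>\<^bsub>E i\<^esub> w')" .
    have wc: "w' \<in> carrier (E i)" using w' C_carr by auto
    have b: "cobounds (Suc j) i t w'" using van[OF Suc.prems(2)] w' Suc.prems by (auto simp: acyclic_at_def)
    \<comment> \<open>Both summands bound in \<open>C j\<close>: the first by the choice of
      \<open>w'\<close>, the second because \<open>w'\<close> already bounds in
      \<open>C (Suc j)\<close>.\<close>
    have z: "z = (z \<ominus>\<^bsub>E i\<^esub> w') \<oplus>\<^bsub>E i\<^esub> w'" using E.diff_add_cancel[OF zc wc] by simp
    show ?case
    proof (cases i)
      case 0
      then show ?thesis using b w'(3) z by (auto simp: cobounds_def)
    next
      case (Suc r)
      obtain p where p: "p \<in> C j r t" "\<delta> r p = z \<ominus>\<^bsub>E i\<^esub> w'" using w'(3) by (auto simp: Suc cobounds_def)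
      obtain q where q: "q \<in> C (Suc j) r t" "\<delta> r q = w'" using b by (auto simp: Suc cobounds_def)
      have q': "q \<in> C j r t" using q by (simp add: C_Suc)
      have "\<delta> r (p \<oplus>\<^bsub>E r\<^esub> q) = z"
        using D.hom_add[of p r q] p q q' z C_carr by (auto simp: Suc)
      then show ?thesis using C_add[OF _ p(1) q'] j by (auto simp: Suc cobounds_def)
    qed
  qed
  moreover have "\<exists>s. ((\<lambda>y. mvar j \<odot>\<^bsub>E i\<^esub> y) ^^ s) z = \<zero>\<^bsub>E i\<^esub>" if "z \<in> C j i t" for i z
    using that E.torsion_var_power[of z i j] j by (auto simp: C_def)
  ultimately show ?thesis unfolding acyclic_at_def using t by blast
qed

lemma acyclic_above_iff:
  "(\<forall>t>a. acyclic_at 0 t) \<longleftrightarrow> (\<forall>t>a. acyclic_at n t)"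
proof -
  have "j \<le> n \<Longrightarrow> (\<forall>t>a. acyclic_at 0 t) \<longleftrightarrow> (\<forall>t>a. acyclic_at j t)" for j
  proof (induction j)
    case (Suc j)
    have "(\<forall>t>a. acyclic_at j t) \<longleftrightarrow> (\<forall>t>a. acyclic_at (Suc j) t)"
    proof (intro iffI allI impI)
      fix t assume "\<forall>t>a. acyclic_at j t" "a < t"
      then show "acyclic_at (Suc j) t" using Suc.prems by (intro acyclic_at_Suc) auto
    next
      fix t assume "\<forall>t>a. acyclic_at (Suc j) t" "a < t"
      then show "acyclic_at j t" using Suc.prems by (intro acyclic_at_Suc_converse[of j a t]) auto
    qed
    then show ?case using Suc by simp
  qed simp
  then show ?thesis by simp
qed

section \<open>The socle complex and local cohomology in terms of \<open>C\<close>\<close>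

lemma C_top: "C n i t = {c \<in> piece (E i) t. \<forall>l<n. mvar l \<odot>\<^bsub>E i\<^esub> c = \<zero>\<^bsub>E i\<^esub>}"
  using E.torsion_if_all_vars E.piece_carr by (auto simp: C_def)

text \<open>The cosets are taken modulo the image of all torsion elements, whereas
  \<open>cobounds\<close> asks for a homogeneous preimage. Passing to a component, which is again
  torsion, reconciles the two.\<close>

lemma local_cohomology_nonzero_iff:
  "local_cohomology_nonzero n E \<delta> i t \<longleftrightarrow> \<not> (\<forall>z\<in>C 0 i t. \<delta> i z = \<zero>\<^bsub>E (Suc i)\<^esub> \<longrightarrow> cobounds 0 i t z)"
proof -
  let ?T = "\<lambda>j. torsion_functor n (E j)"
  let ?B = "coboundaries ?T \<delta> i"
  have tor: "carrier (?T j) = torsion_elements n (E j)" "\<zero>\<^bsub>?T j\<^esub> = \<zero>\<^bsub>E j\<^esub>"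
     "piece (?T j) d = piece (E j) d \<inter> torsion_elements n (E j)" "a \<oplus>\<^bsub>?T j\<^esub> b = a \<oplus>\<^bsub>E j\<^esub> b" for j d a b
    by (simp_all add: torsion_functor_def)
  have torc: "torsion_elements n (E j) \<subseteq> carrier (E j)" for j by (auto simp: torsion_elements_def)
  have tora: "x \<oplus>\<^bsub>E j\<^esub> y \<in> torsion_elements n (E j)" "\<ominus>\<^bsub>E j\<^esub> x \<in> torsion_elements n (E j)"
    if "x \<in> torsion_elements n (E j)" "y \<in> torsion_elements n (E j)" for j x y
  proof -
    have c: "x \<in> carrier (E j)" "y \<in> carrier (E j)" using that torc by auto
    show "\<ominus>\<^bsub>E j\<^esub> x \<in> torsion_elements n (E j)"
      using E.torsion_diff[OF E.torsion_zero that(1)] c by (simp add: a_minus_def)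
    show "x \<oplus>\<^bsub>E j\<^esub> y \<in> torsion_elements n (E j)"
      using E.torsion_diff[OF that(1) E.torsion_diff[OF E.torsion_zero that(2)]] c by (simp add: a_minus_def)
  qed
  have Bsub: "additive_subgroup ?B (E i)"
  proof (cases i)
    case 0
    then show ?thesis using E.zero_subgroup[of 0] by (simp add: tor)
  next
    case (Suc r)
    show ?thesis
    proof (rule additive_subgroup.intro, rule E.M.add.subgroupI)
      show "?B \<subseteq> carrier (E i)" using subsetD[OF torc] by (auto simp: Suc tor)
      show "?B \<noteq> {}" using E.torsion_zero by (auto simp: Suc tor)
    next
      fix a assume "a \<in> ?B"
      then obtain x where x: "x \<in> torsion_elements n (E r)" "a = \<delta> r x" by (auto simp: Suc tor)
      then show "\<ominus>\<^bsub>E i\<^esub> a \<in> ?B"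
        using D.hom_neg[of x r] tora(2)[of x r x] subsetD[OF torc, of x r]
        by (auto simp: Suc tor intro!: rev_image_eqI[of "\<ominus>\<^bsub>E r\<^esub> x"])
      fix b assume "b \<in> ?B"
      then obtain y where y: "y \<in> torsion_elements n (E r)" "b = \<delta> r y" by (auto simp: Suc tor)
      then show "a \<oplus>\<^bsub>E i\<^esub> b \<in> ?B"
        using D.hom_add[OF subsetD[OF torc x(1)] subsetD[OF torc y(1)]] tora(1)[OF x(1) y(1)] x(2)
        unfolding Suc coboundaries.simps tor by (metis image_eqI)
    qed
  qed
  interpret B: additive_subgroup ?B "E i" by (rule Bsub)
  have coset: "?B +>\<^bsub>?T i\<^esub> z = {h \<oplus>\<^bsub>E i\<^esub> z | h. h \<in> ?B}" for z
    by (auto simp: a_r_coset_def r_coset_def torsion_functor_def)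
  have coset_iff: "?B +>\<^bsub>?T i\<^esub> z = ?B \<longleftrightarrow> z \<in> ?B" if z: "z \<in> carrier (E i)" for z
  proof
    assume "?B +>\<^bsub>?T i\<^esub> z = ?B"
    moreover have "z \<in> ?B +>\<^bsub>?T i\<^esub> z" unfolding coset
      using B.zero_closed z by (intro CollectI exI[of _ "\<zero>\<^bsub>E i\<^esub>"]) simp
    ultimately show "z \<in> ?B" by simp
  next
    assume zB: "z \<in> ?B"
    have "h \<in> ?B +>\<^bsub>?T i\<^esub> z" if "h \<in> ?B" for h
    proof -
      have hc: "h \<in> carrier (E i)" using that B.a_Hcarr by blast
      have "h \<oplus>\<^bsub>E i\<^esub> (\<ominus>\<^bsub>E i\<^esub> z) \<in> ?B"
        using B.a_closed[OF that] subgroup.m_inv_closed[OF B.a_subgroup zB] by (simp add: a_inv_def)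
      moreover have "h = (h \<oplus>\<^bsub>E i\<^esub> (\<ominus>\<^bsub>E i\<^esub> z)) \<oplus>\<^bsub>E i\<^esub> z"
        using hc z by (simp add: E.M.a_assoc E.M.l_neg)
      ultimately show ?thesis unfolding coset by blast
    qed
    then have "?B \<subseteq> ?B +>\<^bsub>?T i\<^esub> z" by (rule subsetI)
    moreover have "?B +>\<^bsub>?T i\<^esub> z \<subseteq> ?B" unfolding coset using B.a_closed[OF _ zB] by blast
    ultimately show "?B +>\<^bsub>?T i\<^esub> z = ?B" by (rule equalityI[rotated])
  qed
  have B_iff: "z \<in> ?B \<longleftrightarrow> cobounds 0 i t z" if z: "z \<in> piece (E i) t" for z
  proof (cases i)
    case 0
    then show ?thesis by (simp add: cobounds_def tor)
  next
    case (Suc r)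
    have "\<exists>w\<in>C 0 r t. \<delta> r w = z" if w: "w \<in> torsion_elements n (E r)" "z = \<delta> r w" for w
    proof
      have wc: "w \<in> carrier (E r)" using w torc by auto
      show "E.component r w t \<in> C 0 r t" 
        using E.component(1)[OF wc, of t] E.torsion_component[OF w(1), of t] by (simp add: C_def)
      show "\<delta> r (E.component r w t) = z"
        using D.hom_component[OF wc, of t] w z E.component_piece[of z i t t] by (simp add: Suc)
    qed
    moreover have "z \<in> ?B" if "w \<in> C 0 r t" "\<delta> r w = z" for w
      using that by (auto simp: Suc tor C_def)
    ultimately show ?thesis unfolding cobounds_def Suc coboundaries.simps tor nat.case by blast
  qed
  have ker: "ker_on (?T i) (?T (Suc i)) (\<delta> i) \<inter> piece (?T i) t = {z \<in> C 0 i t. \<delta> i z = \<zero>\<^bsub>E (Suc i)\<^esub>}"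
    by (auto simp: ker_on_def tor C_def)
  \<comment> \<open>Zero is a cocycle, so the set of cosets is nonempty; it is the zero singleton
    exactly when every coset is the zero coset.\<close>
  have ne: "\<zero>\<^bsub>E i\<^esub> \<in> {z \<in> C 0 i t. \<delta> i z = \<zero>\<^bsub>E (Suc i)\<^esub>}" using C_zero by auto
  have img: "f ` A = {b} \<longleftrightarrow> (\<forall>z\<in>A. f z = b)" if "a \<in> A" for f :: "'e \<Rightarrow> 'e set" and A a b
    using that by auto
  have "cohomology_piece ?T \<delta> i t = {?B} \<longleftrightarrow>
     (\<forall>z \<in> {z \<in> C 0 i t. \<delta> i z = \<zero>\<^bsub>E (Suc i)\<^esub>}. ?B +>\<^bsub>?T i\<^esub> z = ?B)"
    unfolding cohomology_piece_def ker by (rule img[OF ne])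
  also have "\<dots> \<longleftrightarrow> (\<forall>z \<in> {z \<in> C 0 i t. \<delta> i z = \<zero>\<^bsub>E (Suc i)\<^esub>}. cobounds 0 i t z)"
  proof (intro ball_cong refl)
    fix z assume "z \<in> {z \<in> C 0 i t. \<delta> i z = \<zero>\<^bsub>E (Suc i)\<^esub>}"
    then have "z \<in> carrier (E i)" "z \<in> piece (E i) t" using C_carr by (auto simp: C_def)
    then show "?B +>\<^bsub>?T i\<^esub> z = ?B \<longleftrightarrow> cobounds 0 i t z" using coset_iff B_iff by blast
  qed
  finally show ?thesis unfolding local_cohomology_nonzero_def by auto
qed

lemma acyclic_at_0_iff: "acyclic_at 0 t \<longleftrightarrow> (\<forall>i. \<not> local_cohomology_nonzero n E \<delta> i t)"
  by (simp add: acyclic_at_def local_cohomology_nonzero_iff)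

end

subsection \<open>Koszul cochains\<close>

text \<open>
  A list of length \<open>j\<close> encodes a set of variables among the first \<open>j\<close>, with its head standing for the
  variable \<open>j - 1\<close>, and its weight is the size of that set. Cochains of degree \<open>p\<close> only matter on lists
  of weight \<open>p\<close>; their values elsewhere are arbitrary. Degrees are integers so that \<open>-1\<close> is allowed.
\<close>

primrec weight :: "bool list \<Rightarrow> int" where
  "weight [] = 0"
| "weight (b # xs) = (if b then 1 else 0) + weight xs"

text \<open>The recursion is the mapping cone of multiplication by the newest variable on the Koszul
  complex of the earlier ones. All signs come from the minus of the cone.\<close>

primrec koszul_d :: "('k::field mpoly, 'b) graded_module \<Rightarrow> bool list \<Rightarrow> (bool list \<Rightarrow> 'b) \<Rightarrow> 'b" where
  "koszul_d M [] f = \<zero>\<^bsub>M\<^esub>"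
| "koszul_d M (b # xs) f =
    (if b then mvar (length xs) \<odot>\<^bsub>M\<^esub> f (False # xs) \<ominus>\<^bsub>M\<^esub> koszul_d M xs (\<lambda>ys. f (True # ys))
     else koszul_d M xs (\<lambda>ys. f (False # ys)))"

lemma weight_nonneg: "0 \<le> weight xs" by (induction xs) auto

lemma weight_le_length: "weight xs \<le> int (length xs)" by (induction xs) auto

lemma weight_replicate [simp]: "weight (replicate j False) = 0" "weight (replicate j True) = int j"
  by (induction j) auto

lemma weight_eq_0: "weight xs = 0 \<Longrightarrow> xs = replicate (length xs) False"
proof (induction xs)
  case (Cons b xs)
  then show ?case using weight_nonneg[of xs] by (auto split: if_splits)
qed simp

lemma weight_eq_length: "weight xs = int (length xs) \<Longrightarrow> xs = replicate (length xs) True"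
proof (induction xs)
  case (Cons b xs)
  then show ?case using weight_le_length[of xs] by (auto split: if_splits)
qed simp

text \<open>Coarser than removing one variable from a set: only sizes are compared. The differential
  at \<open>xs\<close> depends on no other values, and the relation is stable under the list
  recursion.\<close>

definition precedes :: "bool list \<Rightarrow> bool list \<Rightarrow> bool" where
  "precedes xs ys \<longleftrightarrow> length ys = length xs \<and> weight ys + 1 = weight xs"

lemma precedes_Cons [simp]:
  "precedes (True # xs) (False # xs)" "precedes (b # xs) (b # ys) \<longleftrightarrow> precedes xs ys"
  by (auto simp: precedes_def)

lemma koszul_d_cong:
  "(\<And>ys. precedes xs ys \<Longrightarrow> f ys = g ys) \<Longrightarrow> koszul_d M xs f = koszul_d M xs g"
proof (induction xs arbitrary: f g)
  case (Cons b xs)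
  have "koszul_d M xs (\<lambda>ys. f (b # ys)) = koszul_d M xs (\<lambda>ys. g (b # ys))"
    by (rule Cons.IH) (simp add: Cons.prems)
  then show ?case using Cons.prems[of "False # xs"] by (cases b) auto
qed simp

context gmod
begin

lemma diff_diff_diff:
  assumes "a \<in> carrier M" "b \<in> carrier M" "c \<in> carrier M" "d \<in> carrier M"
  shows "(a \<ominus>\<^bsub>M\<^esub> b) \<ominus>\<^bsub>M\<^esub> (c \<ominus>\<^bsub>M\<^esub> d) = (a \<ominus>\<^bsub>M\<^esub> c) \<ominus>\<^bsub>M\<^esub> (b \<ominus>\<^bsub>M\<^esub> d)"
  using assms by (simp add: a_minus_def M.minus_add M.a_ac)

lemma diff_zero [simp]: "a \<in> carrier M \<Longrightarrow> a \<ominus>\<^bsub>M\<^esub> \<zero>\<^bsub>M\<^esub> = a"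
  by (simp add: a_minus_def)

lemma carrier_submodule: "submodule (carrier M) (poly_ring n) M"
  by (rule submoduleI) auto

lemma submodule_diff:
  assumes "submodule Z (poly_ring n) M" "x \<in> Z" "y \<in> Z" shows "x \<ominus>\<^bsub>M\<^esub> y \<in> Z"
  using submoduleE(3,5)[OF assms(1)] assms(2,3) by (simp add: a_minus_def)

lemma submodule_zero:
  assumes "submodule Z (poly_ring n) M" shows "\<zero>\<^bsub>M\<^esub> \<in> Z"
  using submodule.axioms(1)[OF assms] subgroup.one_closed by fastforce

lemma koszul_d_in:
  assumes "submodule Z (poly_ring n) M"
  shows "length xs \<le> n \<Longrightarrow> (\<And>ys. precedes xs ys \<Longrightarrow> f ys \<in> Z) \<Longrightarrow> koszul_d M xs f \<in> Z"
proof (induction xs arbitrary: f)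
  case Nil
  then show ?case using submodule_zero[OF assms] by simp
next
  case (Cons b xs)
  have "koszul_d M xs (\<lambda>ys. f (b # ys)) \<in> Z"
    by (rule Cons.IH) (use Cons.prems in auto)
  then show ?case using Cons.prems(1) Cons.prems(2)[of "False # xs"]
    by (cases b) (auto intro!: submodule_diff[OF assms] submoduleE(4)[OF assms])
qed

lemmas koszul_d_carr = koszul_d_in[OF carrier_submodule]

lemma koszul_d_piece:
  "length xs \<le> n \<Longrightarrow> (\<And>ys. precedes xs ys \<Longrightarrow> f ys \<in> piece M e) \<Longrightarrow> koszul_d M xs f \<in> piece M (e + 1)"
proof (induction xs arbitrary: f)
  case (Cons b xs)
  have "koszul_d M xs (\<lambda>ys. f (b # ys)) \<in> piece M (e + 1)"
    by (rule Cons.IH) (use Cons.prems in auto)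
  then show ?case using Cons.prems(1) Cons.prems(2)[of "False # xs"]
    by (cases b) (auto intro!: piece_diff piece_var)
qed simp

lemma koszul_d_diff:
  "length xs \<le> n \<Longrightarrow> (\<And>ys. precedes xs ys \<Longrightarrow> f ys \<in> carrier M) \<Longrightarrow> (\<And>ys. precedes xs ys \<Longrightarrow> g ys \<in> carrier M) \<Longrightarrow>
    koszul_d M xs (\<lambda>ys. f ys \<ominus>\<^bsub>M\<^esub> g ys) = koszul_d M xs f \<ominus>\<^bsub>M\<^esub> koszul_d M xs g"
proof (induction xs arbitrary: f g)
  case (Cons b xs)
  have IH: "koszul_d M xs (\<lambda>ys. f (b # ys) \<ominus>\<^bsub>M\<^esub> g (b # ys)) = koszul_d M xs (\<lambda>ys. f (b # ys)) \<ominus>\<^bsub>M\<^esub> koszul_d M xs (\<lambda>ys. g (b # ys))"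
    by (rule Cons.IH) (use Cons.prems in auto)
  have c: "koszul_d M xs (\<lambda>ys. f (b # ys)) \<in> carrier M" "koszul_d M xs (\<lambda>ys. g (b # ys)) \<in> carrier M"
    by (rule koszul_d_carr; use Cons.prems in auto)+
  show ?case
  proof (cases b)
    case True
    then show ?thesis using IH c Cons.prems(1) Cons.prems(2,3)[of "False # xs"]
      by (simp add: smult_diff diff_diff_diff)
  qed (use IH in simp)
qed (simp add: diff_eq_zero_iff)

lemma koszul_d_smult:
  assumes p: "p \<in> carrier (poly_ring n)"
  shows "length xs \<le> n \<Longrightarrow> (\<And>ys. precedes xs ys \<Longrightarrow> f ys \<in> carrier M) \<Longrightarrow>
    koszul_d M xs (\<lambda>ys. p \<odot>\<^bsub>M\<^esub> f ys) = p \<odot>\<^bsub>M\<^esub> koszul_d M xs f"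
proof (induction xs arbitrary: f)
  case (Cons b xs)
  have IH: "koszul_d M xs (\<lambda>ys. p \<odot>\<^bsub>M\<^esub> f (b # ys)) = p \<odot>\<^bsub>M\<^esub> koszul_d M xs (\<lambda>ys. f (b # ys))"
    by (rule Cons.IH) (use Cons.prems in auto)
  have c: "koszul_d M xs (\<lambda>ys. f (b # ys)) \<in> carrier M"
    by (rule koszul_d_carr; use Cons.prems in auto)
  show ?case
  proof (cases b)
    case True
    then have "p \<odot>\<^bsub>M\<^esub> (mvar (length xs) \<odot>\<^bsub>M\<^esub> f (False # xs)) = mvar (length xs) \<odot>\<^bsub>M\<^esub> (p \<odot>\<^bsub>M\<^esub> f (False # xs))"
      using Cons.prems p by (intro smult_comm) auto
    then show ?thesis using True IH c p Cons.prems(1) Cons.prems(2)[of "False # xs"]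
      by (simp add: smult_diff)
  qed (use IH in simp)
qed (use p in simp)

text \<open>At a list with head \<open>True\<close>, x_j times the differential of the
  \<open>False\<close> half occurs twice with opposite signs; the remaining double differentials
  vanish by induction.\<close>

lemma koszul_d_koszul_d:
  "length xs \<le> n \<Longrightarrow> (\<And>ys. length ys = length xs \<Longrightarrow> weight ys + 2 = weight xs \<Longrightarrow> f ys \<in> carrier M) \<Longrightarrow>
    koszul_d M xs (\<lambda>ys. koszul_d M ys f) = \<zero>\<^bsub>M\<^esub>"
proof (induction xs arbitrary: f)
  case (Cons b xs)
  have IH: "koszul_d M xs (\<lambda>ys. koszul_d M ys (\<lambda>ys. f (b # ys))) = \<zero>\<^bsub>M\<^esub>"
    by (rule Cons.IH) (use Cons.prems in auto)
  show ?case
  proof (cases b)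
    case True
    have fF: "f (False # ys) \<in> carrier M" if "precedes xs ys" for ys
      using that True by (intro Cons.prems(2)) (auto simp: precedes_def)
    have fT: "koszul_d M ys (\<lambda>ys. f (True # ys)) \<in> carrier M" if "precedes xs ys" for ys
      by (rule koszul_d_carr) (use Cons.prems True that in \<open>auto simp: precedes_def\<close>)
    have k: "koszul_d M xs (\<lambda>ys. f (False # ys)) \<in> carrier M"
      by (rule koszul_d_carr) (use Cons.prems fF in auto)
    have "koszul_d M xs (\<lambda>ys. koszul_d M (True # ys) f)
       = koszul_d M xs (\<lambda>ys. mvar (length xs) \<odot>\<^bsub>M\<^esub> f (False # ys) \<ominus>\<^bsub>M\<^esub> koszul_d M ys (\<lambda>ys. f (True # ys)))"
      by (rule koszul_d_cong) (simp add: precedes_def)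
    also have "\<dots> = koszul_d M xs (\<lambda>ys. mvar (length xs) \<odot>\<^bsub>M\<^esub> f (False # ys)) \<ominus>\<^bsub>M\<^esub> koszul_d M xs (\<lambda>ys. koszul_d M ys (\<lambda>ys. f (True # ys)))"
      by (rule koszul_d_diff) (use Cons.prems fF fT in auto)
    also have "\<dots> = mvar (length xs) \<odot>\<^bsub>M\<^esub> koszul_d M xs (\<lambda>ys. f (False # ys))"
      using IH True koszul_d_smult[of "mvar (length xs)" xs "\<lambda>ys. f (False # ys)"] Cons.prems(1) fF k by simp
    finally show ?thesis using True k Cons.prems(1) by (simp add: diff_eq_zero_iff)
  qed (use IH in simp)
qed simp

lemma koszul_d_weight_0: "weight xs = 0 \<Longrightarrow> koszul_d M xs f = \<zero>\<^bsub>M\<^esub>"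
proof (induction xs arbitrary: f)
  case (Cons b xs)
  then show ?case using weight_nonneg[of xs] by (cases b) auto
qed simp

text \<open>The twist by \<open>p\<close> makes the differential preserve \<open>t\<close>, as each
  variable has degree 1. Coefficients in a subset \<open>Z\<close> spare turning kernels and images
  into graded modules of their own.\<close>

definition cochain :: "'b set \<Rightarrow> nat \<Rightarrow> int \<Rightarrow> int \<Rightarrow> (bool list \<Rightarrow> 'b) \<Rightarrow> bool" where
  "cochain Z j p t f \<longleftrightarrow> (\<forall>xs. length xs = j \<longrightarrow> weight xs = p \<longrightarrow> f xs \<in> Z \<and> f xs \<in> piece M (t + p))"

definition cocycle :: "nat \<Rightarrow> int \<Rightarrow> (bool list \<Rightarrow> 'b) \<Rightarrow> bool" where
  "cocycle j p f \<longleftrightarrow> (\<forall>xs. length xs = j \<longrightarrow> weight xs = p + 1 \<longrightarrow> koszul_d M xs f = \<zero>\<^bsub>M\<^esub>)"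

definition koszul_bounds :: "nat \<Rightarrow> int \<Rightarrow> (bool list \<Rightarrow> 'b) \<Rightarrow> (bool list \<Rightarrow> 'b) \<Rightarrow> bool" where
  "koszul_bounds j p g f \<longleftrightarrow> (\<forall>xs. length xs = j \<longrightarrow> weight xs = p \<longrightarrow> koszul_d M xs g = f xs)"

lemma cochain_mono: "cochain Z j p t f \<Longrightarrow> Z \<subseteq> Z' \<Longrightarrow> cochain Z' j p t f"
  by (auto simp: cochain_def)

lemma cochain_diff:
  assumes "submodule Z (poly_ring n) M" "cochain Z j p t f" "cochain Z j p t g"
  shows "cochain Z j p t (\<lambda>xs. f xs \<ominus>\<^bsub>M\<^esub> g xs)"
  using assms by (auto simp: cochain_def submodule_diff piece_diff)

lemma cochain_koszul_d:
  assumes "submodule Z (poly_ring n) M" "cochain Z j p t f" "j \<le> n"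
  shows "cochain Z j (p + 1) t (\<lambda>xs. koszul_d M xs f)"
  unfolding cochain_def
proof (intro allI impI conjI)
  fix xs assume xs: "length xs = j" "weight xs = p + 1"
  show "koszul_d M xs f \<in> Z" by (rule koszul_d_in[OF assms(1)]) (use assms xs in \<open>auto simp: cochain_def precedes_def\<close>)
  have "koszul_d M xs f \<in> piece M ((t + p) + 1)"
    by (rule koszul_d_piece) (use assms xs in \<open>auto simp: cochain_def precedes_def\<close>)
  then show "koszul_d M xs f \<in> piece M (t + (p + 1))" by (simp add: add.assoc)
qed

lemma koszul_d_diff_cochain:
  assumes "cochain (carrier M) j p t f" "cochain (carrier M) j p t g" "j \<le> n" "length xs = j" "weight xs = p + 1"
  shows "koszul_d M xs (\<lambda>ys. f ys \<ominus>\<^bsub>M\<^esub> g ys) = koszul_d M xs f \<ominus>\<^bsub>M\<^esub> koszul_d M xs g"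
  by (rule koszul_d_diff) (use assms in \<open>auto simp: cochain_def precedes_def\<close>)

lemma koszul_d_carr_cochain:
  assumes "cochain (carrier M) j p t f" "j \<le> n" "length xs = j" "weight xs = p + 1"
  shows "koszul_d M xs f \<in> carrier M"
  by (rule koszul_d_carr) (use assms in \<open>auto simp: cochain_def precedes_def\<close>)

lemma cocycle_koszul_d:
  assumes "cochain (carrier M) j (p - 1) t f" "j \<le> n" shows "cocycle j p (\<lambda>xs. koszul_d M xs f)"
  unfolding cocycle_def
  by (intro allI impI koszul_d_koszul_d) (use assms in \<open>auto simp: cochain_def\<close>)

text \<open>\<open>A\<close> and \<open>B\<close> are the \<open>False\<close> and
  \<open>True\<close> halves of the primitive. The twist \<open>t + 1\<close> of \<open>B\<close>
  makes up for the weight of the removed head.\<close>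

lemma koszul_bounds_combine:
  assumes A: "cochain (carrier M) j (p - 1) t A" and B: "cochain (carrier M) j (p - 2) (t + 1) B"
    and dA: "\<And>xs. length xs = j \<Longrightarrow> weight xs = p \<Longrightarrow> koszul_d M xs A = f (False # xs)"
    and dB: "\<And>xs. length xs = j \<Longrightarrow> weight xs = p - 1 \<Longrightarrow> mvar j \<odot>\<^bsub>M\<^esub> A xs \<ominus>\<^bsub>M\<^esub> koszul_d M xs B = f (True # xs)"
  shows "\<exists>g. cochain (carrier M) (Suc j) (p - 1) t g \<and> koszul_bounds (Suc j) p g f"
proof (intro exI conjI)
  \<comment> \<open>Only lists of length \<open>Suc j\<close> are tested, so the value at
    \<open>[]\<close> is arbitrary.\<close>
  let ?g = "\<lambda>xs. case xs of [] \<Rightarrow> \<zero>\<^bsub>M\<^esub> | b # ys \<Rightarrow> if b then B ys else A ys"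
  show "cochain (carrier M) (Suc j) (p - 1) t ?g"
    unfolding cochain_def
  proof (intro allI impI)
    fix xs assume xs: "length xs = Suc j" "weight xs = p - 1"
    then obtain b ys where b: "xs = b # ys" by (cases xs) auto
    then show "?g xs \<in> carrier M \<and> ?g xs \<in> piece M (t + (p - 1))"
      using xs A B by (cases b) (auto simp: cochain_def algebra_simps)
  qed
  show "koszul_bounds (Suc j) p ?g f"
    unfolding koszul_bounds_def
  proof (intro allI impI)
    fix xs assume xs: "length xs = Suc j" "weight xs = p"
    then obtain b ys where b: "xs = b # ys" by (cases xs) auto
    then show "koszul_d M xs ?g = f xs"
      using xs dA[of ys] dB[of ys] by (cases b) auto
  qed
qed

text \<open>A cochain of degree 0 is a single element, placed at the all-\<open>False\<close> list,
  and its differential collects its multiples by the variables. This links \<open>C n\<close> to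
  Koszul cohomology.\<close>

lemma cocycle_0_iff:
  "j \<le> n \<Longrightarrow> f (replicate j False) \<in> carrier M \<Longrightarrow>
   cocycle j 0 f \<longleftrightarrow> (\<forall>i<j. mvar i \<odot>\<^bsub>M\<^esub> f (replicate j False) = \<zero>\<^bsub>M\<^esub>)"
proof (induction j arbitrary: f)
  case 0
  then show ?case by (auto simp: cocycle_def)
next
  case (Suc j)
  have "cocycle (Suc j) 0 f \<longleftrightarrow> cocycle j 0 (\<lambda>ys. f (False # ys)) \<and> mvar j \<odot>\<^bsub>M\<^esub> f (replicate (Suc j) False) = \<zero>\<^bsub>M\<^esub>"
  proof (intro iffI conjI)
    assume k: "cocycle (Suc j) 0 f"
    show "cocycle j 0 (\<lambda>ys. f (False # ys))"
      unfolding cocycle_def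
    proof (intro allI impI)
      fix xs :: "bool list" assume "length xs = j" "weight xs = 0 + 1"
      then show "koszul_d M xs (\<lambda>ys. f (False # ys)) = \<zero>\<^bsub>M\<^esub>"
        using k[unfolded cocycle_def, rule_format, of "False # xs"] by simp
    qed
    show "mvar j \<odot>\<^bsub>M\<^esub> f (replicate (Suc j) False) = \<zero>\<^bsub>M\<^esub>"
      using k[unfolded cocycle_def, rule_format, of "True # replicate j False"] Suc.prems
      by (simp add: koszul_d_weight_0)
  next
    assume k: "cocycle j 0 (\<lambda>ys. f (False # ys)) \<and> mvar j \<odot>\<^bsub>M\<^esub> f (replicate (Suc j) False) = \<zero>\<^bsub>M\<^esub>"
    show "cocycle (Suc j) 0 f"
      unfolding cocycle_def
    proof (intro allI impI)
      fix xs :: "bool list" assume xs: "length xs = Suc j" "weight xs = 0 + 1"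
      then obtain b ys where b: "xs = b # ys" by (cases xs) auto
      show "koszul_d M xs f = \<zero>\<^bsub>M\<^esub>"
      proof (cases b)
        case True
        then have "ys = replicate j False" using weight_eq_0[of ys] xs b by simp
        then show ?thesis using k True b by (simp add: koszul_d_weight_0 diff_eq_zero_iff)
      qed (use k b xs in \<open>auto simp: cocycle_def\<close>)
    qed
  qed
  then show ?case using Suc.IH[of "\<lambda>ys. f (False # ys)"] Suc.prems by (auto simp: less_Suc_eq)
qed

text \<open>The primitive must take values in \<open>Z\<close> too; a primitive with values in all
  of \<open>M\<close> would not give cohomology with coefficients in \<open>Z\<close>.\<close>

definition koszul_vanishing :: "'b set \<Rightarrow> int \<Rightarrow> int \<Rightarrow> bool" where
  "koszul_vanishing Z p t \<longleftrightarrow> (\<forall>f. cochain Z n p t f \<longrightarrow> cocycle n p f \<longrightarrow> (\<exists>g. cochain Z n (p - 1) t g \<and> koszul_bounds n p g f))"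

end

section \<open>Koszul cochains along a homomorphism and its kernel\<close>

context ghom
begin

lemma koszul_d_hom:
  "length xs \<le> n \<Longrightarrow> (\<And>ys. precedes xs ys \<Longrightarrow> f ys \<in> carrier M) \<Longrightarrow>
    koszul_d N xs (\<lambda>ys. h (f ys)) = h (koszul_d M xs f)"
proof (induction xs arbitrary: f)
  case (Cons b xs)
  have IH: "koszul_d N xs (\<lambda>ys. h (f (b # ys))) = h (koszul_d M xs (\<lambda>ys. f (b # ys)))"
    by (rule Cons.IH) (use Cons.prems in auto)
  have c: "koszul_d M xs (\<lambda>ys. f (b # ys)) \<in> carrier M"
    by (rule M.koszul_d_carr; use Cons.prems in auto)
  show ?case
  proof (cases b)
    case True
    then show ?thesis using IH c Cons.prems(1) Cons.prems(2)[of "False # xs"]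
      by (simp add: hom_diff hom_smult)
  qed (use IH in simp)
qed simp

definition kernel :: "'b set" where "kernel = {x \<in> carrier M. h x = \<zero>\<^bsub>N\<^esub>}"

lemma kernel_sub: "kernel \<subseteq> carrier M" by (auto simp: kernel_def)

lemma cochain_lift:
  assumes "N.cochain (h ` carrier M) j p t f"
  obtains g where "M.cochain (carrier M) j p t g" "\<And>xs. length xs = j \<Longrightarrow> weight xs = p \<Longrightarrow> h (g xs) = f xs"
proof -
  have "\<exists>y. length xs = j \<longrightarrow> weight xs = p \<longrightarrow> y \<in> piece M (t + p) \<and> h y = f xs" for xs
    using assms hom_lift_piece[of "f xs" "t + p"] by (metis N.cochain_def)
  then obtain g where g: "\<And>xs. length xs = j \<Longrightarrow> weight xs = p \<Longrightarrow> g xs \<in> piece M (t + p) \<and> h (g xs) = f xs" by metis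
  then have "M.cochain (carrier M) j p t g" unfolding M.cochain_def using M.piece_carr by blast
  then show ?thesis using that[of g] g by blast
qed

lemma cochain_hom: "M.cochain (carrier M) j p t f \<Longrightarrow> N.cochain (h ` carrier M) j p t (\<lambda>xs. h (f xs))"
  by (auto simp: M.cochain_def N.cochain_def hom_piece)

lemma koszul_d_hom_cochain:
  assumes "M.cochain (carrier M) n p t f" "length xs = n" "weight xs = p + 1"
    and k: "\<And>ys. length ys = n \<Longrightarrow> weight ys = p \<Longrightarrow> h (f ys) = k ys"
  shows "h (koszul_d M xs f) = koszul_d N xs k"
proof -
  have "h (koszul_d M xs f) = koszul_d N xs (\<lambda>ys. h (f ys))"
    by (rule koszul_d_hom[symmetric]) (use assms in \<open>auto simp: M.cochain_def precedes_def\<close>)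
  also have "\<dots> = koszul_d N xs k" by (rule koszul_d_cong) (use assms in \<open>auto simp: precedes_def\<close>)
  finally show ?thesis .
qed

text \<open>Surjectivity on cohomology from \<open>M\<close> to the image of \<open>h\<close>,
  stated for cocycles because coboundaries always lift; equivalently, the connecting map into the
  cohomology of the kernel is zero.\<close>

definition cocycles_lift :: "int \<Rightarrow> int \<Rightarrow> bool" where
  "cocycles_lift p t \<longleftrightarrow> (\<forall>f. N.cochain (h ` carrier M) n p t f \<longrightarrow> N.cocycle n p f \<longrightarrow>
     (\<exists>g. M.cochain (carrier M) n p t g \<and> M.cocycle n p g \<and> (\<forall>xs. length xs = n \<longrightarrow> weight xs = p \<longrightarrow> h (g xs) = f xs)))"

text \<open>
  The next two lemmas are the connecting isomorphism of the long exact sequence, split in two because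
  for the socle of an injective module only the first half is available.
\<close>

lemma koszul_vanishing_kernel_iff_cocycles_lift:
  assumes a1: "\<And>f. M.cochain kernel n (p + 1) t f \<Longrightarrow> M.cocycle n (p + 1) f \<Longrightarrow>
     \<exists>g. M.cochain (carrier M) n p t g \<and> M.koszul_bounds n (p + 1) g f"
  shows "M.koszul_vanishing kernel (p + 1) t \<longleftrightarrow> cocycles_lift p t"
proof
  assume van: "M.koszul_vanishing kernel (p + 1) t"
  show "cocycles_lift p t"
    unfolding cocycles_lift_def
  proof (intro allI impI)
    fix f assume f: "N.cochain (h ` carrier M) n p t f" and fcl: "N.cocycle n p f"
    obtain g where g: "M.cochain (carrier M) n p t g" "\<And>xs. length xs = n \<Longrightarrow> weight xs = p \<Longrightarrow> h (g xs) = f xs"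
      using cochain_lift[OF f] by blast
    \<comment> \<open>The differential of \<open>g\<close> is sent to that of \<open>f\<close>,
      which is zero, so it is a cocycle in the kernel. A primitive \<open>k\<close> in the kernel
      corrects \<open>g\<close> to the cocycle \<open>g - k\<close>.\<close>
    have "M.cochain kernel n (p + 1) t (\<lambda>xs. koszul_d M xs g)"
      using M.cochain_koszul_d[OF M.carrier_submodule g(1)] koszul_d_hom_cochain[OF g(1) _ _ g(2)] fcl
      by (auto simp: M.cochain_def kernel_def N.cocycle_def)
    moreover have "M.cocycle n (p + 1) (\<lambda>xs. koszul_d M xs g)" by (rule M.cocycle_koszul_d) (use g in auto)
    ultimately obtain k where k: "M.cochain kernel n p t k" "M.koszul_bounds n (p + 1) k (\<lambda>xs. koszul_d M xs g)"
      using van by (auto simp: M.koszul_vanishing_def)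
    have kc: "M.cochain (carrier M) n p t k" using M.cochain_mono[OF k(1) kernel_sub] .
    show "\<exists>g. M.cochain (carrier M) n p t g \<and> M.cocycle n p g \<and> (\<forall>xs. length xs = n \<longrightarrow> weight xs = p \<longrightarrow> h (g xs) = f xs)"
    proof (intro exI[of _ "\<lambda>xs. g xs \<ominus>\<^bsub>M\<^esub> k xs"] conjI allI impI)
      show "M.cochain (carrier M) n p t (\<lambda>xs. g xs \<ominus>\<^bsub>M\<^esub> k xs)"
        by (rule M.cochain_diff[OF M.carrier_submodule g(1) kc])
      show "M.cocycle n p (\<lambda>xs. g xs \<ominus>\<^bsub>M\<^esub> k xs)"
        unfolding M.cocycle_def
      proof (intro allI impI)
        fix xs assume xs: "length xs = n" "weight xs = p + 1"
        show "koszul_d M xs (\<lambda>xs. g xs \<ominus>\<^bsub>M\<^esub> k xs) = \<zero>\<^bsub>M\<^esub>"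
          using M.koszul_d_diff_cochain[OF g(1) kc _ xs] M.koszul_d_carr_cochain[OF g(1) _ xs] k(2) xs
          by (simp add: M.koszul_bounds_def M.diff_eq_zero_iff)
      qed
      fix xs assume xs: "length xs = n" "weight xs = p"
      then have "g xs \<in> carrier M" "k xs \<in> carrier M" "h (k xs) = \<zero>\<^bsub>N\<^esub>"
        using g kc k(1) by (auto simp: M.cochain_def kernel_def)
      then show "h (g xs \<ominus>\<^bsub>M\<^esub> k xs) = f xs" using g(2)[OF xs] hom_carr[of "g xs"] by (simp add: hom_diff)
    qed
  qed
next
  assume li: "cocycles_lift p t"
  show "M.koszul_vanishing kernel (p + 1) t"
    unfolding M.koszul_vanishing_def
  proof (intro allI impI)
    fix f assume f: "M.cochain kernel n (p + 1) t f" "M.cocycle n (p + 1) f"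
    obtain g where g: "M.cochain (carrier M) n p t g" "M.koszul_bounds n (p + 1) g f" using a1[OF f] by blast
    \<comment> \<open>The differential of \<open>g\<close> is \<open>f\<close>, with values in the
      kernel, so the image of \<open>g\<close> is a cocycle. If \<open>g'\<close> is a cocycle
      lifting it, then \<open>g - g'\<close> lies in the kernel and still bounds
      \<open>f\<close>.\<close>
    have "N.cocycle n p (\<lambda>xs. h (g xs))"
      unfolding N.cocycle_def
    proof (intro allI impI)
      fix xs assume xs: "length xs = n" "weight xs = p + 1"
      have "koszul_d N xs (\<lambda>xs. h (g xs)) = h (koszul_d M xs g)"
        using koszul_d_hom_cochain[OF g(1) xs, of "\<lambda>xs. h (g xs)"] by simp
      then show "koszul_d N xs (\<lambda>xs. h (g xs)) = \<zero>\<^bsub>N\<^esub>"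
        using f(1) g(2) xs by (simp add: M.koszul_bounds_def M.cochain_def kernel_def)
    qed
    then obtain g' where g': "M.cochain (carrier M) n p t g'" "M.cocycle n p g'"
      "\<And>xs. length xs = n \<Longrightarrow> weight xs = p \<Longrightarrow> h (g' xs) = h (g xs)"
      using li cochain_hom[OF g(1)] unfolding cocycles_lift_def by blast
    show "\<exists>g. M.cochain kernel n (p + 1 - 1) t g \<and> M.koszul_bounds n (p + 1) g f"
    proof (intro exI[of _ "\<lambda>xs. g xs \<ominus>\<^bsub>M\<^esub> g' xs"] conjI)
      have "M.cochain (carrier M) n p t (\<lambda>xs. g xs \<ominus>\<^bsub>M\<^esub> g' xs)"
        by (rule M.cochain_diff[OF M.carrier_submodule g(1) g'(1)])
      moreover have "h (g xs \<ominus>\<^bsub>M\<^esub> g' xs) = \<zero>\<^bsub>N\<^esub>" if xs: "length xs = n" "weight xs = p" for xs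
      proof -
        have "g xs \<in> carrier M" "g' xs \<in> carrier M" using xs g(1) g'(1) by (auto simp: M.cochain_def)
        then show ?thesis using g'(3)[OF xs] by (simp add: hom_diff N.diff_eq_zero_iff)
      qed
      ultimately show "M.cochain kernel n (p + 1 - 1) t (\<lambda>xs. g xs \<ominus>\<^bsub>M\<^esub> g' xs)"
        by (simp add: M.cochain_def kernel_def)
      show "M.koszul_bounds n (p + 1) (\<lambda>xs. g xs \<ominus>\<^bsub>M\<^esub> g' xs) f"
        unfolding M.koszul_bounds_def
      proof (intro allI impI)
        fix xs assume xs: "length xs = n" "weight xs = p + 1"
        have "f xs \<in> carrier M" using f(1) xs by (auto simp: M.cochain_def kernel_def)
        then show "koszul_d M xs (\<lambda>xs. g xs \<ominus>\<^bsub>M\<^esub> g' xs) = f xs"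
          using M.koszul_d_diff_cochain[OF g(1) g'(1) _ xs] g(2) g'(2) xs by (simp add: M.koszul_bounds_def M.cocycle_def)
      qed
    qed
  qed
qed

lemma cocycles_lift_iff_koszul_vanishing:
  assumes a2: "M.koszul_vanishing (carrier M) p t"
  shows "cocycles_lift p t \<longleftrightarrow> N.koszul_vanishing (h ` carrier M) p t"
proof
  assume li: "cocycles_lift p t"
  show "N.koszul_vanishing (h ` carrier M) p t"
    unfolding N.koszul_vanishing_def
  proof (intro allI impI)
    fix f assume "N.cochain (h ` carrier M) n p t f" "N.cocycle n p f"
    then obtain g where g: "M.cochain (carrier M) n p t g" "M.cocycle n p g"
      "\<And>xs. length xs = n \<Longrightarrow> weight xs = p \<Longrightarrow> h (g xs) = f xs"
      using li unfolding cocycles_lift_def by blast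
    obtain k where k: "M.cochain (carrier M) n (p - 1) t k" "M.koszul_bounds n p k g"
      using a2 g unfolding M.koszul_vanishing_def by blast
    have "koszul_d N xs (\<lambda>xs. h (k xs)) = f xs" if "length xs = n" "weight xs = p" for xs
      using koszul_d_hom_cochain[OF k(1), of xs "\<lambda>xs. h (k xs)"] that k(2) g(3) by (simp add: M.koszul_bounds_def)
    then show "\<exists>g. N.cochain (h ` carrier M) n (p - 1) t g \<and> N.koszul_bounds n p g f"
      using cochain_hom[OF k(1)] unfolding N.koszul_bounds_def by blast
  qed
next
  assume van: "N.koszul_vanishing (h ` carrier M) p t"
  show "cocycles_lift p t"
    unfolding cocycles_lift_def
  proof (intro allI impI)
    fix f assume "N.cochain (h ` carrier M) n p t f" "N.cocycle n p f"
    then obtain k where k: "N.cochain (h ` carrier M) n (p - 1) t k" "N.koszul_bounds n p k f"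
      using van unfolding N.koszul_vanishing_def by blast
    \<comment> \<open>A primitive of \<open>f\<close> is lifted instead of \<open>f\<close> itself:
      the differential of that lift is automatically a cocycle over \<open>f\<close>.\<close>
    obtain g where g: "M.cochain (carrier M) n (p - 1) t g"
      "\<And>xs. length xs = n \<Longrightarrow> weight xs = p - 1 \<Longrightarrow> h (g xs) = k xs"
      using cochain_lift[OF k(1)] by blast
    have "h (koszul_d M xs g) = f xs" if xs: "length xs = n" "weight xs = p" for xs
      using koszul_d_hom_cochain[OF g(1), of xs k] g(2) k(2) xs by (simp add: N.koszul_bounds_def)
    then show "\<exists>g. M.cochain (carrier M) n p t g \<and> M.cocycle n p g \<and> (\<forall>xs. length xs = n \<longrightarrow> weight xs = p \<longrightarrow> h (g xs) = f xs)"
      using M.cochain_koszul_d[OF M.carrier_submodule g(1)] M.cocycle_koszul_d[OF g(1)]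
      by (intro exI[of _ "\<lambda>xs. koszul_d M xs g"]) auto
  qed
qed

text \<open>In the top degree every cochain is a cocycle, so H^n is right exact: H^n(kernel) ->
  H^n(M) -> H^n(image) -> 0. The assumption says that the first map is zero.\<close>

lemma koszul_vanishing_top_iff:
  assumes a1: "\<And>f. M.cochain kernel n (int n) t f \<Longrightarrow>
     \<exists>g. M.cochain (carrier M) n (int n - 1) t g \<and> M.koszul_bounds n (int n) g f"
  shows "M.koszul_vanishing (carrier M) (int n) t \<longleftrightarrow> N.koszul_vanishing (h ` carrier M) (int n) t"
proof -
  have noxs: False if "length xs = n" "weight xs = int n + 1" for xs using that weight_le_length[of xs] by simp
  have cl: "M.cocycle n (int n) f" "N.cocycle n (int n) f'" for f f'
    using noxs by (auto simp: M.cocycle_def N.cocycle_def)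
  show ?thesis
  proof
    assume van: "M.koszul_vanishing (carrier M) (int n) t"
    then have "cocycles_lift (int n) t"
      unfolding cocycles_lift_def using cochain_lift cl(1) by metis
    then show "N.koszul_vanishing (h ` carrier M) (int n) t" using cocycles_lift_iff_koszul_vanishing[OF van] by simp
  next
    assume van: "N.koszul_vanishing (h ` carrier M) (int n) t"
    show "M.koszul_vanishing (carrier M) (int n) t"
      unfolding M.koszul_vanishing_def
    proof (intro allI impI)
      fix f assume f: "M.cochain (carrier M) n (int n) t f"
      obtain k where k: "N.cochain (h ` carrier M) n (int n - 1) t k" "N.koszul_bounds n (int n) k (\<lambda>xs. h (f xs))"
        using van cochain_hom[OF f] cl(2) unfolding N.koszul_vanishing_def by blast
      obtain g where g: "M.cochain (carrier M) n (int n - 1) t g"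
        "\<And>xs. length xs = n \<Longrightarrow> weight xs = int n - 1 \<Longrightarrow> h (g xs) = k xs"
        using cochain_lift[OF k(1)] by blast
      have kg: "M.cochain (carrier M) n (int n) t (\<lambda>xs. koszul_d M xs g)"
        using M.cochain_koszul_d[OF M.carrier_submodule g(1)] by simp
      have "h (koszul_d M xs g \<ominus>\<^bsub>M\<^esub> f xs) = \<zero>\<^bsub>N\<^esub>" if xs: "length xs = n" "weight xs = int n" for xs
      proof -
        have "h (koszul_d M xs g) = h (f xs)"
          using koszul_d_hom_cochain[OF g(1), of xs k] g(2) k(2) xs by (simp add: N.koszul_bounds_def)
        moreover have "koszul_d M xs g \<in> carrier M" "f xs \<in> carrier M" using f kg xs by (auto simp: M.cochain_def)
        ultimately show ?thesis by (simp add: hom_diff N.diff_eq_zero_iff)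
      qed
      then have "M.cochain kernel n (int n) t (\<lambda>xs. koszul_d M xs g \<ominus>\<^bsub>M\<^esub> f xs)"
        using M.cochain_diff[OF M.carrier_submodule kg f] by (simp add: M.cochain_def kernel_def)
      from a1[OF this] obtain g' where g': "M.cochain (carrier M) n (int n - 1) t g'"
        "M.koszul_bounds n (int n) g' (\<lambda>xs. koszul_d M xs g \<ominus>\<^bsub>M\<^esub> f xs)" by blast
      show "\<exists>g. M.cochain (carrier M) n (int n - 1) t g \<and> M.koszul_bounds n (int n) g f"
      proof (intro exI[of _ "\<lambda>xs. g xs \<ominus>\<^bsub>M\<^esub> g' xs"] conjI)
        show "M.cochain (carrier M) n (int n - 1) t (\<lambda>xs. g xs \<ominus>\<^bsub>M\<^esub> g' xs)"
          by (rule M.cochain_diff[OF M.carrier_submodule g(1) g'(1)])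
        show "M.koszul_bounds n (int n) (\<lambda>xs. g xs \<ominus>\<^bsub>M\<^esub> g' xs) f"
          unfolding M.koszul_bounds_def
        proof (intro allI impI)
          fix xs assume xs: "length xs = n" "weight xs = int n"
          have c: "koszul_d M xs g \<in> carrier M" "f xs \<in> carrier M" using kg f xs by (auto simp: M.cochain_def)
          have "koszul_d M xs (\<lambda>xs. g xs \<ominus>\<^bsub>M\<^esub> g' xs) = koszul_d M xs g \<ominus>\<^bsub>M\<^esub> (koszul_d M xs g \<ominus>\<^bsub>M\<^esub> f xs)"
            using M.koszul_d_diff_cochain[OF g(1) g'(1) _ xs(1)] xs g'(2) by (simp add: M.koszul_bounds_def)
          then show "koszul_d M xs (\<lambda>xs. g xs \<ominus>\<^bsub>M\<^esub> g' xs) = f xs"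
            using c by (simp add: a_minus_def M.M.minus_add M.M.r_neg2)
        qed
      qed
    qed
  qed
qed

end

subsection \<open>Exactness of Koszul complexes\<close>

context gmod
begin

lemma diff_diff_cancel: "a \<in> carrier M \<Longrightarrow> b \<in> carrier M \<Longrightarrow> a \<ominus>\<^bsub>M\<^esub> (a \<ominus>\<^bsub>M\<^esub> b) = b"
  by (simp add: a_minus_def M.minus_add M.r_neg2)

lemma cochain_False: "cochain Z (Suc j) p t f \<Longrightarrow> cochain Z j p t (\<lambda>xs. f (False # xs))"
  by (simp add: cochain_def)

lemma cochain_True: "cochain Z (Suc j) p t f \<Longrightarrow> cochain Z j (p - 1) (t + 1) (\<lambda>xs. f (True # xs))"
  by (auto simp: cochain_def)

lemma kcoD: "cochain Z j p t f \<Longrightarrow> length xs = j \<Longrightarrow> weight xs = p \<Longrightarrow> f xs \<in> Z \<and> f xs \<in> piece M (t + p)"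
  by (simp add: cochain_def)

lemma cocycle_False:
  assumes "cocycle (Suc j) p f" shows "cocycle j p (\<lambda>xs. f (False # xs))"
  unfolding cocycle_def
proof (intro allI impI)
  fix xs assume "length xs = j" "weight xs = p + 1"
  then have "koszul_d M (False # xs) f = \<zero>\<^bsub>M\<^esub>" using assms by (auto simp: cocycle_def simp del: koszul_d.simps)
  then show "koszul_d M xs (\<lambda>xs. f (False # xs)) = \<zero>\<^bsub>M\<^esub>" by simp
qed

lemma cocycle_True:
  assumes "cochain (carrier M) (Suc j) p t f" "cocycle (Suc j) p f" "Suc j \<le> n" "length xs = j" "weight xs = p"
  shows "mvar j \<odot>\<^bsub>M\<^esub> f (False # xs) = koszul_d M xs (\<lambda>xs. f (True # xs))"
proof -
  have "koszul_d M (True # xs) f = \<zero>\<^bsub>M\<^esub>" using assms(2,4,5) by (auto simp: cocycle_def simp del: koszul_d.simps)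
  moreover have "f (False # xs) \<in> carrier M" using assms by (auto simp: cochain_def)
  moreover have "koszul_d M xs (\<lambda>xs. f (True # xs)) \<in> carrier M"
    using koszul_d_carr_cochain[OF cochain_True[OF assms(1)], of xs] assms by auto
  ultimately show ?thesis using assms by (simp add: diff_eq_zero_iff)
qed

text \<open>The cone step from \<open>j\<close> to \<open>Suc j\<close>. Once \<open>a\<close>
  bounds the \<open>False\<close> half of \<open>f\<close>, the obstruction is the cocycle
  \<open>c\<close>. It is removed by a primitive \<open>B\<close> of \<open>c\<close>, or for
  \<open>p = 1\<close> by changing \<open>a\<close> by a cocycle \<open>A\<close> with x_j
  \<open>A = c\<close>.\<close>

lemma koszul_step:
  assumes f: "cochain (carrier M) (Suc j) p t f" "cocycle (Suc j) p f" "Suc j \<le> n"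
    and a: "cochain (carrier M) j (p - 1) t a" "koszul_bounds j p a (\<lambda>xs. f (False # xs))"
  defines "c \<equiv> (\<lambda>xs. mvar j \<odot>\<^bsub>M\<^esub> a xs \<ominus>\<^bsub>M\<^esub> f (True # xs))"
  shows "cochain (carrier M) j (p - 1) (t + 1) c" "cocycle j (p - 1) c"
    "\<And>A. cochain (carrier M) j (p - 1) t A \<Longrightarrow> cocycle j (p - 1) A \<Longrightarrow> p = 1 \<Longrightarrow>
      (\<And>xs. length xs = j \<Longrightarrow> weight xs = 0 \<Longrightarrow> mvar j \<odot>\<^bsub>M\<^esub> A xs = c xs) \<Longrightarrow>
      \<exists>g. cochain (carrier M) (Suc j) (p - 1) t g \<and> koszul_bounds (Suc j) p g f"
    "\<And>B. cochain (carrier M) j (p - 2) (t + 1) B \<Longrightarrow> koszul_bounds j (p - 1) B c \<Longrightarrow>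
      \<exists>g. cochain (carrier M) (Suc j) (p - 1) t g \<and> koszul_bounds (Suc j) p g f"
proof -
  have xa: "cochain (carrier M) j (p - 1) (t + 1) (\<lambda>xs. mvar j \<odot>\<^bsub>M\<^esub> a xs)"
    unfolding cochain_def
  proof (intro allI impI)
    fix xs assume "length xs = j" "weight xs = p - 1"
    from kcoD[OF a(1) this] show "mvar j \<odot>\<^bsub>M\<^esub> a xs \<in> carrier M \<and> mvar j \<odot>\<^bsub>M\<^esub> a xs \<in> piece M (t + 1 + (p - 1))"
      using f(3) piece_var[of j "a xs" "t + (p - 1)"] by (simp add: algebra_simps)
  qed
  have b: "cochain (carrier M) j (p - 1) (t + 1) (\<lambda>xs. f (True # xs))" using cochain_True[OF f(1)] .
  show "cochain (carrier M) j (p - 1) (t + 1) c"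
    unfolding c_def by (rule cochain_diff[OF carrier_submodule xa b])
  show "cocycle j (p - 1) c"
    unfolding cocycle_def
  proof (intro allI impI)
    fix xs assume xs: "length xs = j" "weight xs = p - 1 + 1"
    have "koszul_d M xs (\<lambda>xs. mvar j \<odot>\<^bsub>M\<^esub> a xs) = mvar j \<odot>\<^bsub>M\<^esub> koszul_d M xs a"
      by (rule koszul_d_smult) (use a(1) f(3) xs in \<open>auto simp: cochain_def precedes_def\<close>)
    also have "\<dots> = koszul_d M xs (\<lambda>xs. f (True # xs))"
      using cocycle_True[OF f] a(2) xs by (simp add: koszul_bounds_def)
    finally show "koszul_d M xs c = \<zero>\<^bsub>M\<^esub>"
      unfolding c_def using koszul_d_diff_cochain[OF xa b _ xs] koszul_d_carr_cochain[OF b _ xs] f(3) by (simp add: diff_eq_zero_iff)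
  qed
  have ac: "a xs \<in> carrier M" "f (True # xs) \<in> carrier M" if "length xs = j" "weight xs = p - 1" for xs
    using a(1) b that by (auto simp: cochain_def)
  show "\<exists>g. cochain (carrier M) (Suc j) (p - 1) t g \<and> koszul_bounds (Suc j) p g f"
    if A: "cochain (carrier M) j (p - 1) t A" "cocycle j (p - 1) A" "p = 1"
      "\<And>xs. length xs = j \<Longrightarrow> weight xs = 0 \<Longrightarrow> mvar j \<odot>\<^bsub>M\<^esub> A xs = c xs" for A
  proof (rule koszul_bounds_combine)
    show "cochain (carrier M) j (p - 1) t (\<lambda>xs. a xs \<ominus>\<^bsub>M\<^esub> A xs)"
      by (rule cochain_diff[OF carrier_submodule a(1) A(1)])
    show "cochain (carrier M) j (p - 2) (t + 1) (\<lambda>_. \<zero>\<^bsub>M\<^esub>)" by (simp add: cochain_def)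
    show "koszul_d M xs (\<lambda>xs. a xs \<ominus>\<^bsub>M\<^esub> A xs) = f (False # xs)" if xs: "length xs = j" "weight xs = p" for xs
    proof -
      have xs': "weight xs = p - 1 + 1" using xs by simp
      have "f (False # xs) \<in> carrier M" using f(1) xs by (auto simp: cochain_def)
      then show ?thesis
        using koszul_d_diff_cochain[OF a(1) A(1) _ xs(1) xs'] a(2) A(2) xs f(3) by (simp add: koszul_bounds_def cocycle_def)
    qed
    show "mvar j \<odot>\<^bsub>M\<^esub> (a xs \<ominus>\<^bsub>M\<^esub> A xs) \<ominus>\<^bsub>M\<^esub> koszul_d M xs (\<lambda>_. \<zero>\<^bsub>M\<^esub>) = f (True # xs)"
      if xs: "length xs = j" "weight xs = p - 1" for xs
    proof -
      have "A xs \<in> carrier M" using A(1) xs by (auto simp: cochain_def)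
      then have "mvar j \<odot>\<^bsub>M\<^esub> (a xs \<ominus>\<^bsub>M\<^esub> A xs) = f (True # xs)"
        using A(3) A(4)[of xs] xs ac[OF xs] f(3) by (simp add: smult_diff c_def diff_diff_cancel)
      then show ?thesis using koszul_d_weight_0[of xs] xs A(3) ac[OF xs] by simp
    qed
  qed
  show "\<exists>g. cochain (carrier M) (Suc j) (p - 1) t g \<and> koszul_bounds (Suc j) p g f"
    if B: "cochain (carrier M) j (p - 2) (t + 1) B" "koszul_bounds j (p - 1) B c" for B
    by (rule koszul_bounds_combine[OF a(1) B(1)]) (use a(2) B(2) ac f(3) in \<open>auto simp: koszul_bounds_def c_def diff_diff_cancel\<close>)
qed

text \<open>The assumption is coregularity: x_j is surjective on the elements killed by the earlier
  variables. For \<open>p > 1\<close> the obstruction \<open>c\<close> bounds by induction; for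
  \<open>p = 1\<close> it is one element killed by the earlier variables and gets divided by
  x_j.\<close>

lemma koszul_exact_divisible:
  assumes div: "\<And>j e c. j < n \<Longrightarrow> c \<in> piece M (e + 1) \<Longrightarrow> (\<And>i. i < j \<Longrightarrow> mvar i \<odot>\<^bsub>M\<^esub> c = \<zero>\<^bsub>M\<^esub>) \<Longrightarrow>
    \<exists>d\<in>piece M e. mvar j \<odot>\<^bsub>M\<^esub> d = c \<and> (\<forall>i<j. mvar i \<odot>\<^bsub>M\<^esub> d = \<zero>\<^bsub>M\<^esub>)"
  shows "j \<le> n \<Longrightarrow> 1 \<le> p \<Longrightarrow> cochain (carrier M) j p t f \<Longrightarrow> cocycle j p f \<Longrightarrow>
    \<exists>g. cochain (carrier M) j (p - 1) t g \<and> koszul_bounds j p g f"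
proof (induction j arbitrary: p t f)
  case 0
  then show ?case by (intro exI[of _ "\<lambda>_. \<zero>\<^bsub>M\<^esub>"]) (auto simp: cochain_def koszul_bounds_def)
next
  case (Suc j)
  obtain a where a: "cochain (carrier M) j (p - 1) t a" "koszul_bounds j p a (\<lambda>xs. f (False # xs))"
    using Suc.IH[OF _ Suc.prems(2) cochain_False[OF Suc.prems(3)] cocycle_False[OF Suc.prems(4)]] Suc.prems(1) by auto
  note step = koszul_step[OF Suc.prems(3,4,1) a]
  let ?c = "\<lambda>xs. mvar j \<odot>\<^bsub>M\<^esub> a xs \<ominus>\<^bsub>M\<^esub> f (True # xs)"
  show ?case
  proof (cases "p = 1")
    case False
    then obtain B where "cochain (carrier M) j (p - 1 - 1) (t + 1) B" "koszul_bounds j (p - 1) B ?c"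
      using Suc.IH[OF _ _ step(1,2)] Suc.prems(1,2) by auto
    then show ?thesis using step(4)[of B] by simp
  next
    case True
    let ?o = "replicate j False"
    have c: "?c ?o \<in> piece M (t + 1)" "?c ?o \<in> carrier M"
      using kcoD[OF step(1), of ?o] True by auto
    have "cocycle j 0 ?c" using step(2) True by simp
    then have "\<And>i. i < j \<Longrightarrow> mvar i \<odot>\<^bsub>M\<^esub> ?c ?o = \<zero>\<^bsub>M\<^esub>"
      using cocycle_0_iff[of j ?c] c(2) Suc.prems(1) by auto
    then obtain d where d: "d \<in> piece M t" "mvar j \<odot>\<^bsub>M\<^esub> d = ?c ?o" "\<forall>i<j. mvar i \<odot>\<^bsub>M\<^esub> d = \<zero>\<^bsub>M\<^esub>"
      using div[of j "?c ?o" t] c(1) Suc.prems(1) by auto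
    show ?thesis
    proof (rule step(3)[of "\<lambda>_. d"])
      show "cochain (carrier M) j (p - 1) t (\<lambda>_. d)" using d piece_carr True by (auto simp: cochain_def)
      show "cocycle j (p - 1) (\<lambda>_. d)" using cocycle_0_iff[of j "\<lambda>_. d"] d piece_carr True Suc.prems(1) by auto
      show "p = 1" by fact
      show "mvar j \<odot>\<^bsub>M\<^esub> d = ?c xs" if "length xs = j" "weight xs = 0" for xs
        using d weight_eq_0[OF that(2)] that(1) by simp
    qed
  qed
qed

text \<open>The part of degree \<open>d\<close> of \<open>(x_0, \<dots>, x_{j-1}) M\<close>.\<close>

primrec var_multiples :: "nat \<Rightarrow> int \<Rightarrow> 'b set" where
  "var_multiples 0 d = {\<zero>\<^bsub>M\<^esub>}"
| "var_multiples (Suc j) d = {mvar j \<odot>\<^bsub>M\<^esub> a \<oplus>\<^bsub>M\<^esub> b | a b. a \<in> piece M (d - 1) \<and> b \<in> var_multiples j d}"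

lemma var_multiples_SucI: "a \<in> piece M (d - 1) \<Longrightarrow> b \<in> var_multiples j d \<Longrightarrow> mvar j \<odot>\<^bsub>M\<^esub> a \<oplus>\<^bsub>M\<^esub> b \<in> var_multiples (Suc j) d"
  by auto

lemma var_multiples_piece: "j \<le> n \<Longrightarrow> x \<in> var_multiples j d \<Longrightarrow> x \<in> piece M d"
proof (induction j arbitrary: x)
  case (Suc j)
  then show ?case using piece_var[of j _ "d - 1"] by (auto intro!: piece_add)
qed simp

lemma var_multiples_carr: "j \<le> n \<Longrightarrow> x \<in> var_multiples j d \<Longrightarrow> x \<in> carrier M"
  using var_multiples_piece piece_carr by blast

lemma var_multiples_zero: "j \<le> n \<Longrightarrow> \<zero>\<^bsub>M\<^esub> \<in> var_multiples j d"
proof (induction j)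
  case (Suc j)
  then show ?case using var_multiples_SucI[OF piece_zero, of "\<zero>\<^bsub>M\<^esub>" j d] by simp
qed simp

lemma var_multiples_add: "j \<le> n \<Longrightarrow> x \<in> var_multiples j d \<Longrightarrow> y \<in> var_multiples j d \<Longrightarrow> x \<oplus>\<^bsub>M\<^esub> y \<in> var_multiples j d"
proof (induction j arbitrary: x y)
  case (Suc j)
  then obtain a b a' b' where x: "x = mvar j \<odot>\<^bsub>M\<^esub> a \<oplus>\<^bsub>M\<^esub> b" "a \<in> piece M (d - 1)" "b \<in> var_multiples j d"
    and y: "y = mvar j \<odot>\<^bsub>M\<^esub> a' \<oplus>\<^bsub>M\<^esub> b'" "a' \<in> piece M (d - 1)" "b' \<in> var_multiples j d" by auto
  have c: "a \<in> carrier M" "a' \<in> carrier M" "b \<in> carrier M" "b' \<in> carrier M"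
    using x y piece_carr var_multiples_carr[of j] Suc.prems(1) by auto
  have "x \<oplus>\<^bsub>M\<^esub> y = mvar j \<odot>\<^bsub>M\<^esub> (a \<oplus>\<^bsub>M\<^esub> a') \<oplus>\<^bsub>M\<^esub> (b \<oplus>\<^bsub>M\<^esub> b')"
    using c Suc.prems(1) unfolding x(1) y(1) by (simp add: smult_r_distr M.a_ac)
  then show ?case using var_multiples_SucI[OF piece_add[OF x(2) y(2)] Suc.IH[OF _ x(3) y(3)]] Suc.prems(1) by simp
qed simp

lemma var_multiples_neg: "j \<le> n \<Longrightarrow> x \<in> var_multiples j d \<Longrightarrow> \<ominus>\<^bsub>M\<^esub> x \<in> var_multiples j d"
proof (induction j arbitrary: x)
  case (Suc j)
  then obtain a b where x: "x = mvar j \<odot>\<^bsub>M\<^esub> a \<oplus>\<^bsub>M\<^esub> b" "a \<in> piece M (d - 1)" "b \<in> var_multiples j d" by auto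
  have c: "a \<in> carrier M" "b \<in> carrier M"
    using x piece_carr var_multiples_carr[of j] Suc.prems(1) by auto
  have "\<ominus>\<^bsub>M\<^esub> x = mvar j \<odot>\<^bsub>M\<^esub> (\<ominus>\<^bsub>M\<^esub> a) \<oplus>\<^bsub>M\<^esub> (\<ominus>\<^bsub>M\<^esub> b)"
    using c Suc.prems(1) unfolding x(1) by (simp add: smult_r_minus M.minus_add)
  then show ?case using var_multiples_SucI[OF piece_neg[OF x(2)] Suc.IH[OF _ x(3)]] Suc.prems(1) by simp
qed simp

lemma var_multiples_subgroup: "j \<le> n \<Longrightarrow> additive_subgroup (var_multiples j d) M"
  by (rule additive_subgroup.intro, rule M.add.subgroupI)
    (auto intro: var_multiples_carr var_multiples_add var_multiples_neg dest: var_multiples_zero)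

lemma var_multiples_var:
  assumes "i < j" "j \<le> n" "z \<in> piece M (d - 1)" shows "mvar i \<odot>\<^bsub>M\<^esub> z \<in> var_multiples j d"
  using assms(1,2)
proof (induction j)
  case (Suc j)
  show ?case
  proof (cases "i = j")
    case True
    then have "mvar i \<odot>\<^bsub>M\<^esub> z = mvar j \<odot>\<^bsub>M\<^esub> z \<oplus>\<^bsub>M\<^esub> \<zero>\<^bsub>M\<^esub>" using assms(3) Suc.prems piece_carr by simp
    then show ?thesis using var_multiples_SucI[OF assms(3) var_multiples_zero[of j d]] Suc.prems by simp
  next
    case False
    then have q: "mvar i \<odot>\<^bsub>M\<^esub> z \<in> var_multiples j d" using Suc by auto
    then have "mvar i \<odot>\<^bsub>M\<^esub> z = mvar j \<odot>\<^bsub>M\<^esub> \<zero>\<^bsub>M\<^esub> \<oplus>\<^bsub>M\<^esub> mvar i \<odot>\<^bsub>M\<^esub> z"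
      using var_multiples_carr[OF _ q] Suc.prems by simp
    then show ?thesis using var_multiples_SucI[OF piece_zero q] by simp
  qed
qed simp

text \<open>A top coboundary is a signed sum of multiples of the variables, so top cohomology
  surjects onto a piece of \<open>M\<close> modulo the variables.\<close>

lemma koszul_d_top_var_multiples:
  "j \<le> n \<Longrightarrow> cochain (carrier M) j (int j - 1) t g \<Longrightarrow> koszul_d M (replicate j True) g \<in> var_multiples j (t + int j)"
proof (induction j arbitrary: t g)
  case (Suc j)
  let ?i = "replicate j True"
  have "cochain (carrier M) j (int j - 1) (t + 1) (\<lambda>xs. g (True # xs))"
    using cochain_True[OF Suc.prems(2)] by simp
  then have "koszul_d M ?i (\<lambda>xs. g (True # xs)) \<in> var_multiples j (t + 1 + int j)"
    using Suc.IH Suc.prems(1) by simp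
  then have q: "\<ominus>\<^bsub>M\<^esub> koszul_d M ?i (\<lambda>xs. g (True # xs)) \<in> var_multiples j (t + int (Suc j))"
    using var_multiples_neg[of j] Suc.prems(1) by (simp add: algebra_simps)
  have "g (False # ?i) \<in> piece M (t + int (Suc j) - 1)"
    using kcoD[OF Suc.prems(2), of "False # ?i"] by (simp add: algebra_simps)
  from var_multiples_SucI[OF this q] show ?case by (simp add: a_minus_def)
qed simp

text \<open>The assumption says that the variables form a regular sequence. The cases below the top
  and at the top are proved together because degree \<open>j\<close> is below the top for
  \<open>Suc j\<close> variables but is the top degree for \<open>j\<close> variables.\<close>

lemma koszul_exact_regular:
  assumes reg: "\<And>j d a. j < n \<Longrightarrow> a \<in> piece M d \<Longrightarrow> mvar j \<odot>\<^bsub>M\<^esub> a \<in> var_multiples j (d + 1) \<Longrightarrow> a \<in> var_multiples j d"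
  shows "j \<le> n \<Longrightarrow> cochain (carrier M) j p t f \<Longrightarrow>
    (p < int j \<and> cocycle j p f) \<or> (p = int j \<and> f (replicate j True) \<in> var_multiples j (t + int j)) \<Longrightarrow>
    \<exists>g. cochain (carrier M) j (p - 1) t g \<and> koszul_bounds j p g f"
proof (induction j arbitrary: p t f)
  case 0
  show ?case
  proof (intro exI[of _ "\<lambda>_. \<zero>\<^bsub>M\<^esub>"] conjI)
    show "cochain (carrier M) 0 (p - 1) t (\<lambda>_. \<zero>\<^bsub>M\<^esub>)" by (simp add: cochain_def)
    show "koszul_bounds 0 p (\<lambda>_. \<zero>\<^bsub>M\<^esub>) f" using "0.prems"(3) by (auto simp: koszul_bounds_def)
  qed
next
  case (Suc j)
  let ?i = "replicate j True"
  show ?case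
  proof (cases "p = int (Suc j)")
    case False
    then have p: "p < int (Suc j)" and cl: "cocycle (Suc j) p f" using Suc.prems(3) by auto
    \<comment> \<open>The \<open>False\<close> half is then a top cochain for \<open>j\<close>
      variables. The cocycle condition puts its multiple by x_j among the multiples of the earlier
      variables, and regularity cancels x_j.\<close>
    have "f (False # ?i) \<in> var_multiples j (t + int j)" if pj: "p = int j"
    proof (rule reg)
      show "j < n" using Suc.prems by simp
      show "f (False # ?i) \<in> piece M (t + int j)"
        using kcoD[OF cochain_False[OF Suc.prems(2)], of ?i] pj by simp
      have "mvar j \<odot>\<^bsub>M\<^esub> f (False # ?i) = koszul_d M ?i (\<lambda>xs. f (True # xs))"
        using cocycle_True[OF Suc.prems(2) cl Suc.prems(1)] pj by simp
      also have "\<dots> \<in> var_multiples j (t + 1 + int j)"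
        by (rule koszul_d_top_var_multiples) (use cochain_True[OF Suc.prems(2)] pj Suc.prems(1) in auto)
      finally show "mvar j \<odot>\<^bsub>M\<^esub> f (False # ?i) \<in> var_multiples j (t + int j + 1)" by (simp add: algebra_simps)
    qed
    then have "p < int j \<and> cocycle j p (\<lambda>xs. f (False # xs)) \<or> p = int j \<and> f (False # ?i) \<in> var_multiples j (t + int j)"
      using cocycle_False[OF cl] p by linarith
    then obtain a where a: "cochain (carrier M) j (p - 1) t a" "koszul_bounds j p a (\<lambda>xs. f (False # xs))"
      using Suc.IH[OF _ cochain_False[OF Suc.prems(2)]] Suc.prems(1) by auto
    note step = koszul_step[OF Suc.prems(2) cl Suc.prems(1) a]
    obtain B where "cochain (carrier M) j (p - 1 - 1) (t + 1) B"
      "koszul_bounds j (p - 1) B (\<lambda>xs. mvar j \<odot>\<^bsub>M\<^esub> a xs \<ominus>\<^bsub>M\<^esub> f (True # xs))"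
      using Suc.IH[OF _ step(1)] step(2) p Suc.prems(1) by auto
    then show ?thesis using step(4)[of B] by simp
  next
    case True
    then have "f (replicate (Suc j) True) \<in> var_multiples (Suc j) (t + int (Suc j))" using Suc.prems(3) by auto
    \<comment> \<open>The primitive has \<open>y\<close> as its \<open>False\<close> half and a
      primitive of the negative of \<open>q\<close> as its \<open>True\<close> half; the minus in
      the differential turns the latter back into \<open>q\<close>.\<close>
    then obtain y q where yq: "f (True # ?i) = mvar j \<odot>\<^bsub>M\<^esub> y \<oplus>\<^bsub>M\<^esub> q"
      "y \<in> piece M (t + int j)" "q \<in> var_multiples j (t + 1 + int j)" by (auto simp: algebra_simps)
    have nq: "\<ominus>\<^bsub>M\<^esub> q \<in> var_multiples j (t + 1 + int j)" using var_multiples_neg[OF _ yq(3)] Suc.prems(1) by simp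
    have qc: "q \<in> carrier M" "y \<in> carrier M"
      using var_multiples_carr[OF _ yq(3)] piece_carr[OF yq(2)] Suc.prems(1) by auto
    have "cochain (carrier M) j (int j) (t + 1) (\<lambda>_. \<ominus>\<^bsub>M\<^esub> q)"
      using var_multiples_piece[OF _ nq] var_multiples_carr[OF _ nq] Suc.prems(1) by (simp add: cochain_def)
    then obtain B where B: "cochain (carrier M) j (int j - 1) (t + 1) B" "koszul_bounds j (int j) B (\<lambda>_. \<ominus>\<^bsub>M\<^esub> q)"
      using Suc.IH[of "int j" "t + 1" "\<lambda>_. \<ominus>\<^bsub>M\<^esub> q"] nq Suc.prems(1) by auto
    show ?thesis
    proof (rule koszul_bounds_combine)
      show "cochain (carrier M) j (p - 1) t (\<lambda>_. y)" using yq(2) qc True by (simp add: cochain_def)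
      show "cochain (carrier M) j (p - 2) (t + 1) B" using B(1) True by (simp add: algebra_simps)
      show "koszul_d M xs (\<lambda>_. y) = f (False # xs)" if "length xs = j" "weight xs = p" for xs
        using that True weight_le_length[of xs] by simp
      show "mvar j \<odot>\<^bsub>M\<^esub> y \<ominus>\<^bsub>M\<^esub> koszul_d M xs B = f (True # xs)" if xs: "length xs = j" "weight xs = p - 1" for xs
      proof -
        have "xs = ?i" using xs True weight_eq_length[of xs] by simp
        then show ?thesis using xs True B(2) yq(1) qc Suc.prems(1) by (simp add: koszul_bounds_def a_minus_def)
      qed
    qed
  qed
qed

end

subsection \<open>Graded free modules\<close>

context gmod
begin

lemma smult_add_left:
  "p \<in> carrier (poly_ring n) \<Longrightarrow> q \<in> carrier (poly_ring n) \<Longrightarrow> x \<in> carrier M \<Longrightarrow>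
    (p + q) \<odot>\<^bsub>M\<^esub> x = p \<odot>\<^bsub>M\<^esub> x \<oplus>\<^bsub>M\<^esub> q \<odot>\<^bsub>M\<^esub> x"
  using smult_l_distr[of p q x] by simp

lemma smult_mult_left:
  "p \<in> carrier (poly_ring n) \<Longrightarrow> q \<in> carrier (poly_ring n) \<Longrightarrow> x \<in> carrier M \<Longrightarrow>
    (p * q) \<odot>\<^bsub>M\<^esub> x = p \<odot>\<^bsub>M\<^esub> (q \<odot>\<^bsub>M\<^esub> x)"
  using smult_assoc1[of p q x] by simp

lemma smult_zero_one: "x \<in> carrier M \<Longrightarrow> 0 \<odot>\<^bsub>M\<^esub> x = \<zero>\<^bsub>M\<^esub>" "x \<in> carrier M \<Longrightarrow> 1 \<odot>\<^bsub>M\<^esub> x = x"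
  using smult_l_null[of x] smult_one[of x] by simp_all

end

locale free_gmod = gmod n M for n and M :: "('k::field mpoly, 'b) graded_module" +
  fixes B :: "'b set"
  assumes basis: "homogeneous_basis n M B"
begin

definition lincomb :: "('b \<Rightarrow> 'k mpoly) \<Rightarrow> 'b" where
  "lincomb c = finsum M (\<lambda>b. c b \<odot>\<^bsub>M\<^esub> b) B"

definition coord :: "'b \<Rightarrow> 'b \<Rightarrow> 'k mpoly" where
  "coord x = (THE c. c \<in> B \<rightarrow>\<^sub>E carrier (poly_ring n) \<and> x = lincomb c)"

lemma finite_B: "finite B" and B_homogeneous: "b \<in> B \<Longrightarrow> \<exists>d. b \<in> piece M d"
  using basis by (auto simp: homogeneous_basis_def)

lemma B_carr: "b \<in> B \<Longrightarrow> b \<in> carrier M"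
  using B_homogeneous piece_carr by blast

lemma coord_ex1: "x \<in> carrier M \<Longrightarrow> \<exists>!c. c \<in> B \<rightarrow>\<^sub>E carrier (poly_ring n) \<and> x = lincomb c"
  using basis by (simp add: homogeneous_basis_def lincomb_def)

lemma coord:
  assumes "x \<in> carrier M"
  shows "b \<in> B \<Longrightarrow> coord x b \<in> carrier (poly_ring n)" "lincomb (coord x) = x"
  using theI'[OF coord_ex1[OF assms]] unfolding coord_def[symmetric] by auto

lemma lincomb_cong: "(\<And>b. b \<in> B \<Longrightarrow> c b = c' b) \<Longrightarrow> (\<And>b. b \<in> B \<Longrightarrow> c' b \<in> carrier (poly_ring n)) \<Longrightarrow> lincomb c = lincomb c'"
  unfolding lincomb_def by (rule M.finsum_cong') (auto simp: B_carr)

lemma lincomb_closed: "(\<And>b. b \<in> B \<Longrightarrow> c b \<in> carrier (poly_ring n)) \<Longrightarrow> lincomb c \<in> carrier M"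
  unfolding lincomb_def by (rule M.finsum_closed) (auto simp: B_carr)

lemma coord_lincomb:
  assumes c: "\<And>b. b \<in> B \<Longrightarrow> c b \<in> carrier (poly_ring n)" and b: "b \<in> B"
  shows "coord (lincomb c) b = c b"
proof -
  have "lincomb (restrict c B) = lincomb c" by (rule lincomb_cong) (use c in auto)
  then have "coord (lincomb c) = restrict c B"
    unfolding coord_def using coord_ex1[OF lincomb_closed, of c] c by (intro the1_equality) auto
  then show ?thesis using b by simp
qed

lemma lincomb_add:
  assumes "\<And>b. b \<in> B \<Longrightarrow> c b \<in> carrier (poly_ring n)" "\<And>b. b \<in> B \<Longrightarrow> c' b \<in> carrier (poly_ring n)"
  shows "lincomb (\<lambda>b. c b + c' b) = lincomb c \<oplus>\<^bsub>M\<^esub> lincomb c'"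
proof -
  have "lincomb (\<lambda>b. c b + c' b) = finsum M (\<lambda>b. c b \<odot>\<^bsub>M\<^esub> b \<oplus>\<^bsub>M\<^esub> c' b \<odot>\<^bsub>M\<^esub> b) B"
    unfolding lincomb_def
    by (rule M.finsum_cong') (use assms B_carr in \<open>auto simp: smult_add_left\<close>)
  also have "\<dots> = lincomb c \<oplus>\<^bsub>M\<^esub> lincomb c'"
    unfolding lincomb_def by (rule M.finsum_addf) (use assms B_carr in auto)
  finally show ?thesis .
qed

lemma lincomb_smult:
  assumes "\<And>b. b \<in> B \<Longrightarrow> c b \<in> carrier (poly_ring n)" "p \<in> carrier (poly_ring n)"
  shows "lincomb (\<lambda>b. p * c b) = p \<odot>\<^bsub>M\<^esub> lincomb c"
proof -
  have "p \<odot>\<^bsub>M\<^esub> lincomb c = finsum M (\<lambda>b. p \<odot>\<^bsub>M\<^esub> (c b \<odot>\<^bsub>M\<^esub> b)) B"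
    unfolding lincomb_def using assms finite_B B_carr by (intro finsum_smult_ldistr) auto
  also have "\<dots> = lincomb (\<lambda>b. p * c b)"
    unfolding lincomb_def
    by (rule M.finsum_cong') (use assms B_carr in \<open>auto simp: carrier_mult smult_mult_left\<close>)
  finally show ?thesis by simp
qed

lemma coord_add:
  assumes "x \<in> carrier M" "y \<in> carrier M" "b \<in> B"
  shows "coord (x \<oplus>\<^bsub>M\<^esub> y) b = coord x b + coord y b"
proof -
  have "lincomb (\<lambda>b. coord x b + coord y b) = x \<oplus>\<^bsub>M\<^esub> y"
    using lincomb_add[of "coord x" "coord y"] coord assms by simp
  then show ?thesis using coord_lincomb[of "\<lambda>b. coord x b + coord y b" b] coord(1) assms by (simp add: carrier_add)
qed

lemma coord_smult:
  assumes "x \<in> carrier M" "p \<in> carrier (poly_ring n)" "b \<in> B"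
  shows "coord (p \<odot>\<^bsub>M\<^esub> x) b = p * coord x b"
proof -
  have "lincomb (\<lambda>b. p * coord x b) = p \<odot>\<^bsub>M\<^esub> x"
    using lincomb_smult[of "coord x" p] coord assms by simp
  then show ?thesis using coord_lincomb[of "\<lambda>b. p * coord x b" b] coord(1) assms by (simp add: carrier_mult)
qed

lemma coord_zero: "b \<in> B \<Longrightarrow> coord \<zero>\<^bsub>M\<^esub> b = 0"
  using coord_smult[of "\<zero>\<^bsub>M\<^esub>" 0 b] by simp

lemma coord_basis: "b \<in> B \<Longrightarrow> coord b b = 1"
proof -
  assume b: "b \<in> B"
  let ?c = "\<lambda>b'. if b' = b then 1 else 0 :: 'k mpoly"
  have "lincomb ?c = finsum M (\<lambda>b'. if b = b' then b' else \<zero>\<^bsub>M\<^esub>) B"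
    unfolding lincomb_def
    by (rule M.finsum_cong') (use B_carr in \<open>auto simp: smult_zero_one\<close>)
  also have "\<dots> = b"
    using M.finsum_singleton[OF b finite_B, of "\<lambda>b. b"] B_carr by auto
  finally show ?thesis using coord_lincomb[of ?c b] b by simp
qed

lemma smult_homogeneous_piece:
  assumes "p \<in> carrier (poly_ring n)" "b \<in> piece M e" "\<And>u. u \<in> keys p \<Longrightarrow> int (monom_degree u) + e = d"
  shows "p \<odot>\<^bsub>M\<^esub> b \<in> piece M d"
proof (rule smult_in_subgroup[OF assms(1) piece_carr[OF assms(2)] piece_subgroup])
  fix u assume u: "u \<in> keys p"
  then have "keys u \<subseteq> {..<n}" using assms(1) by (auto simp: poly_ring_carrier)
  from piece_single[OF this assms(2), of "lookup p u"]
  show "single u (lookup p u) \<odot>\<^bsub>M\<^esub> b \<in> piece M d" using assms(3)[OF u] by simp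
qed

lemma lincomb_piece:
  assumes "\<And>b. b \<in> B \<Longrightarrow> c b \<in> carrier (poly_ring n)"
    "\<And>b e u. b \<in> B \<Longrightarrow> b \<in> piece M e \<Longrightarrow> u \<in> keys (c b) \<Longrightarrow> int (monom_degree u) + e = d"
  shows "lincomb c \<in> piece M d"
  unfolding lincomb_def
proof (rule finsum_in_subgroup[OF piece_subgroup])
  fix b assume b: "b \<in> B"
  then obtain e where "b \<in> piece M e" using B_homogeneous by blast
  then show "c b \<odot>\<^bsub>M\<^esub> b \<in> piece M d" using assms b by (intro smult_homogeneous_piece) auto
qed

lemma basis_nonzero: "b \<in> B \<Longrightarrow> b \<noteq> \<zero>\<^bsub>M\<^esub>"
  using coord_basis[of b] coord_zero[of b] by auto

text \<open>Split every coordinate into its terms of the expected degree and the rest. The rest has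
  no part in degree \<open>d\<close>, so \<open>x\<close> equals the combination of the first parts,
  and uniqueness of coordinates finishes.\<close>

lemma coord_homogeneous:
  assumes x: "x \<in> piece M d" and b: "b \<in> B" "b \<in> piece M e" and u: "u \<in> keys (coord x b)"
  shows "int (monom_degree u) + e = d"
proof -
  have xc: "x \<in> carrier M" using x piece_carr by blast
  \<comment> \<open>The choice is harmless: a basis element is nonzero, so it lies in one piece
    only.\<close>
  define dg where "dg b = (SOME e. b \<in> piece M e)" for b
  have dg: "b \<in> piece M (dg b)" if "b \<in> B" for b
    unfolding dg_def using B_homogeneous[OF that] by (rule someI_ex)
  have dgu: "dg b = e" if "b \<in> B" "b \<in> piece M e" for b e
    using piece_unique[OF dg that(2)] that basis_nonzero by auto
  define c where "c b = Poly_Mapping.mapp (\<lambda>m a. a when int (monom_degree m) + dg b = d) (coord x b)" for b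
  define c' where "c' b = Poly_Mapping.mapp (\<lambda>m a. a when int (monom_degree m) + dg b \<noteq> d) (coord x b)" for b
  have lc: "lookup (c b) m = (if int (monom_degree m) + dg b = d then lookup (coord x b) m else 0)"
    "lookup (c' b) m = (if int (monom_degree m) + dg b \<noteq> d then lookup (coord x b) m else 0)" for b m
    by (auto simp: c_def c'_def lookup_mapp when_def in_keys_iff)
  have kc: "m \<in> keys (c b) \<longleftrightarrow> m \<in> keys (coord x b) \<and> int (monom_degree m) + dg b = d"
    "m \<in> keys (c' b) \<longleftrightarrow> m \<in> keys (coord x b) \<and> int (monom_degree m) + dg b \<noteq> d" for b m
    by (auto simp: in_keys_iff lc)
  have cc: "c b \<in> carrier (poly_ring n)" "c' b \<in> carrier (poly_ring n)" if "b \<in> B" for b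
    using coord(1)[OF xc that] by (auto simp: poly_ring_carrier kc)
  have sum: "coord x b = c b + c' b" for b
    by (rule poly_mapping_eqI) (simp add: lookup_add lc)
  have y: "lincomb c \<in> piece M d"
    by (rule lincomb_piece) (use cc dgu in \<open>auto simp: kc\<close>)
  have z: "lincomb c' \<in> {y \<in> carrier M. component y d = \<zero>\<^bsub>M\<^esub>}"
    unfolding lincomb_def
  proof (rule finsum_in_subgroup[OF component_kernel_subgroup])
    fix b assume b: "b \<in> B"
    show "c' b \<odot>\<^bsub>M\<^esub> b \<in> {y \<in> carrier M. component y d = \<zero>\<^bsub>M\<^esub>}"
    proof (rule smult_in_subgroup[OF cc(2)[OF b] B_carr[OF b] component_kernel_subgroup])
      fix u assume u: "u \<in> keys (c' b)"
      then have "keys u \<subseteq> {..<n}" using cc(2)[OF b] by (auto simp: poly_ring_carrier)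
      from piece_single[OF this dg[OF b]]
      have p: "single u (lookup (c' b) u) \<odot>\<^bsub>M\<^esub> b \<in> piece M (int (monom_degree u) + dg b)" .
      have "int (monom_degree u) + dg b \<noteq> d" using u kc by blast
      then show "single u (lookup (c' b) u) \<odot>\<^bsub>M\<^esub> b \<in> {y \<in> carrier M. component y d = \<zero>\<^bsub>M\<^esub>}"
        using component_piece[OF p, of d] piece_carr[OF p] by auto
    qed
  qed
  have "coord x = (\<lambda>b. c b + c' b)" by (rule ext) (rule sum)
  then have "x = lincomb (\<lambda>b. c b + c' b)" using coord(2)[OF xc] by simp
  also have "\<dots> = lincomb c \<oplus>\<^bsub>M\<^esub> lincomb c'" by (rule lincomb_add) (use cc in auto)
  finally have e: "x = lincomb c \<oplus>\<^bsub>M\<^esub> lincomb c'" .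
  have "component x d = lincomb c"
    unfolding e using component_add[of "lincomb c" "lincomb c'" d] z y component_piece[OF y] piece_carr[OF y] by auto
  then have "x = lincomb c" using component_piece[OF x] by simp
  then have "coord x b = c b" using coord_lincomb[of c b] cc b by simp
  then have "u \<in> keys (c b)" using u by simp
  then have "int (monom_degree u) + dg b = d" unfolding kc by blast
  then show ?thesis using dgu[OF b] by simp
qed

text \<open>A left inverse of multiplication by x_j that commutes with the other variables. It
  replaces computations in quotients of the free module.\<close>

definition coord_div :: "nat \<Rightarrow> 'b \<Rightarrow> 'b" where
  "coord_div j x = lincomb (\<lambda>b. var_div j (coord x b))"

lemma coord_div_add:
  assumes "x \<in> carrier M" "y \<in> carrier M"
  shows "coord_div j (x \<oplus>\<^bsub>M\<^esub> y) = coord_div j x \<oplus>\<^bsub>M\<^esub> coord_div j y"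
proof -
  have "coord_div j (x \<oplus>\<^bsub>M\<^esub> y) = lincomb (\<lambda>b. var_div j (coord x b) + var_div j (coord y b))"
    unfolding coord_div_def by (rule lincomb_cong) (use assms coord(1) in \<open>auto simp: coord_add var_div_add var_div_carrier carrier_add\<close>)
  then show ?thesis
    using lincomb_add[of "\<lambda>b. var_div j (coord x b)" "\<lambda>b. var_div j (coord y b)"] assms coord(1)
    by (simp add: coord_div_def var_div_carrier)
qed

lemma coord_div_var:
  assumes "x \<in> carrier M" "j < n" shows "coord_div j (mvar j \<odot>\<^bsub>M\<^esub> x) = x"
proof -
  have "coord_div j (mvar j \<odot>\<^bsub>M\<^esub> x) = lincomb (coord x)"
    unfolding coord_div_def by (rule lincomb_cong) (use assms coord(1) in \<open>auto simp: coord_smult\<close>)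
  then show ?thesis using coord(2)[OF assms(1)] by simp
qed

lemma coord_div_var_other:
  assumes "x \<in> carrier M" "i < n" "i \<noteq> j" shows "coord_div j (mvar i \<odot>\<^bsub>M\<^esub> x) = mvar i \<odot>\<^bsub>M\<^esub> coord_div j x"
proof -
  have "coord_div j (mvar i \<odot>\<^bsub>M\<^esub> x) = lincomb (\<lambda>b. mvar i * var_div j (coord x b))"
    unfolding coord_div_def
    by (rule lincomb_cong) (use assms coord(1) in \<open>auto simp: coord_smult var_div_mvar_mult_other var_div_carrier carrier_mult\<close>)
  then show ?thesis
    using lincomb_smult[of "\<lambda>b. var_div j (coord x b)" "mvar i"] assms coord(1) by (simp add: coord_div_def var_div_carrier)
qed

lemma coord_div_piece:
  assumes "x \<in> piece M d" shows "coord_div j x \<in> piece M (d - 1)"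
  unfolding coord_div_def
proof (rule lincomb_piece)
  fix b assume b: "b \<in> B"
  then show "var_div j (coord x b) \<in> carrier (poly_ring n)" using coord(1) assms piece_carr by (auto intro: var_div_carrier)
  fix e u assume e: "b \<in> piece M e" and "u \<in> keys (var_div j (coord x b))"
  then have "u + single j 1 \<in> keys (coord x b)" by (simp add: keys_var_div)
  from coord_homogeneous[OF assms b e this]
  show "int (monom_degree u) + e = d - 1" by (simp add: monom_degree_add)
qed

lemma coord_div_var_multiples:
  assumes "k < n"
  shows "j \<le> k \<Longrightarrow> x \<in> var_multiples j (d + 1) \<Longrightarrow> coord_div k x \<in> var_multiples j d"
proof (induction j arbitrary: x)
  case 0
  then show ?case using coord_div_var[of "\<zero>\<^bsub>M\<^esub>" k] assms by simp
next
  case (Suc j)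
  then obtain a b where x: "x = mvar j \<odot>\<^bsub>M\<^esub> a \<oplus>\<^bsub>M\<^esub> b" "a \<in> piece M d" "b \<in> var_multiples j (d + 1)" by auto
  have c: "a \<in> carrier M" "b \<in> carrier M"
    using x piece_carr var_multiples_carr[of j] Suc.prems assms by auto
  have "coord_div k x = mvar j \<odot>\<^bsub>M\<^esub> coord_div k a \<oplus>\<^bsub>M\<^esub> coord_div k b"
    unfolding x(1) using coord_div_add[of "mvar j \<odot>\<^bsub>M\<^esub> a" b k] coord_div_var_other[of a j k] c Suc.prems assms by simp
  then show ?case using var_multiples_SucI[OF coord_div_piece[OF x(2)] Suc.IH[OF _ x(3)]] Suc.prems by simp
qed

text \<open>Apply \<open>coord_div j\<close> to x_j \<open>a\<close>: the result is
  \<open>a\<close>, and \<open>coord_div j\<close> maps multiples of the earlier variables to such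
  multiples.\<close>

lemma regular:
  assumes "j < n" "a \<in> piece M d" "mvar j \<odot>\<^bsub>M\<^esub> a \<in> var_multiples j (d + 1)"
  shows "a \<in> var_multiples j d"
  using coord_div_var_multiples[OF assms(1) order_refl assms(3)] coord_div_var[of a j] assms piece_carr by simp

lemma zero_in_keys_mult: "0 \<in> keys (p * q :: 'k mpoly) \<Longrightarrow> 0 \<in> keys p \<and> 0 \<in> keys q"
proof -
  assume "0 \<in> keys (p * q)"
  then obtain a b where "0 = a + b" "a \<in> keys p" "b \<in> keys q" using keys_mult by blast
  moreover from this have "monom_degree a = 0" "monom_degree b = 0"
    using monom_degree_add[of a b] by auto
  ultimately show ?thesis by (auto simp: monom_degree_eq_0_iff)
qed

text \<open>The product of the irrelevant ideal with the free module.\<close>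

definition no_constants :: "'b set" where "no_constants = {x \<in> carrier M. \<forall>b\<in>B. 0 \<notin> keys (coord x b)}"

lemma no_constants_add: "x \<in> no_constants \<Longrightarrow> y \<in> no_constants \<Longrightarrow> x \<oplus>\<^bsub>M\<^esub> y \<in> no_constants"
  by (auto simp: no_constants_def coord_add in_keys_iff lookup_add)

lemma no_constants_smult: "x \<in> no_constants \<Longrightarrow> p \<in> carrier (poly_ring n) \<Longrightarrow> p \<odot>\<^bsub>M\<^esub> x \<in> no_constants"
  by (auto simp: no_constants_def coord_smult dest!: zero_in_keys_mult)

lemma no_constants_submodule: "submodule no_constants (poly_ring n) M"
proof (rule submoduleI)
  fix a assume a: "a \<in> no_constants"
  have "(- 1) \<odot>\<^bsub>M\<^esub> a = \<ominus>\<^bsub>M\<^esub> a"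
  proof -
    have "(1 + - 1) \<odot>\<^bsub>M\<^esub> a = a \<oplus>\<^bsub>M\<^esub> (- 1) \<odot>\<^bsub>M\<^esub> a"
      using a smult_l_distr[of 1 "- 1" a] smult_one[of a] by (simp add: no_constants_def carrier_uminus)
    then have "(- 1) \<odot>\<^bsub>M\<^esub> a \<oplus>\<^bsub>M\<^esub> a = \<zero>\<^bsub>M\<^esub>"
      using a smult_l_null[of a] M.a_comm[of a "(- 1) \<odot>\<^bsub>M\<^esub> a"] by (simp add: no_constants_def carrier_uminus)
    then show ?thesis
      using M.minus_equality[of "(- 1) \<odot>\<^bsub>M\<^esub> a" a] a by (simp add: no_constants_def carrier_uminus)
  qed
  then show "\<ominus>\<^bsub>M\<^esub> a \<in> no_constants" using no_constants_smult[OF a, of "- 1"] by (simp add: carrier_uminus)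
qed (auto simp: no_constants_add no_constants_smult, auto simp: no_constants_def coord_zero)

lemma var_multiples_no_constants: "j \<le> n \<Longrightarrow> x \<in> var_multiples j d \<Longrightarrow> x \<in> no_constants"
proof (induction j arbitrary: x)
  case 0
  then show ?case by (simp add: no_constants_def coord_zero)
next
  case (Suc j)
  then obtain a b where x: "x = mvar j \<odot>\<^bsub>M\<^esub> a \<oplus>\<^bsub>M\<^esub> b" "a \<in> piece M (d - 1)" "b \<in> var_multiples j d" by auto
  have "mvar j \<odot>\<^bsub>M\<^esub> a \<in> no_constants"
    using piece_carr[OF x(2)] Suc.prems(1)
    by (auto simp: no_constants_def coord_smult in_keys_iff lookup_mvar_mult)
  then show ?case unfolding x(1) using Suc.IH[OF _ x(3)] Suc.prems(1) by (intro no_constants_add) auto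
qed

text \<open>Each monomial of a coordinate is nonconstant, so a variable splits off. With
  \<open>var_multiples_no_constants\<close> this matches the coordinate form with the form in which
  Koszul coboundaries appear.\<close>

lemma no_constants_var_multiples:
  assumes x: "x \<in> piece M d" "x \<in> no_constants" shows "x \<in> var_multiples n d"
proof -
  have xc: "x \<in> carrier M" using x by (simp add: no_constants_def)
  have "lincomb (coord x) \<in> var_multiples n d"
    unfolding lincomb_def
  proof (rule finsum_in_subgroup[OF var_multiples_subgroup[OF order_refl]])
    fix b assume b: "b \<in> B"
    then obtain e where e: "b \<in> piece M e" using B_homogeneous by blast
    show "coord x b \<odot>\<^bsub>M\<^esub> b \<in> var_multiples n d"
    proof (rule smult_in_subgroup[OF coord(1)[OF xc b] B_carr[OF b] var_multiples_subgroup[OF order_refl]])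
      fix u assume u: "u \<in> keys (coord x b)"
      then have "u \<noteq> 0" using x(2) b by (auto simp: no_constants_def)
      then obtain i where i: "lookup u i \<noteq> 0" by (metis lookup_zero poly_mapping_eqI)
      have un: "keys u \<subseteq> {..<n}" using coord(1)[OF xc b] u by (auto simp: poly_ring_carrier)
      have "i \<in> keys u" using i by (simp add: in_keys_iff)
      then have "i < n" using un by auto
      from i obtain u' where u': "u = u' + single i 1" "keys u' \<subseteq> keys u" by (rule monom_split_variable)
      let ?a = "lookup (coord x b) u"
      have "single u ?a \<odot>\<^bsub>M\<^esub> b = mvar i \<odot>\<^bsub>M\<^esub> (single u' ?a \<odot>\<^bsub>M\<^esub> b)"
        using smult_assoc1[of "mvar i" "single u' ?a" b] mvar_mult_single[of i u' ?a] u' un B_carr[OF b] \<open>i < n\<close>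
        by (simp add: carrier_single)
      moreover have "single u' ?a \<odot>\<^bsub>M\<^esub> b \<in> piece M (d - 1)"
      proof -
        have "int (monom_degree u) + e = d" using coord_homogeneous[OF x(1) b e u] .
        then have "int (monom_degree u') + e = d - 1" unfolding u'(1) by (simp add: monom_degree_add)
        then show ?thesis using piece_single[OF _ e, of u' ?a] u' un by auto
      qed
      ultimately show "single u ?a \<odot>\<^bsub>M\<^esub> b \<in> var_multiples n d" using var_multiples_var[OF \<open>i < n\<close> order_refl] by simp
    qed
  qed
  then show ?thesis using coord(2)[OF xc] by simp
qed

text \<open>Turns the minimality condition of the resolution into the absence of constant terms in
  coordinates.\<close>

lemma irrelevant_span_no_constants:
  "mod_span n M {p \<odot>\<^bsub>M\<^esub> x | p x. p \<in> irrelevant_ideal n \<and> x \<in> carrier M} \<subseteq> no_constants"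
proof -
  have "p \<odot>\<^bsub>M\<^esub> x \<in> no_constants" if p: "p \<in> irrelevant_ideal n" and x: "x \<in> carrier M" for p x
  proof -
    have "0 \<notin> keys p" using irrelevant_ideal_keys(2)[OF p, of 0] by auto
    then show ?thesis using irrelevant_ideal_keys(1)[OF p] x
      by (auto simp: no_constants_def coord_smult dest!: zero_in_keys_mult)
  qed
  then have "no_constants \<in> {N. submodule N (poly_ring n) M \<and> {p \<odot>\<^bsub>M\<^esub> x | p x. p \<in> irrelevant_ideal n \<and> x \<in> carrier M} \<subseteq> N}"
    using no_constants_submodule by auto
  then show ?thesis unfolding mod_span_def by (rule Inter_lower)
qed

lemma koszul_exact_below_top:
  assumes "p < int n" "cochain (carrier M) n p t f" "cocycle n p f"
  shows "\<exists>g. cochain (carrier M) n (p - 1) t g \<and> koszul_bounds n p g f"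
  using koszul_exact_regular[OF regular order_refl assms(2)] assms by auto

lemma koszul_vanishing_below_top: "p < int n \<Longrightarrow> koszul_vanishing (carrier M) p t"
  using koszul_exact_below_top by (auto simp: koszul_vanishing_def)

lemma koszul_exact_top:
  assumes "cochain (carrier M) n (int n) t f" "f (replicate n True) \<in> no_constants"
  shows "\<exists>g. cochain (carrier M) n (int n - 1) t g \<and> koszul_bounds n (int n) g f"
proof -
  have "f (replicate n True) \<in> var_multiples n (t + int n)"
    using assms kcoD[OF assms(1), of "replicate n True"] by (intro no_constants_var_multiples) auto
  then show ?thesis using koszul_exact_regular[OF regular order_refl assms(1)] by auto
qed

text \<open>The top cohomology of a free module is its quotient by the variables. A constant term in
  a coordinate of an element of degree \<open>t + n\<close> forces the basis element to have that
  degree.\<close>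

lemma koszul_vanishing_top: "koszul_vanishing (carrier M) (int n) t \<longleftrightarrow> (\<forall>b\<in>B. b \<notin> piece M (t + int n))"
proof
  assume van: "koszul_vanishing (carrier M) (int n) t"
  show "\<forall>b\<in>B. b \<notin> piece M (t + int n)"
  proof (intro ballI notI)
    fix b assume b: "b \<in> B" "b \<in> piece M (t + int n)"
    have "cochain (carrier M) n (int n) t (\<lambda>_. b)" using b B_carr by (simp add: cochain_def)
    moreover have "cocycle n (int n) (\<lambda>_. b)"
      unfolding cocycle_def
    proof (intro allI impI)
      fix xs :: "bool list" assume "length xs = n" "weight xs = int n + 1"
      then show "koszul_d M xs (\<lambda>_. b) = \<zero>\<^bsub>M\<^esub>" using weight_le_length[of xs] by simp
    qed
    ultimately obtain g where g: "cochain (carrier M) n (int n - 1) t g" "koszul_bounds n (int n) g (\<lambda>_. b)"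
      using van by (auto simp: koszul_vanishing_def)
    then have "b \<in> var_multiples n (t + int n)" using koszul_d_top_var_multiples[OF order_refl g(1)] by (simp add: koszul_bounds_def)
    then have "b \<in> no_constants" by (rule var_multiples_no_constants[OF order_refl])
    then have "0 \<notin> keys (coord b b)" using b by (simp add: no_constants_def)
    then show False using coord_basis[OF b(1)] by simp
  qed
next
  assume nb: "\<forall>b\<in>B. b \<notin> piece M (t + int n)"
  show "koszul_vanishing (carrier M) (int n) t"
    unfolding koszul_vanishing_def
  proof (intro allI impI koszul_exact_top)
    fix f assume f: "cochain (carrier M) n (int n) t f"
    let ?x = "f (replicate n True)"
    have x: "?x \<in> carrier M" "?x \<in> piece M (t + int n)" using kcoD[OF f, of "replicate n True"] by auto
    have "0 \<notin> keys (coord ?x b)" if b: "b \<in> B" for b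
    proof
      assume z: "0 \<in> keys (coord ?x b)"
      obtain e where e: "b \<in> piece M e" using B_homogeneous[OF b] by blast
      from coord_homogeneous[OF x(2) b e z] have "e = t + int n" by simp
      then show False using nb e b by auto
    qed
    then show "?x \<in> no_constants" using x by (simp add: no_constants_def)
  qed
qed

end

subsection \<open>Dimension shifting\<close>

context gmod
begin

lemma koszul_vanishing_above:
  assumes "int n < p" "\<zero>\<^bsub>M\<^esub> \<in> Z" shows "koszul_vanishing Z p t"
  unfolding koszul_vanishing_def
proof (intro allI impI exI conjI)
  fix f
  show "cochain Z n (p - 1) t (\<lambda>_. \<zero>\<^bsub>M\<^esub>)" using assms by (simp add: cochain_def)
  show "koszul_bounds n p (\<lambda>_. \<zero>\<^bsub>M\<^esub>) f"
    unfolding koszul_bounds_def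
  proof (intro allI impI)
    fix xs :: "bool list" assume "length xs = n" "weight xs = p"
    then show "koszul_d M xs (\<lambda>_. \<zero>\<^bsub>M\<^esub>) = f xs" using weight_le_length[of xs] assms by simp
  qed
qed

end

text \<open>An injective \<open>h\<close> identifies cochains with their images. It is used to
  replace \<open>M\<close> by its copy inside the first injective module.\<close>

lemma (in ghom) koszul_vanishing_inj_iff:
  assumes inj: "inj_on h (carrier M)"
  shows "M.koszul_vanishing (carrier M) p t \<longleftrightarrow> N.koszul_vanishing (h ` carrier M) p t"
proof
  assume van: "M.koszul_vanishing (carrier M) p t"
  have "cocycles_lift p t"
    unfolding cocycles_lift_def
  proof (intro allI impI)
    fix f assume f: "N.cochain (h ` carrier M) n p t f" "N.cocycle n p f"
    obtain g where g: "M.cochain (carrier M) n p t g" "\<And>xs. length xs = n \<Longrightarrow> weight xs = p \<Longrightarrow> h (g xs) = f xs"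
      using cochain_lift[OF f(1)] by blast
    have "M.cocycle n p g"
      unfolding M.cocycle_def
    proof (intro allI impI)
      fix xs assume xs: "length xs = n" "weight xs = p + 1"
      have "h (koszul_d M xs g) = h \<zero>\<^bsub>M\<^esub>"
        using koszul_d_hom_cochain[OF g(1) xs g(2)] f(2) xs by (simp add: N.cocycle_def)
      then show "koszul_d M xs g = \<zero>\<^bsub>M\<^esub>"
        using inj_onD[OF inj] M.koszul_d_carr_cochain[OF g(1) order_refl xs] by simp
    qed
    then show "\<exists>g. M.cochain (carrier M) n p t g \<and> M.cocycle n p g \<and> (\<forall>xs. length xs = n \<longrightarrow> weight xs = p \<longrightarrow> h (g xs) = f xs)"
      using g by blast
  qed
  then show "N.koszul_vanishing (h ` carrier M) p t" using cocycles_lift_iff_koszul_vanishing[OF van] by simp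
next
  assume van: "N.koszul_vanishing (h ` carrier M) p t"
  show "M.koszul_vanishing (carrier M) p t"
    unfolding M.koszul_vanishing_def
  proof (intro allI impI)
    fix f assume f: "M.cochain (carrier M) n p t f" "M.cocycle n p f"
    have "N.cocycle n p (\<lambda>xs. h (f xs))"
      unfolding N.cocycle_def
    proof (intro allI impI)
      fix xs assume xs: "length xs = n" "weight xs = p + 1"
      show "koszul_d N xs (\<lambda>xs. h (f xs)) = \<zero>\<^bsub>N\<^esub>"
        using koszul_d_hom_cochain[OF f(1) xs, of "\<lambda>xs. h (f xs)"] f(2) xs by (simp add: M.cocycle_def)
    qed
    then obtain k where k: "N.cochain (h ` carrier M) n (p - 1) t k" "N.koszul_bounds n p k (\<lambda>xs. h (f xs))"
      using van cochain_hom[OF f(1)] unfolding N.koszul_vanishing_def by blast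
    obtain g where g: "M.cochain (carrier M) n (p - 1) t g"
      "\<And>xs. length xs = n \<Longrightarrow> weight xs = p - 1 \<Longrightarrow> h (g xs) = k xs"
      using cochain_lift[OF k(1)] by blast
    have "koszul_d M xs g = f xs" if xs: "length xs = n" "weight xs = p" for xs
    proof -
      have xs': "weight xs = p - 1 + 1" using xs by simp
      have "h (koszul_d M xs g) = h (f xs)"
        using koszul_d_hom_cochain[OF g(1) xs(1) xs' g(2)] k(2) xs by (simp add: N.koszul_bounds_def)
      then show ?thesis
        using inj_onD[OF inj] M.koszul_d_carr_cochain[OF g(1) order_refl xs(1) xs'] M.kcoD[OF f(1) xs] by simp
    qed
    then show "\<exists>g. M.cochain (carrier M) n (p - 1) t g \<and> M.koszul_bounds n p g f"
      using g(1) unfolding M.koszul_bounds_def by blast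
  qed
qed

section \<open>Dimension shifting along the injective resolution\<close>

locale injective_resolution = injective_complex +
  assumes exact: "\<delta> i ` carrier (E i) = ker_on (E (Suc i)) (E (Suc (Suc i))) (\<delta> (Suc i))"
begin

lemma kernel_Suc: "D.kernel (Suc i) = \<delta> i ` carrier (E i)"
  using exact[of i] by (simp add: D.kernel_def ker_on_def)

lemma E_koszul_vanishing:
  assumes "1 \<le> p" shows "E.koszul_vanishing i (carrier (E i)) p t"
proof -
  have div: "\<exists>d\<in>piece (E i) e. mvar j \<odot>\<^bsub>E i\<^esub> d = c \<and> (\<forall>l<j. mvar l \<odot>\<^bsub>E i\<^esub> d = \<zero>\<^bsub>E i\<^esub>)"
    if "j < n" "c \<in> piece (E i) (e + 1)" "\<And>l. l < j \<Longrightarrow> mvar l \<odot>\<^bsub>E i\<^esub> c = \<zero>\<^bsub>E i\<^esub>" for j e c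
    using graded_injective_divisible_torsion[OF inj that] by blast
  show ?thesis
    unfolding E.koszul_vanishing_def using E.koszul_exact_divisible[OF div order_refl assms] by blast
qed

text \<open>By exactness, a cocycle of the socle complex is a Koszul 0-cocycle with values in the
  image of the previous differential. That it bounds in the socle complex means that it lifts to a
  0-cocycle.\<close>

lemma socle_Suc_iff:
  "(\<forall>z\<in>C n (Suc i) t. \<delta> (Suc i) z = \<zero>\<^bsub>E (Suc (Suc i))\<^esub> \<longrightarrow> cobounds n (Suc i) t z) \<longleftrightarrow> D.cocycles_lift i 0 t"
proof
  let ?o = "replicate n False"
  assume soc: "\<forall>z\<in>C n (Suc i) t. \<delta> (Suc i) z = \<zero>\<^bsub>E (Suc (Suc i))\<^esub> \<longrightarrow> cobounds n (Suc i) t z"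
  show "D.cocycles_lift i 0 t"
    unfolding D.cocycles_lift_def
  proof (intro allI impI)
    fix f assume f: "E.cochain (Suc i) (\<delta> i ` carrier (E i)) n 0 t f" "E.cocycle (Suc i) n 0 f"
    have fo: "f ?o \<in> \<delta> i ` carrier (E i)" "f ?o \<in> piece (E (Suc i)) t"
      using E.kcoD[OF f(1), of ?o] by auto
    have foc: "f ?o \<in> carrier (E (Suc i))" using E.piece_carr[OF fo(2)] .
    have "f ?o \<in> C n (Suc i) t" using E.cocycle_0_iff[OF order_refl, of f "Suc i"] foc f(2) fo(2) by (simp add: C_top)
    moreover have "\<delta> (Suc i) (f ?o) = \<zero>\<^bsub>E (Suc (Suc i))\<^esub>" using fo(1) exact[of i] by (auto simp: ker_on_def)
    ultimately obtain w where w: "w \<in> C n i t" "\<delta> i w = f ?o" using soc by (auto simp: cobounds_def)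
    have wc: "w \<in> carrier (E i)" using C_carr[OF w(1)] .
    show "\<exists>g. E.cochain i (carrier (E i)) n 0 t g \<and> E.cocycle i n 0 g \<and> (\<forall>xs. length xs = n \<longrightarrow> weight xs = 0 \<longrightarrow> \<delta> i (g xs) = f xs)"
    proof (intro exI[of _ "\<lambda>_. w"] conjI allI impI)
      show "E.cochain i (carrier (E i)) n 0 t (\<lambda>_. w)" using w wc by (simp add: E.cochain_def C_top)
      show "E.cocycle i n 0 (\<lambda>_. w)" using E.cocycle_0_iff[OF order_refl, of "\<lambda>_. w" i] w wc by (simp add: C_top)
      fix xs :: "bool list" assume "length xs = n" "weight xs = 0"
      then show "\<delta> i w = f xs" using weight_eq_0[of xs] w(2) by simp
    qed
  qed
next
  let ?o = "replicate n False"
  assume li: "D.cocycles_lift i 0 t"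
  show "\<forall>z\<in>C n (Suc i) t. \<delta> (Suc i) z = \<zero>\<^bsub>E (Suc (Suc i))\<^esub> \<longrightarrow> cobounds n (Suc i) t z"
  proof (intro ballI impI)
    fix z assume z: "z \<in> C n (Suc i) t" "\<delta> (Suc i) z = \<zero>\<^bsub>E (Suc (Suc i))\<^esub>"
    have zc: "z \<in> carrier (E (Suc i))" using C_carr[OF z(1)] .
    have "z \<in> \<delta> i ` carrier (E i)" using exact[of i] z zc by (simp add: ker_on_def)
    then have "E.cochain (Suc i) (\<delta> i ` carrier (E i)) n 0 t (\<lambda>_. z)" using z(1) by (simp add: E.cochain_def C_top)
    moreover have "E.cocycle (Suc i) n 0 (\<lambda>_. z)"
      using E.cocycle_0_iff[OF order_refl, of "\<lambda>_. z" "Suc i"] z zc by (simp add: C_top)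
    ultimately obtain g where g: "E.cochain i (carrier (E i)) n 0 t g" "E.cocycle i n 0 g"
      "\<And>xs. length xs = n \<Longrightarrow> weight xs = 0 \<Longrightarrow> \<delta> i (g xs) = z"
      using li unfolding D.cocycles_lift_def by blast
    have go: "g ?o \<in> carrier (E i)" "g ?o \<in> piece (E i) t" using E.kcoD[OF g(1), of ?o] by auto
    have "g ?o \<in> C n i t" using E.cocycle_0_iff[OF order_refl, of g i] go(1) g(2) go(2) by (simp add: C_top)
    then show "cobounds n (Suc i) t z" using g(3)[of ?o] by (auto simp: cobounds_def)
  qed
qed

text \<open>Neither side has nonzero coboundaries in degree 0, so both say that the kernel has no
  socle in degree \<open>t\<close>.\<close>

lemma socle_0_iff:
  "(\<forall>z\<in>C n 0 t. \<delta> 0 z = \<zero>\<^bsub>E (Suc 0)\<^esub> \<longrightarrow> cobounds n 0 t z) \<longleftrightarrow> E.koszul_vanishing 0 (D.kernel 0) 0 t"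
proof
  let ?o = "replicate n False"
  assume soc: "\<forall>z\<in>C n 0 t. \<delta> 0 z = \<zero>\<^bsub>E (Suc 0)\<^esub> \<longrightarrow> cobounds n 0 t z"
  show "E.koszul_vanishing 0 (D.kernel 0) 0 t"
    unfolding E.koszul_vanishing_def
  proof (intro allI impI exI conjI)
    fix f assume f: "E.cochain 0 (D.kernel 0) n 0 t f" "E.cocycle 0 n 0 f"
    have fo: "f ?o \<in> D.kernel 0" "f ?o \<in> piece (E 0) t"
      using E.kcoD[OF f(1), of ?o] by auto
    have foc: "f ?o \<in> carrier (E 0)" using E.piece_carr[OF fo(2)] .
    have "f ?o \<in> C n 0 t" using E.cocycle_0_iff[OF order_refl, of f 0] foc f(2) fo(2) by (simp add: C_top)
    then have z: "f ?o = \<zero>\<^bsub>E 0\<^esub>" using soc fo(1) by (auto simp: cobounds_def D.kernel_def)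
    show "E.cochain 0 (D.kernel 0) n (0 - 1) t (\<lambda>_. \<zero>\<^bsub>E 0\<^esub>)" by (simp add: E.cochain_def D.kernel_def)
    show "E.koszul_bounds 0 n 0 (\<lambda>_. \<zero>\<^bsub>E 0\<^esub>) f"
      unfolding E.koszul_bounds_def
    proof (intro allI impI)
      fix xs :: "bool list" assume "length xs = n" "weight xs = 0"
      then show "koszul_d (E 0) xs (\<lambda>_. \<zero>\<^bsub>E 0\<^esub>) = f xs" using weight_eq_0[of xs] z E.koszul_d_weight_0[of xs 0] by simp
    qed
  qed
next
  let ?o = "replicate n False"
  assume van: "E.koszul_vanishing 0 (D.kernel 0) 0 t"
  show "\<forall>z\<in>C n 0 t. \<delta> 0 z = \<zero>\<^bsub>E (Suc 0)\<^esub> \<longrightarrow> cobounds n 0 t z"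
  proof (intro ballI impI)
    fix z assume z: "z \<in> C n 0 t" "\<delta> 0 z = \<zero>\<^bsub>E (Suc 0)\<^esub>"
    have zc: "z \<in> carrier (E 0)" using C_carr[OF z(1)] .
    have "E.cochain 0 (D.kernel 0) n 0 t (\<lambda>_. z)" using z zc by (simp add: E.cochain_def C_top D.kernel_def)
    moreover have "E.cocycle 0 n 0 (\<lambda>_. z)"
      using E.cocycle_0_iff[OF order_refl, of "\<lambda>_. z" 0] z zc by (simp add: C_top)
    ultimately obtain g where "E.koszul_bounds 0 n 0 g (\<lambda>_. z)" using van unfolding E.koszul_vanishing_def by blast
    then have "koszul_d (E 0) ?o g = z" by (simp add: E.koszul_bounds_def)
    then show "cobounds n 0 t z" using E.koszul_d_weight_0[of ?o 0 g] by (simp add: cobounds_def)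
  qed
qed

lemma koszul_vanishing_kernel_cocycles_lift:
  assumes "0 \<le> p" shows "E.koszul_vanishing i (D.kernel i) (p + 1) t \<longleftrightarrow> D.cocycles_lift i p t"
proof (rule D.koszul_vanishing_kernel_iff_cocycles_lift)
  fix f assume f: "E.cochain i (D.kernel i) n (p + 1) t f" "E.cocycle i n (p + 1) f"
  then show "\<exists>g. E.cochain i (carrier (E i)) n p t g \<and> E.koszul_bounds i n (p + 1) g f"
    using E_koszul_vanishing[of "p + 1" i t] E.cochain_mono[OF f(1) D.kernel_sub] assms
    unfolding E.koszul_vanishing_def by auto
qed

lemma koszul_vanishing_kernel_shift:
  assumes "1 \<le> p" shows "E.koszul_vanishing (Suc i) (D.kernel (Suc i)) p t \<longleftrightarrow> E.koszul_vanishing i (D.kernel i) (p + 1) t"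
  using koszul_vanishing_kernel_cocycles_lift[of p i t] D.cocycles_lift_iff_koszul_vanishing[OF E_koszul_vanishing[OF assms]] assms
  by (simp add: kernel_Suc)

lemma koszul_vanishing_kernel_shift_0:
  assumes "1 \<le> p" shows "E.koszul_vanishing i (D.kernel i) p t \<longleftrightarrow> E.koszul_vanishing 0 (D.kernel 0) (p + int i) t"
  using assms
proof (induction i arbitrary: p)
  case (Suc i)
  then show ?case using koszul_vanishing_kernel_shift[of p i t] Suc.IH[of "p + 1"] by (simp add: algebra_simps)
qed simp

text \<open>Socle cohomology in degree \<open>r + 1\<close> matches the first Koszul cohomology of
  the \<open>r\<close>-th kernel; \<open>r\<close> shifts carry it to Koszul cohomology of the
  zeroth kernel in degree \<open>r + 1\<close>.\<close>

lemma socle_acyclic_iff: "acyclic_at n t \<longleftrightarrow> (\<forall>p::nat. E.koszul_vanishing 0 (D.kernel 0) (int p) t)"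
proof -
  have "(\<forall>z\<in>C n i t. \<delta> i z = \<zero>\<^bsub>E (Suc i)\<^esub> \<longrightarrow> cobounds n i t z) \<longleftrightarrow> E.koszul_vanishing 0 (D.kernel 0) (int i) t" for i
  proof (cases i)
    case 0
    then show ?thesis using socle_0_iff by simp
  next
    case (Suc r)
    have "D.cocycles_lift r 0 t \<longleftrightarrow> E.koszul_vanishing 0 (D.kernel 0) (int i) t"
      using koszul_vanishing_kernel_cocycles_lift[of 0 r t] koszul_vanishing_kernel_shift_0[of 1 r t] by (simp add: Suc)
    then show ?thesis using socle_Suc_iff[of r t] by (simp add: Suc)
  qed
  then show ?thesis by (simp add: acyclic_at_def)
qed

end

text \<open>
  Minimality enters here: cochains with values in the kernel bound even in the top degree, where the
  Koszul complex of a free module is not exact.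
\<close>

locale minimal_cover = ghom n M N h + F: free_gmod n M B
  for n and M :: "('k::field mpoly, 'b) graded_module" and N :: "('k mpoly, 'c) graded_module" and h B +
  assumes kernel_no_constants: "kernel \<subseteq> F.no_constants"
begin

lemma kernel_cochain_exact:
  assumes "p \<le> int n" "M.cochain kernel n p t f" "M.cocycle n p f"
  shows "\<exists>g. M.cochain (carrier M) n (p - 1) t g \<and> M.koszul_bounds n p g f"
proof (cases "p = int n")
  case True
  then show ?thesis
    using F.koszul_exact_top[of t f] M.cochain_mono[OF assms(2) kernel_sub] kernel_no_constants
      M.kcoD[OF assms(2), of "replicate n True"] by auto
next
  case False
  then show ?thesis
    using F.koszul_exact_below_top[of p t f] M.cochain_mono[OF assms(2) kernel_sub] assms by auto
qed

lemma koszul_vanishing_shift: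
  assumes "p < int n" shows "N.koszul_vanishing (h ` carrier M) p t \<longleftrightarrow> M.koszul_vanishing kernel (p + 1) t"
proof -
  have "M.koszul_vanishing kernel (p + 1) t \<longleftrightarrow> cocycles_lift p t"
    by (rule koszul_vanishing_kernel_iff_cocycles_lift) (use kernel_cochain_exact[of "p + 1"] assms in auto)
  then show ?thesis using cocycles_lift_iff_koszul_vanishing[OF F.koszul_vanishing_below_top[OF assms]] by simp
qed

text \<open>By minimality the kernel contributes nothing to the top cohomology of the free module,
  so covering module and image have the same top vanishing.\<close>

lemma koszul_vanishing_top_cover: "N.koszul_vanishing (h ` carrier M) (int n) t \<longleftrightarrow> (\<forall>b\<in>B. b \<notin> piece M (t + int n))"
proof -
  have cl: "M.cocycle n (int n) f" for f
    unfolding M.cocycle_def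
  proof (intro allI impI)
    fix xs :: "bool list" assume "length xs = n" "weight xs = int n + 1"
    then show "koszul_d M xs f = \<zero>\<^bsub>M\<^esub>" using weight_le_length[of xs] by simp
  qed
  have "M.koszul_vanishing (carrier M) (int n) t \<longleftrightarrow> N.koszul_vanishing (h ` carrier M) (int n) t"
    by (rule koszul_vanishing_top_iff) (use kernel_cochain_exact[of "int n"] cl in auto)
  then show ?thesis using F.koszul_vanishing_top by simp
qed

text \<open>The primitive has degree -1, and no list has negative weight. So it is vacuously a
  cochain with values in the kernel.\<close>

lemma koszul_vanishing_kernel_0: "M.koszul_vanishing kernel 0 t"
  unfolding M.koszul_vanishing_def
proof (intro allI impI)
  fix f assume f: "M.cochain kernel n 0 t f" "M.cocycle n 0 f"
  then obtain g where g: "M.koszul_bounds n 0 g f" using kernel_cochain_exact[of 0 t f] by auto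
  have "M.cochain kernel n (0 - 1) t g"
    unfolding M.cochain_def
  proof (intro allI impI)
    fix xs :: "bool list" assume "weight xs = 0 - 1"
    then show "g xs \<in> kernel \<and> g xs \<in> piece M (t + (0 - 1))" using weight_nonneg[of xs] by simp
  qed
  then show "\<exists>g. M.cochain kernel n (0 - 1) t g \<and> M.koszul_bounds n 0 g f" using g by blast
qed

end

text \<open>\<open>V q p\<close> stands for vanishing in Koszul degree \<open>p\<close> for the
  \<open>q\<close>-th syzygy. It is constant along diagonals up to \<open>p = n\<close>: the
  diagonal from \<open>(0, p)\<close> ends at \<open>(n - p, n)\<close>, and a diagonal starting at
  some \<open>(Suc r, 0)\<close> is true throughout.\<close>

lemma shift_chain:
  fixes V :: "nat \<Rightarrow> int \<Rightarrow> bool"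
  assumes step: "\<And>q p. p < int n \<Longrightarrow> V q p \<longleftrightarrow> V (Suc q) (p + 1)"
    and zero: "\<And>q. V (Suc q) 0" and above: "\<And>p. int n < p \<Longrightarrow> V 0 p"
  shows "(\<forall>p::nat. V 0 (int p)) \<longleftrightarrow> (\<forall>q. V q (int n))"
proof -
  have chain: "p + int k \<le> int n \<Longrightarrow> V q p \<longleftrightarrow> V (q + k) (p + int k)" for q p k
  proof (induction k)
    case (Suc k)
    then show ?case using step[of "p + int k" "q + k"] by (simp add: algebra_simps)
  qed simp
  show ?thesis
  proof (intro iffI allI)
    fix q assume V: "\<forall>p::nat. V 0 (int p)"
    show "V q (int n)"
    proof (cases "q \<le> n")
      case True
      then show ?thesis using chain[of "int (n - q)" q 0] V[rule_format, of "n - q"] by simp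
    next
      case False
      then obtain r where "q = Suc r + n" using less_imp_Suc_add[of n q] by auto
      then show ?thesis using chain[of 0 n "Suc r"] zero[of r] by simp
    qed
  next
    fix p :: nat assume V: "\<forall>q. V q (int n)"
    show "V 0 (int p)"
    proof (cases "p \<le> n")
      case True
      then show ?thesis using chain[of "int p" "n - p" 0] V by (simp add: of_nat_diff)
    qed (simp add: above)
  qed
qed

lemma SUP_int_le:
  fixes X Y :: "int set"
  assumes "\<And>a. (\<forall>t>a. t \<notin> Y) \<Longrightarrow> (\<forall>t>a. t \<notin> X)"
  shows "(SUP t\<in>X. ereal (of_int t)) \<le> (SUP t\<in>Y. ereal (of_int t))"
proof (rule SUP_least)
  fix t assume "t \<in> X"
  \<comment> \<open>The bound \<open>t - 1\<close> makes \<open>t\<close> itself an admissible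
    degree, and integrality returns an \<open>s\<close> in \<open>Y\<close> with
    \<open>t \<le> s\<close>.\<close>
  then have "\<not> (\<forall>s>t - 1. s \<notin> X)" by force
  then have "\<not> (\<forall>s>t - 1. s \<notin> Y)" using assms by blast
  then obtain s where "s \<in> Y" "t \<le> s" by force
  then show "ereal (of_int t) \<le> (SUP t\<in>Y. ereal (of_int t))" by (intro SUP_upper2[of s]) auto
qed

lemma SUP_int_Union:
  "(SUP i. Sup {ereal (of_int t) | t. P i t}) = (SUP t\<in>{t. \<exists>i. P i t}. ereal (of_int t))"
proof (rule antisym)
  show "(SUP i. Sup {ereal (of_int t) | t. P i t}) \<le> (SUP t\<in>{t. \<exists>i. P i t}. ereal (of_int t))"
    by (intro SUP_least Sup_least) (auto intro: SUP_upper)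
  show "(SUP t\<in>{t. \<exists>i. P i t}. ereal (of_int t)) \<le> (SUP i. Sup {ereal (of_int t) | t. P i t})"
  proof (rule SUP_least)
    fix t assume "t \<in> {t. \<exists>i. P i t}"
    then obtain i where "P i t" by blast
    then have "ereal (of_int t) \<le> Sup {ereal (of_int t) | t. P i t}" by (intro Sup_upper) blast
    also have "\<dots> \<le> (SUP i. Sup {ereal (of_int t) | t. P i t})" by (rule SUP_upper) simp
    finally show "ereal (of_int t) \<le> (SUP i. Sup {ereal (of_int t) | t. P i t})" .
  qed
qed

theorem theorem4p1:
  fixes n :: nat
    and M :: "('k::field mpoly, 'm) graded_module"
    and E :: "nat \<Rightarrow> ('k mpoly, 'e) graded_module"
    and \<delta> :: "nat \<Rightarrow> 'e \<Rightarrow> 'e"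
    and \<eta> :: "'m \<Rightarrow> 'e"
    and F :: "nat \<Rightarrow> ('k mpoly, 'f) graded_module"
    and \<phi> :: "nat \<Rightarrow> 'f \<Rightarrow> 'f"
    and \<epsilon> :: "'f \<Rightarrow> 'm"
    and B :: "nat \<Rightarrow> 'f set"
  assumes "graded_module n M"
    and "finitely_generated n M"
    and "graded_injective_resolution n M E \<delta> \<eta>"
    and "minimal_graded_free_resolution n M F \<phi> \<epsilon> B"
  shows "a_star n E \<delta> = (SUP i. b_invariant F B i) - ereal (real n)"
proof -
  have R: "\<And>i. graded_injective n (E i)" "\<eta> \<in> graded_hom n M (E 0)"
    "\<And>i. \<delta> i \<in> graded_hom n (E i) (E (Suc i))" "inj_on \<eta> (carrier M)"
    "\<eta> ` carrier M = ker_on (E 0) (E 1) (\<delta> 0)"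
    "\<And>i. \<delta> i ` carrier (E i) = ker_on (E (Suc i)) (E (Suc (Suc i))) (\<delta> (Suc i))"
    using assms(3) unfolding graded_injective_resolution_def by iprover+
  have S: "\<And>i. graded_module n (F i)" "\<And>i. homogeneous_basis n (F i) (B i)"
    "\<epsilon> \<in> graded_hom n (F 0) M" "\<And>i. \<phi> i \<in> graded_hom n (F (Suc i)) (F i)"
    "\<epsilon> ` carrier (F 0) = carrier M" "\<phi> 0 ` carrier (F 1) = ker_on (F 0) M \<epsilon>"
    "\<And>i. \<phi> (Suc i) ` carrier (F (Suc (Suc i))) = ker_on (F (Suc i)) (F i) (\<phi> i)"
    "\<And>i. \<phi> i ` carrier (F (Suc i)) \<subseteq>
        mod_span n (F i) {p \<odot>\<^bsub>F i\<^esub> x | p x. p \<in> irrelevant_ideal n \<and> x \<in> carrier (F i)}"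
    using assms(4) unfolding minimal_graded_free_resolution_def by iprover+
  interpret M: gmod n M by unfold_locales (rule assms(1))
  interpret I: injective_resolution n E \<delta>
  proof
    show "\<delta> (Suc i) (\<delta> i x) = \<zero>\<^bsub>E (Suc (Suc i))\<^esub>" if "x \<in> carrier (E i)" for i x
      using R(6)[of i] that by (auto simp: ker_on_def)
  qed (rule R)+
  interpret H: ghom n M "E 0" \<eta> by unfold_locales (rule R)
  interpret F: free_gmod n "F i" "B i" for i by unfold_locales (rule S)+
  interpret G: ghom n "F (Suc i)" "F i" "\<phi> i" for i by unfold_locales (rule S)
  interpret eps: ghom n "F 0" M \<epsilon> by unfold_locales (rule S)
  have min: "\<phi> i ` carrier (F (Suc i)) \<subseteq> F.no_constants i" for i
    using S(8)[of i] F.irrelevant_span_no_constants[of i] by (rule subset_trans)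
  have ker_eps: "\<phi> 0 ` carrier (F (Suc 0)) = eps.kernel"
    using S(6) by (simp add: eps.kernel_def ker_on_def)
  have ker_phi: "\<phi> (Suc i) ` carrier (F (Suc (Suc i))) = G.kernel i" for i
    using S(7) by (simp add: G.kernel_def ker_on_def)
  interpret P0: minimal_cover n "F 0" M \<epsilon> "B 0"
    by unfold_locales (use min[of 0] ker_eps in simp)
  interpret P: minimal_cover n "F (Suc i)" "F i" "\<phi> i" "B (Suc i)" for i
    by unfold_locales (use min[of "Suc i"] ker_phi in simp)
  have key: "I.acyclic_at n t \<longleftrightarrow> (\<forall>i. \<forall>b\<in>B i. b \<notin> piece (F i) (t + int n))" for t
  proof -
    \<comment> \<open>The zeroth syzygy is \<open>M\<close>; every later one is the kernel inside
      the preceding free module.\<close>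
    define V where "V q p = (case q of 0 \<Rightarrow> M.koszul_vanishing (carrier M) p t
      | Suc r \<Rightarrow> (case r of 0 \<Rightarrow> F.koszul_vanishing 0 eps.kernel p t | Suc s \<Rightarrow> F.koszul_vanishing (Suc s) (G.kernel s) p t))" for q p
    have "I.D.kernel 0 = \<eta> ` carrier M" using R(5) by (simp add: I.D.kernel_def ker_on_def)
    then have "I.acyclic_at n t \<longleftrightarrow> (\<forall>p::nat. V 0 (int p))"
      using I.socle_acyclic_iff[of t] H.koszul_vanishing_inj_iff[OF R(4), of _ t] by (simp add: V_def)
    also have "\<dots> \<longleftrightarrow> (\<forall>q. V q (int n))"
    proof (rule shift_chain)
      show "V q p \<longleftrightarrow> V (Suc q) (p + 1)" if p: "p < int n" for q p
        using P0.koszul_vanishing_shift[OF p, of t] P.koszul_vanishing_shift[OF p, of 0 t] P.koszul_vanishing_shift[OF p, of "Suc _" t]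
        by (auto simp: V_def S(5) ker_eps ker_phi split: nat.split)
      show "V (Suc q) 0" for q
        using P0.koszul_vanishing_kernel_0 P.koszul_vanishing_kernel_0 by (simp add: V_def split: nat.split)
      show "V 0 p" if "int n < p" for p using M.koszul_vanishing_above[OF that] by (simp add: V_def)
    qed
    also have "\<dots> \<longleftrightarrow> (\<forall>i. \<forall>b\<in>B i. b \<notin> piece (F i) (t + int n))"
    proof -
      have "V q (int n) \<longleftrightarrow> (\<forall>b\<in>B q. b \<notin> piece (F q) (t + int n))" for q
        using P0.koszul_vanishing_top_cover[of t] P.koszul_vanishing_top_cover[of 0 t] P.koszul_vanishing_top_cover[of "Suc _" t]
        by (auto simp: V_def S(5) ker_eps ker_phi split: nat.split)
      then show ?thesis by simp
    qed
    finally show ?thesis .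
  qed
  define X where "X = {t. \<exists>i. local_cohomology_nonzero n E \<delta> i t}"
  define Y where "Y = {d. \<exists>i. \<exists>b\<in>B i. b \<in> piece (F i) d}"
  define Y' where "Y' = {t. t + int n \<in> Y}"
  \<comment> \<open>\<open>X\<close> and \<open>Y'\<close> are only shown to have the same integer
    upper bounds, since \<open>acyclic_above_iff\<close> compares vanishing above a bound.\<close>
  have XY: "(\<forall>t>a. t \<notin> X) \<longleftrightarrow> (\<forall>t>a. t \<notin> Y')" for a
    using I.acyclic_above_iff[of a] key I.acyclic_at_0_iff by (simp add: X_def Y_def Y'_def)
  have "a_star n E \<delta> = (SUP t\<in>X. ereal (of_int t))"
    unfolding a_star_def a_invariant_def
    by (subst SUP_int_Union) (simp add: X_def)
  also have "\<dots> = (SUP t\<in>Y'. ereal (of_int t))"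
    by (intro antisym SUP_int_le) (use XY in blast)+
  \<comment> \<open>Translation by the finite number \<open>n\<close>, done by two inequalities so
    that an infinite supremum is covered as well.\<close>
  also have "\<dots> = (SUP d\<in>Y. ereal (of_int d)) - ereal (real n)"
  proof (rule antisym)
    show "(SUP t\<in>Y'. ereal (of_int t)) \<le> (SUP d\<in>Y. ereal (of_int d)) - ereal (real n)"
    proof (rule SUP_least)
      fix t assume "t \<in> Y'"
      then have "ereal (of_int (t + int n)) \<le> (SUP d\<in>Y. ereal (of_int d))"
        by (intro SUP_upper) (simp add: Y'_def)
      then show "ereal (of_int t) \<le> (SUP d\<in>Y. ereal (of_int d)) - ereal (real n)"
        by (simp add: ereal_le_minus_iff)
    qed
    have "(SUP d\<in>Y. ereal (of_int d)) \<le> (SUP t\<in>Y'. ereal (of_int t)) + ereal (real n)"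
    proof (rule SUP_least)
      fix d assume "d \<in> Y"
      then have "ereal (of_int (d - int n)) \<le> (SUP t\<in>Y'. ereal (of_int t))"
        by (intro SUP_upper) (simp add: Y'_def)
      from add_right_mono[OF this, of "ereal (real n)"]
      show "ereal (of_int d) \<le> (SUP t\<in>Y'. ereal (of_int t)) + ereal (real n)" by simp
    qed
    then show "(SUP d\<in>Y. ereal (of_int d)) - ereal (real n) \<le> (SUP t\<in>Y'. ereal (of_int t))"
      by (simp add: ereal_minus_le_iff add.commute)
  qed
  also have "(SUP d\<in>Y. ereal (of_int d)) = (SUP i. b_invariant F B i)"
    unfolding b_invariant_def
    by (subst SUP_int_Union) (simp add: Y_def)
  finally show ?thesis .
qed

end
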